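(* Let $-1\le\alpha\le0\le\beta\le1$, let $\sigma$ be a finite nonnegative measure with infinite support on $E=[-1,\alpha]\cup[\beta,1]$, and let $$\mathfrak F(\lambda)=\int_E\frac{t\,d\sigma(t)}{t-\lambda}\in\mathbf D^-_{-\infty},\qquad F(\lambda)=\int_E\frac{d\sigma(t)}{t-\lambda}.$$ Let $\{\mathfrak n_j\}_{j\ge1}$ be the normal indices of the coefficient sequence $\mathfrak s_j=\int_Et^{j+1}d\sigma(t)$, $j\in\mathbb Z_+$, of $\mathfrak F$, and $\mathfrak n_0=0$. Then the following statements are equivalent: (i) for $\mathfrak s_{-1}:=\int_Ed\sigma(t)$, the operator $U=U(\mathfrak s_{-1})$ in the block $UL$-factorization $\mathfrak J=UL$ (with parameter $\mathfrak s_{-1}$) of the monic generalized Jacobi matrix $\mathfrak J$ associated with $\mathfrak F$ is bounded in $\ell^2_{[0,\infty)}$; (ii) the operator $U$ in the block $LU$-factorization $J=LU$ of the monic Jacobi matrix $J$ associated with $F$ is bounded in $\ell^2_{[0,\infty)}$; (iii) the sequence $\{\mathfrak F^{[\mathfrak n_j/\mathfrak n_j]}\}_{j=0}^\infty$ of diagonal Padé approximants converges to $\mathfrak F$ locally uniformly in $\widehat{\mathbb C}\setminus([-1-\varepsilon,\alpha]\cup[\beta,1+\varepsilon])$ for some $\varepsilon\ge0$.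
   Context: $\widehat{\mathbb C}=\mathbb C\cup\{\infty\}$ with the spherical metric. $\lambda\widehat\to\infty$ means that $\lambda\to\infty$ inside a sector $\varepsilon<\arg\lambda<\pi-\varepsilon$, $\varepsilon>0$; $\mathfrak F(\lambda)\sim-\sum_j\mathfrak s_j\lambda^{-j-1}$ denotes the asymptotic expansion to all orders as $\lambda\widehat\to\infty$. $\mathbf N_{-\infty}$ is the class of functions $\int_{\mathbb R}\frac{d\mu(t)}{t-\lambda}$ with $\mu$ a finite measure with all moments finite. $\mathbf D^-_{-\infty}$: functions $\mathfrak F$ meromorphic in $\mathbb C_+$ such that for some $\mathfrak s_{-1}\in\mathbb R\setminus\{0\}$ one has $-\frac{\mathfrak s_{-1}}{\lambda}+\frac{\mathfrak F(\lambda)}{\lambda}\in\mathbf N_{-\infty}$. Padé approximants: for a formal power series $\mathfrak F=-\sum_{j\ge0}\mathfrak s_j\lambda^{-j-1}$, the $[L/M]$ approximant is a ratio $A(1/\lambda)/B(1/\lambda)$ of polynomials of formal degrees $L$ and $M$ with $B(0)\neq0$ and $\sum_{j=0}^{L+M-1}\mathfrak s_j\lambda^{-j-1}+\mathfrak F^{[L/M]}(\lambda)=O(\lambda^{-L-M-1})$, $\lambda\to\infty$. Jacobi matrix: $s_j=\int t^jd\sigma$; the monic orthogonal polynomials $P_j$ of $\sigma/s_0$ satisfy $\lambda P_j=P_{j+1}+b_jP_j+c_{j-1}P_{j-1}$, $P_{-1}=0$, $P_0=1$; the monic Jacobi matrix associated with $F$ has $J_{j,j}=b_j$, $J_{j,j+1}=1$,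 $J_{j+1,j}=c_j$. Normal indices of $\{\mathfrak s_j\}_{j\ge0}$: integers $n\ge1$ with $\det(\mathfrak s_{i+k})_{i,k=0}^{n-1}\ne0$, listed increasingly $\mathfrak n_1<\mathfrak n_2<\dots$; $\mathfrak n_0=0$, $\mathfrak k_j=\mathfrak n_{j+1}-\mathfrak n_j\in\{1,2\}$. Generalized Jacobi matrix: $\mathfrak F$ (nonrational) is normalized if its first nonzero coefficient $\mathfrak s_{\mathfrak n_1-1}$ has modulus $1$. For normalized $\mathfrak F$ put $\mathfrak F_0=\mathfrak F$ and recursively $-1/\mathfrak F_j(\lambda)=\epsilon_j\mathfrak p_j(\lambda)+\mathfrak b_j^2\mathfrak F_{j+1}(\lambda)$, where $\epsilon_j=\pm1$ is the first nonzero asymptotic coefficient of $\mathfrak F_j$, $\mathfrak p_j$ is the monic polynomial (of degree $\mathfrak k_j$) with $-1/\mathfrak F_j-\epsilon_j\mathfrak p_j=o(1)$ as $\lambda\widehat\to\infty$, and $\mathfrak b_j>0$ makes $\mathfrak F_{j+1}$ normalized. Put $\mathfrak c_j=\epsilon_j\epsilon_{j+1}\mathfrak b_j^2$; $\mathfrak p_j(\lambda)=\lambda+\mathfrak p_0^{(j)}$ if $\mathfrak k_j=1$, $\mathfrak p_j(\lambda)=\lambda^2+\mathfrak p_1^{(j)}\lambda+\mathfrak p_0^{(j)}$ if $\mathfrak k_j=2$. The monic generalized Jacobi matrix associated with $\mathfrak F$ is the block tridiagonal matrix with diagonal blocks $-\mathfrak p_0^{(j)}$ ($\mathfrak k_j=1$)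 or $\begin{pmatrix}0&1\\-\mathfrak p_0^{(j)}&-\mathfrak p_1^{(j)}\end{pmatrix}$ ($\mathfrak k_j=2$), superdiagonal $\mathfrak k_j\times\mathfrak k_{j+1}$ blocks with lower-left entry $1$ and other entries $0$, and subdiagonal $\mathfrak k_{j+1}\times\mathfrak k_j$ blocks with lower-left entry $\mathfrak c_j$ and other entries $0$. For $\mathfrak F$ not normalized one uses $\mathfrak F/|\mathfrak s_{\mathfrak n_1-1}|$. Form of $L$ and $U$ in (i) and (ii): $L$ has identity diagonal blocks $I_{\mathfrak k_j}$, subdiagonal blocks $L_{j+1}$ ($\mathfrak k_{j+1}\times\mathfrak k_j$, upper-left entry $l_{j+1}$, other entries $0$) and zeros elsewhere; $U$ has diagonal blocks $U_j=u_0^{(j)}$ if $\mathfrak k_j=1$, $U_j=\begin{pmatrix}0&1\\ u_0^{(j)}&u_1^{(j)}\end{pmatrix}$ if $\mathfrak k_j=2$, superdiagonal blocks $D_j$ ($\mathfrak k_j\times\mathfrak k_{j+1}$, lower-left entry $1$, other entries $0$) and zeros elsewhere. The $LU$-factorization $J=LU$ of this form exists and is unique. The $UL$-factorization $\mathfrak J=UL$ with parameter $\mathfrak s_{-1}$ is the (unique) one of this form with $u_0^{(0)}=\mathfrak s_{\mathfrak n_1-1}/\mathfrak s_{-1}$. A matrix is bounded in $\ell^2_{[0,\infty)}$ if it defines a bounded operator there. *)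

theory Defs
  imports
    "HOL-Complex_Analysis.Complex_Analysis"
    "HOL-Library.Landau_Symbols"
    "HOL-Library.Infinite_Set"
    "Jordan_Normal_Form.Determinant"
begin

definition borel_measure :: "real measure \<Rightarrow> bool" where
  "borel_measure \<mu> \<longleftrightarrow> finite_measure \<mu> \<and> sets \<mu> = sets borel"

definition msupport :: "real measure \<Rightarrow> real set" where
  "msupport \<mu> = {x. \<forall>V. open V \<longrightarrow> x \<in> V \<longrightarrow> emeasure \<mu> V > 0}"

definition cauchy_transform :: "real measure \<Rightarrow> complex \<Rightarrow> complex" where
  "cauchy_transform \<mu> z = (\<integral>t. 1 / (complex_of_real t - z) \<partial>\<mu>)"

text \<open>Both classes consist of functions on the open upper half-plane; the values of the
  total function \<open>f\<close> elsewhere are irrelevant.\<close>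

definition class_N :: "(complex \<Rightarrow> complex) set" where
  "class_N = {f. \<exists>\<mu>. borel_measure \<mu> \<and> (\<forall>k::nat. integrable \<mu> (\<lambda>t. t ^ k)) \<and>
                    (\<forall>z. Im z > 0 \<longrightarrow> f z = cauchy_transform \<mu> z)}"

definition class_D_minus :: "(complex \<Rightarrow> complex) set" where
  "class_D_minus = {f. f meromorphic_on {z. Im z > 0} \<and>
     (\<exists>s::real. s \<noteq> 0 \<and> (\<lambda>z. - complex_of_real s / z + f z / z) \<in> class_N)}"

text \<open>The filter of \<open>z \<rightarrow> \<infinity>\<close> inside every sector \<open>e < arg z < \<pi> - e\<close>: a property holds
  eventually for it iff it holds eventually in each of the sectors (with a threshold that
  may depend on the sector).\<close>

definition sector_infinity :: "complex filter" where
  "sector_infinity = (SUP e\<in>{0<..}. inf at_infinity (principal {z. e < Arg z \<and> Arg z < pi - e}))"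

definition asymptotic_to :: "(complex \<Rightarrow> complex) \<Rightarrow> (nat \<Rightarrow> real) \<Rightarrow> bool" where
  "asymptotic_to f s \<longleftrightarrow>
     (\<forall>N. (\<lambda>z. f z + (\<Sum>j\<le>N. complex_of_real (s j) / z ^ (j + 1)))
            \<in> o[sector_infinity](\<lambda>z. 1 / z ^ (N + 1)))"

definition asym_coeffs :: "(complex \<Rightarrow> complex) \<Rightarrow> nat \<Rightarrow> real" where
  "asym_coeffs f = (THE s. asymptotic_to f s)"

definition first_coeff :: "(complex \<Rightarrow> complex) \<Rightarrow> real" where
  "first_coeff f = asym_coeffs f (LEAST j. asym_coeffs f j \<noteq> 0)"

definition normalized :: "(complex \<Rightarrow> complex) \<Rightarrow> bool" where
  "normalized f \<longleftrightarrow> \<bar>first_coeff f\<bar> = 1"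

definition hankel_det :: "(nat \<Rightarrow> real) \<Rightarrow> nat \<Rightarrow> real" where
  "hankel_det s n = Determinant.det (Matrix.mat n n (\<lambda>(i, k). s (i + k)))"

definition normal_index :: "(nat \<Rightarrow> real) \<Rightarrow> nat \<Rightarrow> nat" where
  "normal_index s j =
     (if j = 0 then 0 else enumerate {n. n \<ge> 1 \<and> hankel_det s n \<noteq> 0} (j - 1))"

type_synonym imatrix = "nat \<Rightarrow> nat \<Rightarrow> real"

text \<open>Only used for banded factors, where the sum has finitely many nonzero terms.\<close>

definition imult :: "imatrix \<Rightarrow> imatrix \<Rightarrow> imatrix" where
  "imult A B = (\<lambda>i k. \<Sum>j. A i j * B j k)"

definition in_l2 :: "(nat \<Rightarrow> complex) \<Rightarrow> bool" where
  "in_l2 x \<longleftrightarrow> summable (\<lambda>i. (cmod (x i))\<^sup>2)"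

definition l2_norm :: "(nat \<Rightarrow> complex) \<Rightarrow> real" where
  "l2_norm x = sqrt (\<Sum>i. (cmod (x i))\<^sup>2)"

definition iapply :: "imatrix \<Rightarrow> (nat \<Rightarrow> complex) \<Rightarrow> nat \<Rightarrow> complex" where
  "iapply A x i = (\<Sum>j. complex_of_real (A i j) * x j)"

definition bounded_l2 :: "imatrix \<Rightarrow> bool" where
  "bounded_l2 A \<longleftrightarrow>
     (\<exists>C. \<forall>x. in_l2 x \<longrightarrow>
        (\<forall>i. summable (\<lambda>j. complex_of_real (A i j) * x j)) \<and>
        in_l2 (iapply A x) \<and> l2_norm (iapply A x) \<le> C * l2_norm x)"

text \<open>Block structure. The strictly increasing \<open>n\<close> with \<open>n 0 = 0\<close> lists the first indices of
  the blocks; \<open>Bl a b r c\<close> is the entry in row \<open>r\<close> and column \<open>c\<close> (counted from 0) of the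
  block in block row \<open>a\<close> and block column \<open>b\<close>.\<close>

definition block_size :: "(nat \<Rightarrow> nat) \<Rightarrow> nat \<Rightarrow> nat" where
  "block_size n j = n (Suc j) - n j"

definition block_of :: "(nat \<Rightarrow> nat) \<Rightarrow> nat \<Rightarrow> nat" where
  "block_of n i = (LEAST j. i < n (Suc j))"

definition block_matrix ::
    "(nat \<Rightarrow> nat) \<Rightarrow> (nat \<Rightarrow> nat \<Rightarrow> nat \<Rightarrow> nat \<Rightarrow> real) \<Rightarrow> imatrix" where
  "block_matrix n Bl = (\<lambda>i k.
     Bl (block_of n i) (block_of n k) (i - n (block_of n i)) (k - n (block_of n k)))"

text \<open>The block \<open>(x0)\<close> if \<open>k = 1\<close>, and the block with rows \<open>(0, 1)\<close> and \<open>(x0, x1)\<close> if \<open>k = 2\<close>.\<close>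

definition diag_block :: "nat \<Rightarrow> real \<Rightarrow> real \<Rightarrow> nat \<Rightarrow> nat \<Rightarrow> real" where
  "diag_block k x0 x1 r c =
     (if k = 1 then x0
      else if r = 0 then (if c = 1 then 1 else 0)
      else (if c = 0 then x0 else x1))"

text \<open>\<open>k\<close> is the number of rows.\<close>

definition lower_left_block :: "nat \<Rightarrow> real \<Rightarrow> nat \<Rightarrow> nat \<Rightarrow> real" where
  "lower_left_block k x r c = (if r = k - 1 \<and> c = 0 then x else 0)"

definition upper_left_block :: "real \<Rightarrow> nat \<Rightarrow> nat \<Rightarrow> real" where
  "upper_left_block x r c = (if r = 0 \<and> c = 0 then x else 0)"

definition block_L :: "(nat \<Rightarrow> nat) \<Rightarrow> (nat \<Rightarrow> real) \<Rightarrow> imatrix" where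
  "block_L n l = block_matrix n (\<lambda>a b r c.
     if a = b then (if r = c then 1 else 0)
     else if a = Suc b then upper_left_block (l a) r c
     else 0)"

definition block_U :: "(nat \<Rightarrow> nat) \<Rightarrow> (nat \<Rightarrow> real) \<Rightarrow> (nat \<Rightarrow> real) \<Rightarrow> imatrix" where
  "block_U n u0 u1 = block_matrix n (\<lambda>a b r c.
     if a = b then diag_block (block_size n a) (u0 a) (u1 a) r c
     else if b = Suc a then lower_left_block (block_size n a) 1 r c
     else 0)"

definition LU_factor_U :: "(nat \<Rightarrow> nat) \<Rightarrow> imatrix \<Rightarrow> imatrix" where
  "LU_factor_U n J = (THE U. \<exists>l u0 u1. U = block_U n u0 u1 \<and> J = imult (block_L n l) U)"

text \<open>\<open>v\<close> is the prescribed value of \<open>u\<^sub>0\<close> in the first diagonal block of \<open>U\<close>.\<close>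

definition UL_factor_U :: "(nat \<Rightarrow> nat) \<Rightarrow> imatrix \<Rightarrow> real \<Rightarrow> imatrix" where
  "UL_factor_U n J v =
     (THE U. \<exists>l u0 u1. U = block_U n u0 u1 \<and> u0 0 = v \<and> J = imult U (block_L n l))"

text \<open>Orthogonality is unaffected by scaling the measure, so \<open>\<sigma>\<close> need not be
  divided by its total mass.\<close>

definition orth_poly :: "real measure \<Rightarrow> nat \<Rightarrow> real poly" where
  "orth_poly \<sigma> j = (THE p. degree p = j \<and> lead_coeff p = 1 \<and>
     (\<forall>q. q = 0 \<or> degree q < j \<longrightarrow> (\<integral>t. poly p t * poly q t \<partial>\<sigma>) = 0))"

definition jacobi_recurrence ::
    "real measure \<Rightarrow> (nat \<Rightarrow> real) \<Rightarrow> (nat \<Rightarrow> real) \<Rightarrow> bool" where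
  "jacobi_recurrence \<sigma> b c \<longleftrightarrow>
     (\<forall>j. [:0, 1:] * orth_poly \<sigma> j =
        orth_poly \<sigma> (Suc j) + Polynomial.smult (b j) (orth_poly \<sigma> j) +
        (if j = 0 then 0 else Polynomial.smult (c (j - 1)) (orth_poly \<sigma> (j - 1))))"

definition jacobi_b :: "real measure \<Rightarrow> nat \<Rightarrow> real" where
  "jacobi_b \<sigma> = (THE b. \<exists>c. jacobi_recurrence \<sigma> b c)"

definition jacobi_c :: "real measure \<Rightarrow> nat \<Rightarrow> real" where
  "jacobi_c \<sigma> = (THE c. \<exists>b. jacobi_recurrence \<sigma> b c)"

text \<open>The monic Jacobi matrix associated with \<open>cauchy_transform \<sigma>\<close>.\<close>

definition jacobi_matrix :: "real measure \<Rightarrow> imatrix" where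
  "jacobi_matrix \<sigma> = (\<lambda>i k.
     if k = i then jacobi_b \<sigma> i
     else if k = Suc i then 1
     else if i = Suc k then jacobi_c \<sigma> k
     else 0)"

text \<open>One step \<open>-1/f = \<epsilon> p + b\<^sup>2 g\<close> of the expansion of a normalized \<open>f\<close> into a continued
  fraction, where \<open>\<epsilon> = first_coeff f\<close> and \<open>g\<close> is again normalized. Zeros of \<open>f\<close> (where
  \<open>1/f\<close> is a junk value) play no role, as only the behaviour along
  \<^term>\<open>sector_infinity\<close> is used and \<open>f\<close> has no zeros far out in a sector.\<close>

definition cpoly :: "real poly \<Rightarrow> complex \<Rightarrow> complex" where
  "cpoly p z = poly (map_poly complex_of_real p) z"

definition cf_poly :: "(complex \<Rightarrow> complex) \<Rightarrow> real poly" where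
  "cf_poly f = (THE p. lead_coeff p = 1 \<and>
     ((\<lambda>z. - 1 / f z - complex_of_real (first_coeff f) * cpoly p z) \<longlongrightarrow> 0) sector_infinity)"

definition cf_remainder :: "(complex \<Rightarrow> complex) \<Rightarrow> complex \<Rightarrow> complex" where
  "cf_remainder f z = - 1 / f z - complex_of_real (first_coeff f) * cpoly (cf_poly f) z"

definition cf_b :: "(complex \<Rightarrow> complex) \<Rightarrow> real" where
  "cf_b f = (THE b. b > 0 \<and> normalized (\<lambda>z. cf_remainder f z / complex_of_real (b\<^sup>2)))"

definition cf_next :: "(complex \<Rightarrow> complex) \<Rightarrow> complex \<Rightarrow> complex" where
  "cf_next f = (\<lambda>z. cf_remainder f z / complex_of_real ((cf_b f)\<^sup>2))"

fun cf_seq :: "(complex \<Rightarrow> complex) \<Rightarrow> nat \<Rightarrow> complex \<Rightarrow> complex" where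
  "cf_seq f 0 = (\<lambda>z. f z / complex_of_real \<bar>first_coeff f\<bar>)"
| "cf_seq f (Suc j) = cf_next (cf_seq f j)"

definition gen_jacobi_c :: "(complex \<Rightarrow> complex) \<Rightarrow> nat \<Rightarrow> real" where
  "gen_jacobi_c f j =
     first_coeff (cf_seq f j) * first_coeff (cf_seq f (Suc j)) * (cf_b (cf_seq f j))\<^sup>2"

definition gen_jacobi_matrix :: "(complex \<Rightarrow> complex) \<Rightarrow> imatrix" where
  "gen_jacobi_matrix f =
     (let n = normal_index (asym_coeffs f); p = (\<lambda>j. cf_poly (cf_seq f j)) in
      block_matrix n (\<lambda>a b r c.
        if a = b then
          diag_block (block_size n a) (- poly.coeff (p a) 0) (- poly.coeff (p a) 1) r c
        else if b = Suc a then lower_left_block (block_size n a) 1 r c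
        else if a = Suc b then lower_left_block (block_size n a) (gen_jacobi_c f b) r c
        else 0))"

text \<open>The point at infinity is \<open>None\<close>.\<close>

type_synonym riemann_sphere = "complex option"

text \<open>Stereographic projection onto the unit sphere of \<open>\<complex> \<times> \<real>\<close>. The spherical (chordal)
  metric is the Euclidean distance of the images.\<close>

fun stereo :: "riemann_sphere \<Rightarrow> complex \<times> real" where
  "stereo None = (0, 1)"
| "stereo (Some z) =
     (2 * z / complex_of_real (1 + (cmod z)\<^sup>2), ((cmod z)\<^sup>2 - 1) / (1 + (cmod z)\<^sup>2))"

definition converges_locally_uniformly ::
    "riemann_sphere set \<Rightarrow> (nat \<Rightarrow> riemann_sphere \<Rightarrow> riemann_sphere) \<Rightarrow>
      (riemann_sphere \<Rightarrow> riemann_sphere) \<Rightarrow> bool" where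
  "converges_locally_uniformly D f g \<longleftrightarrow>
     (\<forall>K\<subseteq>D. compact (stereo ` K) \<longrightarrow>
        uniform_limit K (\<lambda>j z. stereo (f j z)) (\<lambda>z. stereo (g z)) sequentially)"

text \<open>A function that is meromorphic near a point of the sphere, read as a sphere-valued map
  there: removable singularities (also at \<open>\<infinity>\<close>) are filled in and poles get the value \<open>\<infinity>\<close>.\<close>

definition sphere_map :: "(complex \<Rightarrow> complex) \<Rightarrow> riemann_sphere \<Rightarrow> riemann_sphere" where
  "sphere_map f w =
     (let G = (case w of None \<Rightarrow> at_infinity | Some z \<Rightarrow> at z) in
      if filterlim f at_infinity G then None else Some (Lim G f))"

definition is_pade ::
    "(nat \<Rightarrow> real) \<Rightarrow> nat \<Rightarrow> nat \<Rightarrow> complex poly \<Rightarrow> complex poly \<Rightarrow> bool" where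
  "is_pade s L M A B \<longleftrightarrow>
     degree A \<le> L \<and> degree B \<le> M \<and> poly B 0 \<noteq> 0 \<and>
     (\<lambda>z. (\<Sum>j<L + M. complex_of_real (s j) / z ^ (j + 1)) + poly A (1 / z) / poly B (1 / z))
       \<in> O[at_infinity](\<lambda>z. 1 / z ^ (L + M + 1))"

definition pade :: "(nat \<Rightarrow> real) \<Rightarrow> nat \<Rightarrow> nat \<Rightarrow> riemann_sphere \<Rightarrow> riemann_sphere" where
  "pade s L M = (THE R. \<exists>A B. is_pade s L M A B \<and>
     R = sphere_map (\<lambda>z. poly A (1 / z) / poly B (1 / z)))"

end

theory Submission
  imports Defs
begin

text \<open>Let \<open>P n\<close> be the monic orthogonal polynomials of \<open>\<sigma>\<close> and \<open>tau n = P (n + 1) (0) / P n (0)\<close>. An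
  index \<open>n \<ge> 1\<close> is normal exactly if \<open>P n (0) \<noteq> 0\<close> (lemma \<open>hankel_det_eq_0_iff\<close>). Each of the three
  statements holds if and only if \<open>tau\<close> is bounded on the normal indices.

  The factor \<open>U\<close> of the Jacobi matrix is tridiagonal. Its entries are 0, 1, coefficients of the
  three-term recurrence, which are at most 1 in modulus, and the numbers \<open>- tau n\<close>; hence it is bounded
  if and only if \<open>tau\<close> is (\<open>bounded_block_U\<close>). The product \<open>U L\<close> of the interchanged factors belongs to
  the recurrence of the polynomials that are orthogonal with respect to \<open>t d\<sigma>(t)\<close>. Their functions of
  the second kind satisfy the same recurrence (\<open>\<Psi>_recurrence\<close>), and their successive quotients are
  the remainders of the continued fraction of \<open>\<FF>\<close> (\<open>cf_step\<close>, \<open>cf_seq_eq\<close>). So \<open>U L\<close> is the generalized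
  Jacobi matrix, and by uniqueness both factorizations have the same \<open>U\<close> (\<open>UL_factor_P\<close>).

  For a normal index \<open>n\<close> the polynomial \<open>P (n + 1) - tau n * P n\<close> vanishes at the origin and is
  orthogonal to all polynomials of degree less than \<open>n\<close>. It has \<open>n + 1\<close> simple real zeros, which are the
  nodes of a positive quadrature rule that is exact up to degree \<open>2 n\<close> (\<open>quadrature\<close>, \<open>weight_pos\<close>). The
  diagonal Pade approximant of order \<open>n\<close> is \<open>\<integral> t d\<sigma>\<^sub>n(t) / (t - z)\<close> for the quadrature measure
  \<open>\<sigma>\<^sub>n\<close> (\<open>pade_eq_quad_transform\<close>); its poles are the nodes other than 0, and none of them lies in the gap
  around the origin (\<open>nodes_separated\<close>). A bound on \<open>tau n\<close> bounds the nodes and conversely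
  (\<open>node_bound\<close>, \<open>parameter_bound\<close>). If the nodes are bounded, the quadrature measures converge weakly
  by the Stone-Weierstrass theorem, which yields the locally uniform convergence
  (\<open>bounded_imp_converges\<close>). If the approximants converge uniformly near infinity, where \<open>\<FF>\<close> is
  bounded, they have no poles there from some index on, so the nodes are bounded
  (\<open>converges_imp_bounded\<close>).\<close>

section \<open>Positive functionals on polynomials and their orthogonal polynomials\<close>

text \<open>The algebra of the argument uses of the measure only the functional that integrates real
  polynomials against it. It is linear and strictly positive on the nonzero polynomials that are
  nonnegative on the two intervals.\<close>

locale positive_functional =
  fixes I :: "real poly \<Rightarrow> real" and E :: "real set"
  assumes I_add: "I (p + q) = I p + I q"
    and I_smult: "I (Polynomial.smult c p) = c * I p"
    and I_pos: "p \<noteq> 0 \<Longrightarrow> (\<And>t. t \<in> E \<Longrightarrow> poly p t \<ge> 0) \<Longrightarrow> I p > 0"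
    and E_bounds: "E \<subseteq> {-1..1}"
begin

lemma I_0 [simp]: "I 0 = 0"
  using I_smult[of 0 0] by simp

lemma I_minus: "I (- p) = - I p"
  using I_smult[of "-1" p] by simp

lemma I_diff: "I (p - q) = I p - I q"
  using I_add[of p "-q"] I_minus[of q] by simp

lemma I_sum: "I (\<Sum>x\<in>A. f x) = (\<Sum>x\<in>A. I (f x))"
  by (induction A rule: infinite_finite_induct) (auto simp: I_add)

lemma I_nonneg: "(\<And>t. t \<in> E \<Longrightarrow> poly p t \<ge> 0) \<Longrightarrow> I p \<ge> 0"
  using I_pos[of p] by (cases "p = 0") auto

lemma I_mono: "(\<And>t. t \<in> E \<Longrightarrow> poly p t \<le> poly q t) \<Longrightarrow> I p \<le> I q"
  using I_nonneg[of "q - p"] by (simp add: I_diff)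

lemma I_square_pos: "p \<noteq> 0 \<Longrightarrow> I (p * p) > 0"
  by (rule I_pos) auto

text \<open>The monic orthogonal polynomials, defined by their three-term recurrence.\<close>

fun P :: "nat \<Rightarrow> real poly" where
  "P 0 = 1"
| "P (Suc 0) = [:- (I [:0, 1:] / I 1), 1:]"
| "P (Suc (Suc n)) =
     [:- (I ([:0, 1:] * (P (Suc n) * P (Suc n))) / I (P (Suc n) * P (Suc n))), 1:] * P (Suc n)
     - Polynomial.smult (I (P (Suc n) * P (Suc n)) / I (P n * P n)) (P n)"

declare P.simps(2,3) [simp del]

text \<open>The squared norms, and the diagonal and subdiagonal of the monic Jacobi matrix.\<close>

definition h :: "nat \<Rightarrow> real" where "h n = I (P n * P n)"
definition b :: "nat \<Rightarrow> real" where "b n = I ([:0, 1:] * (P n * P n)) / h n"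
definition c :: "nat \<Rightarrow> real" where "c n = h (Suc n) / h n"

lemma P_Suc0: "P (Suc 0) = [:- b 0, 1:]"
  by (simp add: b_def h_def P.simps)

lemma P_SucSuc: "P (Suc (Suc n)) = [:- b (Suc n), 1:] * P (Suc n) - Polynomial.smult (c n) (P n)"
  by (simp add: b_def h_def c_def P.simps)

lemma P_recurrence:
  "[:0, 1:] * P j = P (Suc j) + Polynomial.smult (b j) (P j)
     + (if j = 0 then 0 else Polynomial.smult (c (j - 1)) (P (j - 1)))"
proof (cases j)
  case 0
  then show ?thesis unfolding 0 P_Suc0 by simp
next
  case (Suc n)
  show ?thesis unfolding Suc P_SucSuc by (simp add: algebra_simps)
qed

lemma P_degree_lead: "degree (P n) = n \<and> lead_coeff (P n) = 1"
proof (induction n rule: P.induct)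
  case (3 n)
  have d: "degree ([:- b (Suc n), 1:] * P (Suc n)) = Suc (Suc n)"
    and l: "lead_coeff ([:- b (Suc n), 1:] * P (Suc n)) = 1"
  proof -
    have ne: "[:- b (Suc n), 1:] \<noteq> 0" "P (Suc n) \<noteq> 0" using 3 by force+
    show "degree ([:- b (Suc n), 1:] * P (Suc n)) = Suc (Suc n)"
      unfolding degree_mult_eq[OF ne] using 3 by simp
    show "lead_coeff ([:- b (Suc n), 1:] * P (Suc n)) = 1"
      unfolding lead_coeff_mult using 3 by simp
  qed
  have lt: "degree (Polynomial.smult (c n) (P n)) < degree ([:- b (Suc n), 1:] * P (Suc n))"
    using 3 unfolding d by (intro le_less_trans[OF degree_smult_le]) auto
  have dP: "degree (P (Suc (Suc n))) = Suc (Suc n)" unfolding P_SucSuc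
    using lt d by (metis degree_add_eq_left degree_minus diff_conv_add_uminus)
  have "poly.coeff (Polynomial.smult (c n) (P n)) (Suc (Suc n)) = 0"
    using lt d by (intro coeff_eq_0) simp
  then have "lead_coeff (P (Suc (Suc n))) = 1"
    unfolding dP using l d by (simp only: P_SucSuc coeff_diff)
  with dP show ?case by blast
qed (auto simp: P_Suc0)

lemma P_degree [simp]: "degree (P n) = n" using P_degree_lead by blast
lemma P_lead: "lead_coeff (P n) = 1" using P_degree_lead by blast
lemma P_coeff [simp]: "poly.coeff (P n) n = 1" using P_lead[of n] by simp
lemma P_nonzero [simp]: "P n \<noteq> 0" using P_lead[of n] by force

lemma h_pos: "h n > 0"
  unfolding h_def by (rule I_square_pos) simp

lemma c_pos: "c n > 0"
  unfolding c_def using h_pos by simp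

lemma monic_split:
  fixes p q :: "real poly"
  assumes "degree p = n" "lead_coeff p = 1" "degree q \<le> n"
  obtains r where "q = Polynomial.smult (poly.coeff q n) p + r" "r = 0 \<or> degree r < n"
proof -
  define r where "r = q - Polynomial.smult (poly.coeff q n) p"
  have "degree r \<le> n" unfolding r_def
    using assms degree_smult_le[of "poly.coeff q n" p] by (intro degree_diff_le) auto
  moreover have "poly.coeff r n = 0" unfolding r_def using assms by auto
  ultimately have "r = 0 \<or> degree r < n"
    by (metis le_neq_implies_less leading_coeff_0_iff)
  then show ?thesis using that[of r] unfolding r_def by simp
qed

text \<open>By induction on \<open>n\<close>. The two top coefficients of \<open>q\<close> are split off; the recurrence
  coefficients are chosen so that the corresponding terms cancel.\<close>

lemma P_orth: "q = 0 \<or> degree q < n \<Longrightarrow> I (P n * q) = 0"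
proof (induction n arbitrary: q rule: less_induct)
  case (less n)
  show ?case
  proof (cases n)
    case 0
    then show ?thesis using less.prems by auto
  next
    case (Suc m)
    have t: "I (P k * q) = 0" if "q = 0 \<or> degree q < k" "k \<le> m" for k q
      using less.IH[of k q] that Suc by auto
    show ?thesis
    proof (cases "q = 0")
      case False
      then have dq: "degree q \<le> m" using less.prems Suc by simp
      obtain r where r: "q = Polynomial.smult (poly.coeff q m) (P m) + r" "r = 0 \<or> degree r < m"
        using monic_split[OF P_degree P_lead dq] .
      have PP: "I (P (Suc m) * P m) = 0"
      proof (cases m)
        case 0
        have "I (P (Suc 0) * P 0) = I ([:0, 1:] + Polynomial.smult (- b 0) 1)"
          by (subst P_Suc0) simp
        also have "\<dots> = 0" unfolding I_add I_smult b_def h_def using h_pos[of 0] by (simp add: h_def)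
        finally show ?thesis unfolding 0 .
      next
        case (Suc k)
        have "P (Suc m) * P m = [:0, 1:] * (P m * P m)
            + Polynomial.smult (- b m) (P m * P m) - Polynomial.smult (c k) (P m * P k)"
          unfolding Suc P_SucSuc by (simp add: algebra_simps)
        then have "I (P (Suc m) * P m) = I ([:0, 1:] * (P m * P m)) - b m * h m - c k * I (P m * P k)"
          by (simp add: I_add I_diff I_smult h_def)
        also have "I (P m * P k) = 0" using t[of "P k" m] Suc by simp
        finally show ?thesis unfolding b_def using h_pos[of m] by simp
      qed
      have Pr: "I (P (Suc m) * r) = 0"
      proof (cases m)
        case 0
        then show ?thesis using r by simp
      next
        case (Suc k)
        show ?thesis
        proof (cases "r = 0")
          case False
          then have dr: "degree r \<le> k" using r Suc by simp
          have "degree ([:0, 1:] * r) \<le> m" using dr Suc degree_mult_le[of "[:0,1:]" r] by simp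
          then obtain r' where r': "[:0, 1:] * r = Polynomial.smult (poly.coeff ([:0, 1:] * r) m) (P m) + r'"
              "r' = 0 \<or> degree r' < m"
            using monic_split[OF P_degree P_lead] by metis
          obtain r2 where r2: "r = Polynomial.smult (poly.coeff r k) (P k) + r2" "r2 = 0 \<or> degree r2 < k"
            using monic_split[OF P_degree P_lead dr] .
          have "P (Suc m) * r = P m * ([:0, 1:] * r)
              - Polynomial.smult (b m) (P m * r) - Polynomial.smult (c k) (P k * r)"
            unfolding Suc P_SucSuc by (simp add: algebra_simps)
          then have e: "I (P (Suc m) * r) = I (P m * ([:0, 1:] * r)) - b m * I (P m * r) - c k * I (P k * r)"
            by (simp add: I_diff I_smult)
          have e1: "I (P m * r) = 0" using t r False by blast
          have "I (P m * ([:0, 1:] * r)) = poly.coeff r k * h m"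
            by (subst r'(1)) (use t[of r' m] r'(2) Suc in \<open>simp add: distrib_left I_add I_smult h_def\<close>)
          moreover have "I (P k * r) = poly.coeff r k * h k"
            by (subst r2(1)) (use t[of r2 k] r2(2) Suc in \<open>simp add: distrib_left I_add I_smult h_def\<close>)
          ultimately show ?thesis unfolding e e1 c_def using h_pos[of k] Suc by simp
        qed simp
      qed
      show ?thesis
        by (subst r(1)) (simp add: Suc distrib_left I_add I_smult PP Pr)
    qed simp
  qed
qed

lemma P_orth': "q = 0 \<or> degree q < n \<Longrightarrow> I (q * P n) = 0"
  using P_orth[of q n] by (simp add: mult.commute)

lemma I_P_monic:
  assumes "degree q \<le> n"
  shows "I (P n * q) = poly.coeff q n * h n"
proof -
  obtain r where r: "q = Polynomial.smult (poly.coeff q n) (P n) + r" "r = 0 \<or> degree r < n"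
    using monic_split[OF P_degree P_lead assms] .
  show ?thesis
    by (subst r(1)) (use P_orth[OF r(2)] in \<open>simp add: distrib_left I_add I_smult h_def\<close>)
qed

lemma P_unique:
  assumes "degree p = n" "lead_coeff p = 1" "\<And>q. q = 0 \<or> degree q < n \<Longrightarrow> I (p * q) = 0"
  shows "p = P n"
proof -
  obtain r where r: "p = Polynomial.smult (poly.coeff p n) (P n) + r" "r = 0 \<or> degree r < n"
    using monic_split[OF P_degree P_lead] assms(1) by (metis order_refl)
  then have r1: "p = P n + r" using assms by simp
  have "I (r * r) = I (p * r) - I (P n * r)" unfolding r1 by (simp add: I_add distrib_right)
  also have "\<dots> = 0" using assms(3)[OF r(2)] P_orth[OF r(2)] by simp
  finally have "r = 0" using I_square_pos[of r] by force
  then show ?thesis using r1 by simp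
qed

text \<open>Among monic polynomials of degree \<open>n\<close> the orthogonal one has minimal norm.\<close>

lemma h_le:
  assumes "degree p = n" "lead_coeff p = 1"
  shows "h n \<le> I (p * p)"
proof -
  obtain r where r: "p = Polynomial.smult (poly.coeff p n) (P n) + r" "r = 0 \<or> degree r < n"
    using monic_split[OF P_degree P_lead] assms(1) by (metis order_refl)
  then have r1: "p = P n + r" using assms by simp
  have "I (p * p) = h n + 2 * I (P n * r) + I (r * r)"
    unfolding r1 distrib_right distrib_left I_add h_def mult.commute[of r "P n"] by simp
  moreover have "I (r * r) \<ge> 0" by (rule I_nonneg) simp
  ultimately show ?thesis using P_orth[OF r(2)] by simp
qed

lemma b_bound: "\<bar>b n\<bar> \<le> 1"
proof -
  have "I ([:0, 1:] * (P n * P n)) \<le> I (P n * P n)"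
  proof (rule I_mono)
    fix t assume "t \<in> E"
    then have "t \<le> 1" using E_bounds by auto
    then show "poly ([:0, 1:] * (P n * P n)) t \<le> poly (P n * P n) t"
      using mult_right_mono[of t 1 "poly (P n) t * poly (P n) t"] by simp
  qed
  moreover have "- I (P n * P n) \<le> I ([:0, 1:] * (P n * P n))"
    unfolding I_minus[symmetric]
  proof (rule I_mono)
    fix t assume "t \<in> E"
    then have "- 1 \<le> t" using E_bounds by auto
    then show "poly (- (P n * P n)) t \<le> poly ([:0, 1:] * (P n * P n)) t"
      using mult_right_mono[of "-1" t "poly (P n) t * poly (P n) t"] by simp
  qed
  ultimately show ?thesis
    unfolding b_def using h_pos[of n] by (auto simp: abs_le_iff field_simps h_def)
qed

lemma c_bound: "c n \<le> 1"
proof -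
  have "degree ([:0, 1:] * P n) = Suc n" "lead_coeff ([:0, 1:] * P n) = 1"
    using degree_mult_eq[of "[:0,1:]" "P n"] lead_coeff_mult[of "[:0,1:]" "P n"] by auto
  then have "h (Suc n) \<le> I (([:0, 1:] * P n) * ([:0, 1:] * P n))" by (rule h_le)
  also have "\<dots> \<le> I (P n * P n)"
  proof (rule I_mono)
    fix t assume "t \<in> E"
    then have "-1 \<le> t \<and> t \<le> 1" using E_bounds by auto
    then have "\<bar>t\<bar> \<le> 1" by linarith
    then have "t\<^sup>2 \<le> 1" by (simp add: abs_square_le_1)
    then show "poly (([:0, 1:] * P n) * ([:0, 1:] * P n)) t \<le> poly (P n * P n) t"
      using mult_right_mono[of "t\<^sup>2" 1 "(poly (P n) t)\<^sup>2"] by (simp add: power2_eq_square ac_simps)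
  qed
  finally show ?thesis unfolding c_def using h_pos[of n] by (simp add: h_def)
qed

lemma P_at_0: "poly (P (Suc j)) 0 + b j * poly (P j) 0
     + (if j = 0 then 0 else c (j - 1) * poly (P (j - 1)) 0) = 0"
  using arg_cong[OF P_recurrence[of j], of "\<lambda>p. poly p 0"] by (cases j) simp_all

text \<open>Two consecutive orthogonal polynomials have no common zero.\<close>

lemma P_consecutive_nonzero: "poly (P n) 0 \<noteq> 0 \<or> poly (P (Suc n)) 0 \<noteq> 0"
proof (induction n)
  case (Suc n)
  show ?case
  proof (rule ccontr)
    assume "\<not> ?thesis"
    then have "c n * poly (P n) 0 = 0" "poly (P (Suc n)) 0 = 0"
      using P_at_0[of "Suc n"] by auto
    then show False using Suc c_pos[of n] by auto
  qed
qed auto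

end

section \<open>Quasi-orthogonal polynomials and their quadrature rules\<close>

lemma prod_linear_factors_dvd:
  fixes p :: "'a :: idom poly"
  assumes "finite A" "\<And>x. x \<in> A \<Longrightarrow> poly p x = 0"
  shows "(\<Prod>x\<in>A. [:- x, 1:]) dvd p"
  using assms
proof (induction A)
  case (insert a A)
  then obtain q where q: "p = (\<Prod>x\<in>A. [:- x, 1:]) * q" by (auto elim: dvdE)
  have "poly (\<Prod>x\<in>A. [:- x, 1:]) a \<noteq> 0" using insert by (auto simp: poly_prod)
  then have "poly q a = 0" using insert.prems[of a] by (simp add: q)
  then have "[:- a, 1:] dvd q" by (simp add: poly_eq_0_iff_dvd)
  then have "[:- a, 1:] * (\<Prod>x\<in>A. [:- x, 1:]) dvd q * (\<Prod>x\<in>A. [:- x, 1:])"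
    by (rule mult_dvd_mono) simp
  then show ?case unfolding prod.insert[OF insert.hyps] q by (simp only: mult.commute)
qed simp

lemma degree_prod_linear: "finite A \<Longrightarrow> degree (\<Prod>x\<in>A. [:- x, 1 :: 'a :: idom:]) = card A"
  by (subst degree_prod_eq_sum_degree) auto

lemma lead_coeff_prod_linear: "finite A \<Longrightarrow> lead_coeff (\<Prod>x\<in>A. [:- x, 1 :: 'a :: idom:]) = 1"
  by (simp add: lead_coeff_prod)

lemma monic_rootfree_pos:
  fixes g :: "real poly"
  assumes "lead_coeff g = 1" "\<And>x. poly g x \<noteq> 0"
  shows "poly g x > 0"
proof (rule ccontr)
  assume "\<not> ?thesis"
  then have neg: "poly g x < 0" using assms(2)[of x] by simp
  obtain n where n: "\<And>y. y \<ge> n \<Longrightarrow> 1 \<le> poly g y"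
    using poly_pinfty_gt_lc[of g] assms(1) by auto
  define y where "y = max n (x + 1)"
  have "poly g y > 0" "x < y" using n[of y] by (auto simp: y_def)
  then show False using poly_IVT_pos[of x y g] neg assms(2) by blast
qed

context positive_functional
begin

text \<open>The polynomials of degree \<open>n + 1\<close> that are orthogonal to all polynomials of degree less than \<open>n\<close>.\<close>

definition omega :: "nat \<Rightarrow> real \<Rightarrow> real poly" where
  "omega n \<tau> = P (Suc n) - Polynomial.smult \<tau> (P n)"

text \<open>The zeros are the nodes of a quadrature rule whose weights are the values of the functional
  on the Lagrange basis polynomials.\<close>

definition nodes :: "nat \<Rightarrow> real \<Rightarrow> real set" where
  "nodes n \<tau> = {x. poly (omega n \<tau>) x = 0}"

definition lagrange :: "real set \<Rightarrow> real \<Rightarrow> real poly" where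
  "lagrange X x = Polynomial.smult (inverse (\<Prod>y\<in>X - {x}. x - y)) (\<Prod>y\<in>X - {x}. [:- y, 1:])"

definition weight :: "real set \<Rightarrow> real \<Rightarrow> real" where
  "weight X x = I (lagrange X x)"

lemma omega_degree_lead: "degree (omega n \<tau>) = Suc n \<and> lead_coeff (omega n \<tau>) = 1"
proof -
  have d: "degree (Polynomial.smult \<tau> (P n)) < degree (P (Suc n))"
    by (rule le_less_trans[OF degree_smult_le]) simp
  have 1: "degree (omega n \<tau>) = Suc n" unfolding omega_def
    using d by (metis degree_add_eq_left degree_minus diff_conv_add_uminus P_degree)
  have "poly.coeff (Polynomial.smult \<tau> (P n)) (Suc n) = 0"
    using d by (intro coeff_eq_0) simp
  then have "lead_coeff (omega n \<tau>) = 1" unfolding 1 unfolding omega_def by simp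
  with 1 show ?thesis by blast
qed

lemma omega_degree [simp]: "degree (omega n \<tau>) = Suc n" using omega_degree_lead by blast
lemma omega_lead: "lead_coeff (omega n \<tau>) = 1" using omega_degree_lead by blast
lemma omega_nonzero [simp]: "omega n \<tau> \<noteq> 0" using omega_lead[of n \<tau>] by force

lemma omega_orth: "q = 0 \<or> degree q < n \<Longrightarrow> I (omega n \<tau> * q) = 0"
  using P_orth[of q n] P_orth[of q "Suc n"] by (auto simp: omega_def left_diff_distrib I_diff I_smult)

text \<open>Otherwise \<open>omega n \<tau> = k * r\<close> would be orthogonal to \<open>r\<close>, which has degree less than \<open>n\<close>,
  while \<open>k * r\<^sup>2\<close> is nonnegative on the set \<open>E\<close>.\<close>

lemma no_nonneg_quadratic_factor:
  assumes "degree k = 2" "\<And>t. t \<in> E \<Longrightarrow> poly k t \<ge> 0"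
  shows "\<not> k dvd omega n \<tau>"
proof
  assume "k dvd omega n \<tau>"
  then obtain r where r: "omega n \<tau> = k * r" by (auto elim: dvdE)
  then have ne: "k \<noteq> 0" "r \<noteq> 0" using omega_nonzero[of n \<tau>] by auto
  have "Suc n = 2 + degree r" using degree_mult_eq[OF ne] r assms(1) by (metis omega_degree)
  then have "I (omega n \<tau> * r) = 0" by (intro omega_orth) auto
  moreover have "I (k * r * r) > 0" using ne assms(2) by (intro I_pos) (auto simp: mult.assoc)
  ultimately show False by (simp add: r)
qed

lemma nodes_finite [simp]: "finite (nodes n \<tau>)"
  unfolding nodes_def by (rule poly_roots_finite) simp

text \<open>All zeros are real and simple. Write \<open>omega n \<tau> = ?p * g\<close> with the simple factors of the real
  zeros in \<open>?p\<close>. A zero of \<open>g\<close> would be a double zero, so \<open>g\<close> is positive; if \<open>?p\<close> had degree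
  less than \<open>n\<close>, orthogonality to \<open>?p\<close> would contradict positivity of \<open>g * ?p\<^sup>2\<close>.\<close>

lemma nodes_card: "card (nodes n \<tau>) = Suc n"
proof -
  let ?X = "nodes n \<tau>"
  let ?p = "\<Prod>x\<in>?X. [:- x, 1:]"
  have "?p dvd omega n \<tau>" by (rule prod_linear_factors_dvd) (simp, simp add: nodes_def)
  then obtain g where g: "omega n \<tau> = ?p * g" by (auto elim: dvdE)
  have gne: "g \<noteq> 0" using g omega_nonzero[of n \<tau>] by auto
  have pne: "?p \<noteq> 0" using g omega_nonzero[of n \<tau>] by auto
  have lg: "lead_coeff g = 1"
    using omega_lead[of n \<tau>] lead_coeff_prod_linear[of ?X] unfolding g lead_coeff_mult by simp
  have deg: "Suc n = card ?X + degree g"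
    using degree_mult_eq[OF pne gne] degree_prod_linear[of ?X] g by (metis nodes_finite omega_degree)
  have root: "poly g x \<noteq> 0" for x
  proof
    assume gx: "poly g x = 0"
    then have "poly (omega n \<tau>) x = 0" by (subst g) simp
    then have x: "x \<in> ?X" by (simp add: nodes_def)
    from gx have "[:- x, 1:] dvd g" by (simp add: poly_eq_0_iff_dvd)
    moreover have "[:- x, 1:] dvd ?p" using x by (intro dvd_prodI) auto
    ultimately have "[:- x, 1:] * [:- x, 1:] dvd omega n \<tau>"
      unfolding g by (intro mult_dvd_mono)
    moreover have "degree ([:- x, 1:] * [:- x, 1:]) = 2"
      by simp
    moreover have "poly ([:- x, 1:] * [:- x, 1:]) t \<ge> 0" for t
      unfolding poly_mult by simp
    ultimately show False using no_nonneg_quadratic_factor by blast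
  qed
  have pos: "poly g x > 0" for x using monic_rootfree_pos[OF lg root] .
  have "\<not> card ?X < n"
  proof
    assume "card ?X < n"
    then have "I (omega n \<tau> * ?p) = 0"
      using degree_prod_linear[of ?X] by (intro omega_orth) simp
    moreover have "I (g * (?p * ?p)) > 0"
      using gne pne pos by (intro I_pos) (auto simp: less_imp_le)
    ultimately show False unfolding g by (simp add: ac_simps)
  qed
  then have "degree g \<le> 1" using deg by simp
  moreover have "degree g \<noteq> 1"
  proof
    assume "degree g = 1"
    obtain a q where q: "g = pCons a q" by (cases g)
    then have "degree q = 0" "q \<noteq> 0" using \<open>degree g = 1\<close> by (auto split: if_splits)
    then obtain b where "g = [:a, b:]" "b \<noteq> 0" using q by (auto elim: degree_eq_zeroE)
    then have "poly g (- a / b) = 0" by simp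
    then show False using root by blast
  qed
  ultimately have "degree g = 0" by simp
  then have "g = 1" using lg by (auto elim!: degree_eq_zeroE)
  then show ?thesis using deg by simp
qed

lemma lagrange_poly:
  assumes "finite X" "x \<in> X" "y \<in> X"
  shows "poly (lagrange X x) y = (if x = y then 1 else 0)"
proof (cases "x = y")
  case True
  have "(\<Prod>y\<in>X - {x}. x - y) \<noteq> 0" using assms by auto
  then show ?thesis using True by (simp add: lagrange_def poly_prod)
next
  case False
  have "(\<Prod>z\<in>X - {x}. y - z) = 0" using assms False by (intro prod_zero) auto
  then show ?thesis using False by (simp add: lagrange_def poly_prod)
qed

lemma lagrange_degree:
  assumes "finite X" "x \<in> X"
  shows "degree (lagrange X x) < card X"
proof -
  have "card X > 0" using assms card_gt_0_iff by blast
  moreover have "degree (lagrange X x) \<le> card (X - {x})"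
    unfolding lagrange_def using degree_prod_linear[of "X - {x}"] assms
    by (intro order_trans[OF degree_smult_le]) auto
  ultimately show ?thesis using assms by simp
qed

lemma lagrange_interpolation:
  assumes "finite X" "r = 0 \<or> degree r < card X" "X \<noteq> {}"
  shows "r = (\<Sum>x\<in>X. Polynomial.smult (poly r x) (lagrange X x))"
proof (rule poly_eqI_degree)
  fix y assume "y \<in> X"
  then have "(\<Sum>x\<in>X. poly r x * poly (lagrange X x) y) = (\<Sum>x\<in>X. if x = y then poly r x else 0)"
    using assms(1) by (intro sum.cong) (auto simp: lagrange_poly)
  also have "\<dots> = poly r y" using assms(1) \<open>y \<in> X\<close> by simp
  finally show "poly r y = poly (\<Sum>x\<in>X. Polynomial.smult (poly r x) (lagrange X x)) y"
    by (simp add: poly_sum)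
next
  show "degree r < card X" using assms by (auto simp: card_gt_0_iff)
  show "degree (\<Sum>x\<in>X. Polynomial.smult (poly r x) (lagrange X x)) < card X"
  proof (rule degree_sum_less)
    show "degree (Polynomial.smult (poly r x) (lagrange X x)) < card X" if "x \<in> X" for x
      using lagrange_degree[OF assms(1) that] degree_smult_le le_less_trans by blast
  qed (use assms in \<open>auto simp: card_gt_0_iff\<close>)
qed

text \<open>Exactness up to degree \<open>2 n\<close>: division by \<open>omega n \<tau>\<close> leaves a quotient of degree less
  than \<open>n\<close>, which the functional does not see, and a remainder that is interpolated exactly.\<close>

lemma quadrature:
  assumes "degree p \<le> 2 * n"
  shows "I p = (\<Sum>x\<in>nodes n \<tau>. weight (nodes n \<tau>) x * poly p x)"
proof -
  let ?X = "nodes n \<tau>" let ?w = "omega n \<tau>"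
  define q r where "q = p div ?w" and "r = p mod ?w"
  have p: "p = ?w * q + r" by (simp add: q_def r_def)
  have r: "r = 0 \<or> degree r < Suc n" using degree_mod_less[of ?w p] by (simp add: r_def)
  have "q = 0 \<or> degree q < n"
  proof (cases "q = 0")
    case False
    have "degree (?w * q) = Suc n + degree q" using False by (simp add: degree_mult_eq)
    moreover have "degree (p - r) \<le> 2 * n"
    proof (rule degree_diff_le)
      show "degree r \<le> 2 * n" using r by auto
    qed (use assms in auto)
    ultimately show ?thesis using p by auto
  qed auto
  then have Ip: "I p = I r" by (subst p) (simp add: I_add omega_orth)
  have ne: "?X \<noteq> {}" using nodes_card[of n \<tau>] by auto
  have px: "poly p x = poly r x" if "x \<in> ?X" for x
    using that by (subst p) (simp add: nodes_def)
  have "I r = I (\<Sum>x\<in>?X. Polynomial.smult (poly r x) (lagrange ?X x))"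
    using lagrange_interpolation[of ?X r] r ne by (simp add: nodes_card)
  also have "\<dots> = (\<Sum>x\<in>?X. weight ?X x * poly p x)"
    by (simp add: I_sum I_smult weight_def px mult.commute)
  finally show ?thesis using Ip by simp
qed

lemma weight_pos:
  assumes "x \<in> nodes n \<tau>"
  shows "weight (nodes n \<tau>) x > 0"
proof -
  let ?X = "nodes n \<tau>" let ?l = "lagrange ?X x"
  have dl: "degree ?l \<le> n" using lagrange_degree[OF nodes_finite assms] by (simp add: nodes_card)
  have "degree (?l * ?l) \<le> 2 * n" using degree_mult_le[of ?l ?l] dl by simp
  then have "I (?l * ?l) = (\<Sum>y\<in>?X. weight ?X y * poly (?l * ?l) y)" by (rule quadrature)
  also have "\<dots> = (\<Sum>y\<in>?X. if y = x then weight ?X x else 0)"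
    using assms by (intro sum.cong) (auto simp: lagrange_poly)
  also have "\<dots> = weight ?X x" using assms by simp
  finally have "weight ?X x = I (?l * ?l)" by simp
  moreover have "?l \<noteq> 0" using lagrange_poly[OF nodes_finite assms assms] by force
  ultimately show ?thesis using I_square_pos by simp
qed

lemma weight_sum: "(\<Sum>x\<in>nodes n \<tau>. weight (nodes n \<tau>) x) = I 1"
  using quadrature[of 1 n \<tau>] by simp

lemma I_1_pos: "I 1 > 0"
  by (rule I_pos) auto

text \<open>The second moment of the squared orthogonal polynomial with respect to the quadrature rule
  recovers the parameter, so a bound on the nodes gives a bound on the parameter.\<close>

lemma parameter_bound:
  assumes "\<And>x. x \<in> nodes n \<tau> \<Longrightarrow> \<bar>x\<bar> \<le> R"
  shows "\<bar>\<tau>\<bar> \<le> R + 1"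
proof -
  let ?X = "nodes n \<tau>" let ?w = "weight ?X"
  define d where "d = (if n = 0 then 0 else Polynomial.smult (c (n - 1)) (P (n - 1)))"
  have dd: "d = 0 \<or> degree d < n"
    by (auto simp: d_def intro: le_less_trans[OF degree_smult_le])
  have rec: "[:0, 1:] * P n = P (Suc n) + Polynomial.smult (b n) (P n) + d"
    unfolding d_def by (rule P_recurrence)
  have x: "x * poly (P n) x = (\<tau> + b n) * poly (P n) x + poly d x" if "x \<in> ?X" for x
    using arg_cong[OF rec, of "\<lambda>p. poly p x"] that
    by (simp add: nodes_def omega_def distrib_right)
  have h: "h n = (\<Sum>x\<in>?X. ?w x * poly (P n * P n) x)"
    unfolding h_def by (rule quadrature) (simp add: degree_mult_eq)
  have "I (P n * d) = (\<Sum>x\<in>?X. ?w x * poly (P n * d) x)"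
    using degree_mult_le[of "P n" d] dd by (intro quadrature) auto
  then have d0: "(\<Sum>x\<in>?X. ?w x * poly (P n * d) x) = 0" using P_orth[OF dd] by simp
  have "(\<tau> + b n) * h n = (\<Sum>x\<in>?X. ?w x * ((\<tau> + b n) * poly (P n * P n) x)) + (\<Sum>x\<in>?X. ?w x * poly (P n * d) x)"
    unfolding d0 unfolding h by (simp add: sum_distrib_left mult.left_commute)
  also have "\<dots> = (\<Sum>x\<in>?X. ?w x * poly (P n) x * ((\<tau> + b n) * poly (P n) x + poly d x))"
    by (simp add: sum.distrib[symmetric] algebra_simps)
  also have "\<dots> = (\<Sum>x\<in>?X. x * (?w x * poly (P n * P n) x))"
    by (intro sum.cong refl) (simp add: x[symmetric])
  finally have e: "(\<tau> + b n) * h n = (\<Sum>x\<in>?X. x * (?w x * poly (P n * P n) x))" .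
  have "\<bar>(\<tau> + b n) * h n\<bar> \<le> (\<Sum>x\<in>?X. R * (?w x * poly (P n * P n) x))" unfolding e
  proof (rule order_trans[OF sum_abs sum_mono])
    fix x assume "x \<in> ?X"
    then show "\<bar>x * (?w x * poly (P n * P n) x)\<bar> \<le> R * (?w x * poly (P n * P n) x)"
      using assms[of x] weight_pos[of x n \<tau>] by (auto simp: abs_mult intro!: mult_right_mono)
  qed
  also have "\<dots> = R * h n" by (simp add: h sum_distrib_left)
  finally have "\<bar>\<tau> + b n\<bar> \<le> R" using h_pos[of n] by (simp add: abs_mult)
  then show ?thesis using b_bound[of n] by linarith
qed

text \<open>Conversely, if \<open>y\<close> is a node and \<open>g\<close> is \<open>omega n \<tau>\<close> divided by \<open>t - y\<close>, then
  \<open>I ((t - y) * g\<^sup>2) = - \<tau> * h n\<close>, which the minimality of \<open>h n\<close> turns into a bound on \<open>y\<close>.\<close>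

lemma node_bound:
  assumes "y \<in> nodes n \<tau>"
  shows "\<bar>y\<bar> \<le> 1 + \<bar>\<tau>\<bar>"
proof -
  have "[:- y, 1:] dvd omega n \<tau>" using assms by (simp add: nodes_def poly_eq_0_iff_dvd)
  then obtain g where g: "omega n \<tau> = [:- y, 1:] * g" by (auto elim: dvdE)
  then have gne: "g \<noteq> 0" using omega_nonzero[of n \<tau>] by auto
  have "degree ([:- y, 1:] * g) = 1 + degree g" using gne by (subst degree_mult_eq) auto
  then have dg: "degree g = n" using omega_degree[of n \<tau>] unfolding g by simp
  have lg: "lead_coeff g = 1" using omega_lead[of n \<tau>] unfolding g lead_coeff_mult by simp
  have hg: "h n \<le> I (g * g)" using h_le[OF dg lg] .
  have "I (omega n \<tau> * g) = - \<tau> * h n"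
    using P_orth[of g "Suc n"] I_P_monic[of g n] dg lg
    by (simp add: omega_def left_diff_distrib I_diff I_smult)
  then have e: "I ([:- y, 1:] * (g * g)) = - \<tau> * h n" unfolding g by (simp only: mult.assoc)
  have up: "I ([:- y, 1:] * (g * g)) \<le> (1 - y) * I (g * g)"
    unfolding I_smult[symmetric]
  proof (rule I_mono)
    fix t assume "t \<in> E"
    then have "t - y \<le> 1 - y" using E_bounds by auto
    then have "(t - y) * (poly g t * poly g t) \<le> (1 - y) * (poly g t * poly g t)"
      by (intro mult_right_mono) auto
    then show "poly ([:- y, 1:] * (g * g)) t \<le> poly (Polynomial.smult (1 - y) (g * g)) t"
      by (simp add: algebra_simps)
  qed
  have lo: "(- 1 - y) * I (g * g) \<le> I ([:- y, 1:] * (g * g))"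
    unfolding I_smult[symmetric]
  proof (rule I_mono)
    fix t assume "t \<in> E"
    then have "- 1 - y \<le> t - y" using E_bounds by auto
    then have "(- 1 - y) * (poly g t * poly g t) \<le> (t - y) * (poly g t * poly g t)"
      by (intro mult_right_mono) auto
    then show "poly (Polynomial.smult (- 1 - y) (g * g)) t \<le> poly ([:- y, 1:] * (g * g)) t"
      by (simp add: algebra_simps)
  qed
  consider "\<bar>y\<bar> \<le> 1" | "y > 1" | "y < - 1" by linarith
  then show ?thesis
  proof cases
    case 2
    then have "(1 - y) * I (g * g) \<le> (1 - y) * h n" using hg by (intro mult_left_mono_neg) auto
    then have "- \<tau> * h n \<le> (1 - y) * h n" using up e by simp
    then have "- \<tau> \<le> 1 - y" using h_pos[of n] by (simp only: mult_le_cancel_right)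
    then show ?thesis using 2 by linarith
  next
    case 3
    then have "(- 1 - y) * h n \<le> (- 1 - y) * I (g * g)" using hg by (intro mult_left_mono) auto
    then have "(- 1 - y) * h n \<le> - \<tau> * h n" using lo e by linarith
    then have "- 1 - y \<le> - \<tau>" using h_pos[of n] by (simp only: mult_le_cancel_right)
    then show ?thesis using 3 by linarith
  qed linarith
qed

text \<open>Two nodes \<open>x, y\<close> with \<open>(t - x) * (t - y) \<ge> 0\<close> on \<open>E\<close> would give a nonnegative quadratic
  factor. In particular a gap of \<open>E\<close> contains at most one node.\<close>

lemma nodes_separated:
  assumes "x \<in> nodes n \<tau>" "y \<in> nodes n \<tau>" "x \<noteq> y"
  shows "\<exists>t\<in>E. (t - x) * (t - y) < 0"
proof (rule ccontr)
  assume "\<not> ?thesis"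
  then have nn: "\<And>t. t \<in> E \<Longrightarrow> (t - x) * (t - y) \<ge> 0" by force
  have "(\<Prod>z\<in>{x, y}. [:- z, 1:]) dvd omega n \<tau>"
    using assms by (intro prod_linear_factors_dvd) (auto simp: nodes_def)
  then have "[:- x, 1:] * [:- y, 1:] dvd omega n \<tau>" using assms(3) by simp
  moreover have "degree ([:- x, 1:] * [:- y, 1:]) = 2" by simp
  moreover have "poly ([:- x, 1:] * [:- y, 1:]) t \<ge> 0" if "t \<in> E" for t
    unfolding poly_mult using nn[OF that] by simp
  ultimately show False using no_nonneg_quadratic_factor by blast
qed

end

section \<open>Normal indices\<close>

context positive_functional
begin

text \<open>The Hankel matrix of the shifted moments \<open>I (t ^ (j + 1))\<close> is singular iff some nonzero \<open>v\<close> of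
  degree less than \<open>n\<close> makes \<open>t v\<close> orthogonal to all polynomials of degree less than \<open>n\<close>; such a
  \<open>t v\<close> is a nonzero multiple of \<open>P n\<close>.\<close>

lemma hankel_det_eq_0_iff:
  assumes s: "\<And>j. s j = I (monom 1 (j + 1))"
  shows "hankel_det s n = 0 \<longleftrightarrow> poly (P n) 0 = 0"
proof -
  define A where "A = Matrix.mat n n (\<lambda>(i, k). s (i + k))"
  define pol where "pol v = (\<Sum>k<n. monom (vec_index v k) k)" for v :: "real Matrix.vec"
  have A: "A \<in> carrier_mat n n" by (simp add: A_def)
  have entry: "vec_index (A *\<^sub>v v) i = I ([:0, 1:] * pol v * monom 1 i)"
    if "v \<in> carrier_vec n" "i < n" for v i
  proof -
    have "vec_index (A *\<^sub>v v) i = (\<Sum>k<n. s (i + k) * vec_index v k)"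
      using that A by (simp add: A_def scalar_prod_def atLeast0LessThan)
    also have "\<dots> = (\<Sum>k<n. I ([:0, 1:] * monom (vec_index v k) k * monom 1 i))"
    proof (rule sum.cong[OF refl])
      fix k
      have "[:0, 1:] * monom (vec_index v k) k * monom 1 i
          = Polynomial.smult (vec_index v k) (monom 1 (i + k + 1) :: real poly)"
        by (simp add: monom_Suc mult_monom smult_monom add.commute)
      then show "s (i + k) * vec_index v k = I ([:0, 1:] * monom (vec_index v k) k * monom 1 i)"
        by (simp only: I_smult s mult.commute)
    qed
    also have "\<dots> = I ([:0, 1:] * pol v * monom 1 i)"
      unfolding pol_def sum_distrib_left sum_distrib_right I_sum ..
    finally show ?thesis .
  qed
  have coeff_pol: "poly.coeff (pol v) k = (if k < n then vec_index v k else 0)" for v k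
    by (auto simp: pol_def coeff_sum)
  have deg_pol: "pol v = 0 \<or> degree (pol v) < n" for v
  proof (cases "n = 0")
    case False
    then have "degree (pol v) \<le> n - 1" by (intro degree_le) (auto simp: coeff_pol)
    then show ?thesis using False by auto
  qed (simp add: pol_def)
  have "(\<exists>v. v \<in> carrier_vec n \<and> v \<noteq> 0\<^sub>v n \<and> A *\<^sub>v v = 0\<^sub>v n) \<longleftrightarrow> poly (P n) 0 = 0"
  proof
    assume "\<exists>v. v \<in> carrier_vec n \<and> v \<noteq> 0\<^sub>v n \<and> A *\<^sub>v v = 0\<^sub>v n"
    then obtain v where v: "v \<in> carrier_vec n" "v \<noteq> 0\<^sub>v n" "A *\<^sub>v v = 0\<^sub>v n" by blast
    let ?q = "[:0, 1:] * pol v"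
    have pv: "pol v \<noteq> 0"
    proof
      assume "pol v = 0"
      then have "vec_index v k = 0" if "k < n" for k using coeff_pol[of v k] that by simp
      then show False using v(1,2) by (auto simp: vec_eq_iff)
    qed
    then have "degree ?q = Suc (degree (pol v))" by simp
    then have dq: "degree ?q \<le> n" using deg_pol[of v] pv by auto
    have mon: "I (?q * monom 1 i) = 0" if "i < n" for i
      using entry[OF v(1) that] v(3) that by simp
    have orth: "I (?q * p) = 0" if "p = 0 \<or> degree p < n" for p
    proof (cases "p = 0")
      case False
      have "p = (\<Sum>i\<le>degree p. Polynomial.smult (poly.coeff p i) (monom 1 i))"
        by (simp add: smult_monom poly_as_sum_of_monoms)
      then have "I (?q * p) = I (\<Sum>i\<le>degree p. Polynomial.smult (poly.coeff p i) (?q * monom 1 i))"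
        by (metis (no_types, lifting) mult_smult_right sum.cong sum_distrib_left)
      also have "\<dots> = 0" unfolding I_sum I_smult
        using that False mon by (intro sum.neutral) auto
      finally show ?thesis .
    qed simp
    obtain r where r: "?q = Polynomial.smult (poly.coeff ?q n) (P n) + r" "r = 0 \<or> degree r < n"
      using monic_split[OF P_degree P_lead dq] .
    have "I (r * r) = I (?q * r) - poly.coeff ?q n * I (P n * r)"
      using r(1) by (metis I_add I_smult add_diff_cancel_left' distrib_right mult_smult_left)
    then have "I (r * r) = 0" using orth[OF r(2)] P_orth[OF r(2)] by simp
    then have "r = 0" using I_square_pos[of r] by force
    then have q: "?q = Polynomial.smult (poly.coeff ?q n) (P n)" using r(1) by simp
    then have "poly.coeff ?q n \<noteq> 0" using pv by (metis mult_eq_0_iff pCons_eq_0_iff smult_0_left zero_neq_one)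
    moreover have "poly.coeff ?q n * poly (P n) 0 = 0"
      using arg_cong[OF q, of "\<lambda>p. poly p 0"] by simp
    ultimately show "poly (P n) 0 = 0" by simp
  next
    assume "poly (P n) 0 = 0"
    then have "[:0, 1:] dvd P n" using poly_eq_0_iff_dvd[of "P n" 0] by simp
    then obtain g where g: "P n = [:0, 1:] * g" by (auto elim: dvdE)
    then have gne: "g \<noteq> 0" using P_nonzero[of n] by auto
    then have dg: "degree g < n" using P_degree[of n] unfolding g by simp
    define v where "v = Matrix.vec n (poly.coeff g)"
    have v: "v \<in> carrier_vec n" by (simp add: v_def)
    have pv: "pol v = g" using dg by (auto simp: poly_eq_iff coeff_pol v_def coeff_eq_0)
    have "v \<noteq> 0\<^sub>v n"
    proof
      assume "v = 0\<^sub>v n"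
      then have "poly.coeff g (degree g) = 0" using dg by (metis index_vec index_zero_vec(1) v_def)
      then show False using gne by simp
    qed
    moreover have "A *\<^sub>v v = 0\<^sub>v n"
    proof (rule eq_vecI)
      fix i assume "i < dim_vec (0\<^sub>v n :: real Matrix.vec)"
      then have "i < n" by simp
      then have "vec_index (A *\<^sub>v v) i = I (P n * monom 1 i)"
        using entry[OF v] by (simp only: pv g)
      also have "\<dots> = 0" using \<open>i < n\<close> by (intro P_orth) (auto simp: degree_monom_eq)
      finally show "vec_index (A *\<^sub>v v) i = vec_index (0\<^sub>v n) i" using \<open>i < n\<close> by simp
    qed (use A in simp)
    ultimately show "\<exists>v. v \<in> carrier_vec n \<and> v \<noteq> 0\<^sub>v n \<and> A *\<^sub>v v = 0\<^sub>v n" using v by blast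
  qed
  then have "Determinant.det A = 0 \<longleftrightarrow> poly (P n) 0 = 0"
    using det_0_iff_vec_prod_zero_field[OF A] by blast
  then show ?thesis unfolding hankel_det_def A_def .
qed

text \<open>The numbers \<open>n\<close> with \<open>P n\<close> not vanishing at the origin, in increasing order; the first one
  is 0.\<close>

definition nu :: "nat \<Rightarrow> nat" where
  "nu = enumerate {n. poly (P n) 0 \<noteq> 0}"

lemma normal_infinite: "infinite {n. poly (P n) 0 \<noteq> 0}"
  unfolding infinite_nat_iff_unbounded_le
proof
  fix m
  show "\<exists>n\<ge>m. n \<in> {n. poly (P n) 0 \<noteq> 0}"
    using P_consecutive_nonzero[of m] by (auto intro: exI[of _ m] exI[of _ "Suc m"])
qed

lemma nu_strict_mono: "strict_mono nu"
  unfolding nu_def by (rule strict_mono_enumerate[OF normal_infinite])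

lemma nu_nonzero: "poly (P (nu j)) 0 \<noteq> 0"
  using enumerate_in_set[OF normal_infinite, of j] by (simp add: nu_def)

lemma nu_0 [simp]: "nu 0 = 0"
  unfolding nu_def enumerate_0 by (rule Least_eq_0) simp

lemma nu_Suc: "nu (Suc j) = (if poly (P (Suc (nu j))) 0 \<noteq> 0 then Suc (nu j) else Suc (Suc (nu j)))"
proof -
  have "nu (Suc j) = (LEAST n. poly (P n) 0 \<noteq> 0 \<and> nu j < n)"
    using enumerate_Suc''[OF normal_infinite, of j] by (simp add: nu_def)
  also have "\<dots> = (if poly (P (Suc (nu j))) 0 \<noteq> 0 then Suc (nu j) else Suc (Suc (nu j)))"
  proof (cases "poly (P (Suc (nu j))) 0 = 0")
    case False
    then show ?thesis by (auto intro!: Least_equality)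
  next
    case True
    then have "poly (P (Suc (Suc (nu j)))) 0 \<noteq> 0" using P_consecutive_nonzero[of "Suc (nu j)"] by simp
    then show ?thesis using True
      by (auto intro!: Least_equality simp: Suc_le_eq) (metis Suc_lessI)
  qed
  finally show ?thesis .
qed

lemma normal_index_eq_nu:
  assumes "\<And>j. s j = I (monom 1 (j + 1))"
  shows "normal_index s = nu"
proof
  fix j
  have "nu (Suc i) = enumerate {n. n \<ge> 1 \<and> hankel_det s n \<noteq> 0} i" for i
  proof -
    have "nu (Suc i) = enumerate ({n. poly (P n) 0 \<noteq> 0} - {LEAST n. n \<in> {n. poly (P n) 0 \<noteq> 0}}) i"
      unfolding nu_def by (rule enumerate_Suc)
    also have "(LEAST n. n \<in> {n. poly (P n) 0 \<noteq> 0}) = 0" by (rule Least_eq_0) simp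
    also have "{n. poly (P n) 0 \<noteq> 0} - {0} = {n. n \<ge> 1 \<and> hankel_det s n \<noteq> 0}"
      using hankel_det_eq_0_iff[of s, OF assms] by (auto simp: Suc_le_eq intro: gr0I)
    finally show ?thesis .
  qed
  then show "normal_index s j = nu j" by (cases j) (simp_all add: normal_index_def)
qed

end

section \<open>Block triangular factors\<close>

text \<open>Block structures with blocks of size 1 and 2. Every index is of the form \<open>n a\<close> or, if block
  \<open>a\<close> has size 2, of the form \<open>n a + 1\<close>; entries of block matrices are computed in these
  coordinates.\<close>

locale block_structure =
  fixes n :: "nat \<Rightarrow> nat"
  assumes n_0: "n 0 = 0" and n_Suc: "n (Suc a) = Suc (n a) \<or> n (Suc a) = Suc (Suc (n a))"
begin

lemma n_mono: "strict_mono n"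
  using n_Suc by (intro strict_mono_Suc_iff[THEN iffD2]) (metis lessI less_SucI)

lemma n_eq_iff [simp]: "n a = n b \<longleftrightarrow> a = b"
  using n_mono by (simp add: strict_mono_eq)

lemma block_of_eq: "n a \<le> i \<Longrightarrow> i < n (Suc a) \<Longrightarrow> block_of n i = a"
  unfolding block_of_def
proof (rule Least_equality)
  fix j assume "n a \<le> i" "i < n (Suc a)" "i < n (Suc j)"
  then have "n a < n (Suc j)" by simp
  then show "a \<le> j" using n_mono by (simp add: strict_mono_less)
qed

lemma block_of_n [simp]: "block_of n (n a) = a"
  using n_mono by (intro block_of_eq) (auto simp: strict_mono_less)

lemma block_of_Suc_n: "n (Suc a) = Suc (Suc (n a)) \<Longrightarrow> block_of n (Suc (n a)) = a"
  by (intro block_of_eq) auto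

lemma index_cases_aux:
  obtains (first) a where "i = n a" | (second) a where "i = Suc (n a)" "n (Suc a) = Suc (Suc (n a))"
proof -
  have "i < n (Suc i)" using strict_mono_imp_increasing[OF n_mono, of "Suc i"] by simp
  define a where "a = block_of n i"
  have lt: "i < n (Suc a)" unfolding a_def block_of_def
    using \<open>i < n (Suc i)\<close> by (rule LeastI)
  have ge: "n a \<le> i"
  proof (cases a)
    case (Suc k)
    then have "k < block_of n i" using a_def by simp
    then have "\<not> i < n (Suc k)" unfolding block_of_def by (rule not_less_Least)
    then show ?thesis using Suc by simp
  qed (simp add: n_0)
  show ?thesis using n_Suc[of a] lt ge first[of a] second[of a]
    by (metis Suc_leI le_antisym less_Suc_eq not_less_eq_eq)
qed

text \<open>Block \<open>a\<close> has size 2.\<close>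

definition two :: "nat \<Rightarrow> bool" where
  "two a \<longleftrightarrow> n (Suc a) = Suc (Suc (n a))"

lemma n_Suc_two: "n (Suc a) = (if two a then Suc (Suc (n a)) else Suc (n a))"
  using n_Suc[of a] by (auto simp: two_def)

lemma index_cases:
  obtains (first) a where "i = n a" | (second) a where "i = Suc (n a)" "two a"
  using index_cases_aux[of i] unfolding two_def by metis

lemma block_of_second [simp]: "two a \<Longrightarrow> block_of n (Suc (n a)) = a"
  by (simp add: two_def block_of_Suc_n)

lemma block_size_two: "block_size n a = (if two a then 2 else 1)"
  by (simp add: block_size_def n_Suc_two)

lemma n_less_Suc: "n a < n (Suc a)" using n_Suc[of a] by auto

lemma first_neq_second [simp]: "two b \<Longrightarrow> n a \<noteq> Suc (n b)" "two b \<Longrightarrow> Suc (n b) \<noteq> n a"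
  by (metis block_of_second block_of_n n_not_Suc_n)+

lemma first_eq_Suc_single [simp]:
  "\<not> two a \<Longrightarrow> n b = Suc (n a) \<longleftrightarrow> b = Suc a" "\<not> two a \<Longrightarrow> Suc (n a) = n b \<longleftrightarrow> b = Suc a"
  using n_eq_iff[of b "Suc a"] n_Suc_two[of a] by auto

lemma first_eq_Suc_Suc [simp]:
  "two a \<Longrightarrow> n b = Suc (Suc (n a)) \<longleftrightarrow> b = Suc a" "two a \<Longrightarrow> Suc (Suc (n a)) = n b \<longleftrightarrow> b = Suc a"
  using n_eq_iff[of b "Suc a"] n_Suc_two[of a] by auto

lemma block_L_entries [simp]:
  "block_L n l (n a) (n b) = (if a = b then 1 else if a = Suc b then l a else 0)"
  "two b \<Longrightarrow> block_L n l (n a) (Suc (n b)) = 0"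
  "two a \<Longrightarrow> block_L n l (Suc (n a)) (n b) = 0"
  "two a \<Longrightarrow> two b \<Longrightarrow> block_L n l (Suc (n a)) (Suc (n b)) = (if a = b then 1 else 0)"
  by (auto simp: block_L_def block_matrix_def upper_left_block_def)

lemma block_U_entries [simp]:
  "\<not> two a \<Longrightarrow> block_U n u0 u1 (n a) (n b) = (if a = b then u0 a else if b = Suc a then 1 else 0)"
  "\<not> two a \<Longrightarrow> two b \<Longrightarrow> block_U n u0 u1 (n a) (Suc (n b)) = 0"
  "two a \<Longrightarrow> block_U n u0 u1 (n a) (n b) = 0"
  "two a \<Longrightarrow> two b \<Longrightarrow> block_U n u0 u1 (n a) (Suc (n b)) = (if a = b then 1 else 0)"
  "two a \<Longrightarrow> block_U n u0 u1 (Suc (n a)) (n b) = (if a = b then u0 a else if b = Suc a then 1 else 0)"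
  "two a \<Longrightarrow> two b \<Longrightarrow> block_U n u0 u1 (Suc (n a)) (Suc (n b)) = (if a = b then u1 a else 0)"
  by (auto simp: block_U_def block_matrix_def lower_left_block_def diag_block_def block_size_two)

lemma imatrix_eqI:
  fixes A B :: imatrix
  assumes "\<And>a b. A (n a) (n b) = B (n a) (n b)"
    and "\<And>a b. two b \<Longrightarrow> A (n a) (Suc (n b)) = B (n a) (Suc (n b))"
    and "\<And>a b. two a \<Longrightarrow> A (Suc (n a)) (n b) = B (Suc (n a)) (n b)"
    and "\<And>a b. two a \<Longrightarrow> two b \<Longrightarrow> A (Suc (n a)) (Suc (n b)) = B (Suc (n a)) (Suc (n b))"
  shows "A = B"
proof (intro ext)
  fix i k show "A i k = B i k"
    by (cases i rule: index_cases; cases k rule: index_cases) (auto simp: assms)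
qed

lemma imult_L_first:
  "imult (block_L n l) B (n a) k = B (n a) k + (case a of 0 \<Rightarrow> 0 | Suc d \<Rightarrow> l a * B (n d) k)"
proof -
  have "block_L n l (n a) j = 0" if "j \<notin> {n a, n (a - 1)}" for j
    using that by (cases j rule: index_cases) auto
  then have "imult (block_L n l) B (n a) k = (\<Sum>j\<in>{n a, n (a - 1)}. block_L n l (n a) j * B j k)"
    unfolding imult_def by (intro suminf_finite) auto
  then show ?thesis by (cases a) simp_all
qed

lemma imult_L_second:
  assumes "two a"
  shows "imult (block_L n l) B (Suc (n a)) k = B (Suc (n a)) k"
proof -
  have "block_L n l (Suc (n a)) j = 0" if "j \<noteq> Suc (n a)" for j
    using that assms by (cases j rule: index_cases) auto
  then have "imult (block_L n l) B (Suc (n a)) k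
      = (\<Sum>j\<in>{Suc (n a)}. block_L n l (Suc (n a)) j * B j k)"
    unfolding imult_def by (intro suminf_finite) auto
  then show ?thesis using assms by simp
qed

lemma imult_U_single:
  assumes "\<not> two a"
  shows "imult (block_U n u0 u1) B (n a) k = u0 a * B (n a) k + B (n (Suc a)) k"
proof -
  have "block_U n u0 u1 (n a) j = 0" if "j \<notin> {n a, n (Suc a)}" for j
    using that assms by (cases j rule: index_cases) auto
  then have "imult (block_U n u0 u1) B (n a) k
      = (\<Sum>j\<in>{n a, n (Suc a)}. block_U n u0 u1 (n a) j * B j k)"
    unfolding imult_def by (intro suminf_finite) auto
  then show ?thesis using assms by simp
qed

lemma imult_U_first:
  assumes "two a"
  shows "imult (block_U n u0 u1) B (n a) k = B (Suc (n a)) k"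
proof -
  have "block_U n u0 u1 (n a) j = 0" if "j \<noteq> Suc (n a)" for j
    using that assms by (cases j rule: index_cases) auto
  then have "imult (block_U n u0 u1) B (n a) k
      = (\<Sum>j\<in>{Suc (n a)}. block_U n u0 u1 (n a) j * B j k)"
    unfolding imult_def by (intro suminf_finite) auto
  then show ?thesis using assms by simp
qed

lemma imult_U_second:
  assumes "two a"
  shows "imult (block_U n u0 u1) B (Suc (n a)) k
    = u0 a * B (n a) k + u1 a * B (Suc (n a)) k + B (n (Suc a)) k"
proof -
  have "block_U n u0 u1 (Suc (n a)) j = 0" if "j \<notin> {n a, Suc (n a), n (Suc a)}" for j
    using that assms by (cases j rule: index_cases) auto
  then have "imult (block_U n u0 u1) B (Suc (n a)) k
      = (\<Sum>j\<in>{n a, Suc (n a), n (Suc a)}. block_U n u0 u1 (Suc (n a)) j * B j k)"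
    unfolding imult_def by (intro suminf_finite) auto
  then show ?thesis using assms by simp
qed

text \<open>The matrix with diagonal \<open>b\<close>, subdiagonal \<open>c\<close> and superdiagonal 1.\<close>

definition tridiagonal :: "(nat \<Rightarrow> real) \<Rightarrow> (nat \<Rightarrow> real) \<Rightarrow> imatrix" where
  "tridiagonal b c = (\<lambda>i k. if k = i then b i else if k = Suc i then 1 else if i = Suc k then c k else 0)"

text \<open>The factorization \<open>J = L U\<close> of this matrix, written out in the entries of the factors. The
  first row of block \<open>a\<close> of \<open>L\<close> picks up the first row of block \<open>a - 1\<close> of \<open>U\<close>, which reaches
  column \<open>n a\<close> only if that block has size 1.\<close>

definition LU_equations ::
    "(nat \<Rightarrow> real) \<Rightarrow> (nat \<Rightarrow> real) \<Rightarrow> (nat \<Rightarrow> real) \<Rightarrow> (nat \<Rightarrow> real) \<Rightarrow> (nat \<Rightarrow> real) \<Rightarrow> bool" where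
  "LU_equations b c l u0 u1 \<longleftrightarrow> (\<forall>a.
     b (n a) = (if two a then 0 else u0 a) + (case a of 0 \<Rightarrow> 0 | Suc d \<Rightarrow> if two d then 0 else l a) \<and>
     (if two a then c (n a) = u0 a \<and> b (Suc (n a)) = u1 a \<and> c (Suc (n a)) = l (Suc a)
      else c (n a) = l (Suc a) * u0 a))"

lemma LU_iff:
  "tridiagonal b c = imult (block_L n l) (block_U n u0 u1) \<longleftrightarrow> LU_equations b c l u0 u1"
proof
  assume eq: "tridiagonal b c = imult (block_L n l) (block_U n u0 u1)"
  have ent: "tridiagonal b c i k = imult (block_L n l) (block_U n u0 u1) i k" for i k
    using eq by simp
  show "LU_equations b c l u0 u1"
    unfolding LU_equations_def
  proof (intro allI conjI)
    fix a
    show "b (n a) = (if two a then 0 else u0 a)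
        + (case a of 0 \<Rightarrow> 0 | Suc d \<Rightarrow> if two d then 0 else l a)"
    proof (cases a)
      case 0
      then show ?thesis using ent[of "n a" "n a"]
        by (cases "two a") (simp_all add: tridiagonal_def imult_L_first)
    next
      case (Suc d)
      then show ?thesis using ent[of "n a" "n a"]
        by (cases "two a"; cases "two d") (simp_all add: tridiagonal_def imult_L_first)
    qed
    show "if two a then c (n a) = u0 a \<and> b (Suc (n a)) = u1 a \<and> c (Suc (n a)) = l (Suc a)
      else c (n a) = l (Suc a) * u0 a"
    proof (cases "two a")
      case True
      have "c (n a) = u0 a" using ent[of "Suc (n a)" "n a"] True
        by (simp add: tridiagonal_def imult_L_second)
      moreover have "b (Suc (n a)) = u1 a" using ent[of "Suc (n a)" "Suc (n a)"] True
        by (simp add: tridiagonal_def imult_L_second)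
      moreover have "c (Suc (n a)) = l (Suc a)" using ent[of "n (Suc a)" "Suc (n a)"] True
        by (cases "two (Suc a)") (simp_all add: tridiagonal_def imult_L_first)
      ultimately show ?thesis using True by simp
    next
      case False
      then show ?thesis using ent[of "n (Suc a)" "n a"]
        by (cases "two (Suc a)") (simp_all add: tridiagonal_def imult_L_first)
    qed
  qed
next
  assume "LU_equations b c l u0 u1"
  then have E1: "b (n a) = (if two a then 0 else u0 a)
      + (case a of 0 \<Rightarrow> 0 | Suc d \<Rightarrow> if two d then 0 else l a)"
    and E2: "two a \<Longrightarrow> c (n a) = u0 a" "two a \<Longrightarrow> b (Suc (n a)) = u1 a"
      "two a \<Longrightarrow> c (Suc (n a)) = l (Suc a)"
    and E3: "\<not> two a \<Longrightarrow> c (n a) = l (Suc a) * u0 a" for a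
    unfolding LU_equations_def by presburger+
  show "tridiagonal b c = imult (block_L n l) (block_U n u0 u1)"
  proof (rule imatrix_eqI)
    fix a k
    show "tridiagonal b c (n a) (n k) = imult (block_L n l) (block_U n u0 u1) (n a) (n k)"
    proof (cases a)
      case 0
      then show ?thesis
        by (cases "two a"; cases "two k") (auto simp: tridiagonal_def imult_L_first E1[of 0] E3)
    next
      case (Suc d)
      then show ?thesis
        by (cases "two a"; cases "two k"; cases "two d")
          (auto simp: tridiagonal_def imult_L_first E1[of "Suc d"] E3)
    qed
    assume k: "two k"
    show "tridiagonal b c (n a) (Suc (n k)) = imult (block_L n l) (block_U n u0 u1) (n a) (Suc (n k))"
      using k by (cases "k = a"; cases "two a"; cases a; cases "two (a - 1)")
        (auto simp: tridiagonal_def imult_L_first E2)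
  next
    fix a k assume a: "two a"
    then show "tridiagonal b c (Suc (n a)) (n k)
        = imult (block_L n l) (block_U n u0 u1) (Suc (n a)) (n k)"
      by (cases "two k") (auto simp: tridiagonal_def imult_L_second E2)
    show "two k \<Longrightarrow> tridiagonal b c (Suc (n a)) (Suc (n k))
        = imult (block_L n l) (block_U n u0 u1) (Suc (n a)) (Suc (n k))"
      using a by (auto simp: tridiagonal_def imult_L_second E2)
  qed
qed

lemma block_U_cong:
  assumes "\<And>a. u0 a = v0 a" "\<And>a. two a \<Longrightarrow> u1 a = v1 a"
  shows "block_U n u0 u1 = block_U n v0 v1"
proof (rule imatrix_eqI)
  fix a b
  show "block_U n u0 u1 (n a) (n b) = block_U n v0 v1 (n a) (n b)"
    by (cases "two a") (auto simp: assms)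
  show "two b \<Longrightarrow> block_U n u0 u1 (n a) (Suc (n b)) = block_U n v0 v1 (n a) (Suc (n b))"
    by (cases "two a") auto
qed (auto simp: assms)

text \<open>The \<open>LU\<close> factorization determines \<open>U\<close> block row by block row, because the numbers
  \<open>c\<close> do not vanish.\<close>

lemma LU_factor_U_eq:
  assumes "LU_equations b c l u0 u1" "\<And>j. c j \<noteq> 0"
  shows "LU_factor_U n (tridiagonal b c) = block_U n u0 u1"
  unfolding LU_factor_U_def
proof (rule the_equality)
  show "\<exists>l u0' u1'. block_U n u0 u1 = block_U n u0' u1'
      \<and> tridiagonal b c = imult (block_L n l) (block_U n u0 u1)"
    using assms(1) LU_iff by blast
next
  fix U assume "\<exists>l u0 u1. U = block_U n u0 u1 \<and> tridiagonal b c = imult (block_L n l) U"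
  then obtain m v0 v1 where U: "U = block_U n v0 v1" and E: "LU_equations b c m v0 v1"
    using LU_iff by blast
  have E1: "b (n a) = (if two a then 0 else v0 a)
      + (case a of 0 \<Rightarrow> 0 | Suc d \<Rightarrow> if two d then 0 else m a)"
    and E2: "two a \<Longrightarrow> c (n a) = v0 a" "two a \<Longrightarrow> b (Suc (n a)) = v1 a"
    and E3: "\<not> two a \<Longrightarrow> c (n a) = m (Suc a) * v0 a" for a
    using E unfolding LU_equations_def by presburger+
  have F1: "b (n a) = (if two a then 0 else u0 a)
      + (case a of 0 \<Rightarrow> 0 | Suc d \<Rightarrow> if two d then 0 else l a)"
    and F2: "two a \<Longrightarrow> c (n a) = u0 a" "two a \<Longrightarrow> b (Suc (n a)) = u1 a"
    and F3: "\<not> two a \<Longrightarrow> c (n a) = l (Suc a) * u0 a" for a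
    using assms(1) unfolding LU_equations_def by presburger+
  have "u0 a = v0 a" for a
  proof (induction a)
    case 0
    show ?case using E1[of 0] F1[of 0] E2(1)[of 0] F2(1)[of 0] by (cases "two 0") auto
  next
    case (Suc a)
    have "m (Suc a) = l (Suc a)" if "\<not> two a"
    proof -
      have "m (Suc a) * u0 a = l (Suc a) * u0 a" "l (Suc a) * u0 a \<noteq> 0"
        using E3[of a] F3[of a] Suc that assms(2)[of "n a"] by auto
      then show ?thesis by simp
    qed
    then show ?case
      using E1[of "Suc a"] F1[of "Suc a"] E2(1)[of "Suc a"] F2(1)[of "Suc a"]
      by (cases "two (Suc a)") (auto split: if_splits)
  qed
  moreover have "u1 a = v1 a" if "two a" for a
    using E2(2)[of a] F2(2)[of a] that by simp
  ultimately show "U = block_U n u0 u1" unfolding U by (intro block_U_cong) simp_all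
qed

text \<open>The monic block tridiagonal matrix with diagonal blocks given by \<open>p0\<close> and \<open>p1\<close> and
  off-diagonal blocks given by \<open>c\<close>.\<close>

definition block_tridiagonal :: "(nat \<Rightarrow> real) \<Rightarrow> (nat \<Rightarrow> real) \<Rightarrow> (nat \<Rightarrow> real) \<Rightarrow> imatrix" where
  "block_tridiagonal p0 p1 c = block_matrix n (\<lambda>a b r k.
     if a = b then diag_block (block_size n a) (- p0 a) (- p1 a) r k
     else if b = Suc a then lower_left_block (block_size n a) 1 r k
     else if a = Suc b then lower_left_block (block_size n a) (c b) r k
     else 0)"

lemma block_tridiagonal_entries [simp]:
  "\<not> two a \<Longrightarrow> block_tridiagonal p0 p1 c (n a) (n b) =
     (if a = b then - p0 a else if b = Suc a then 1 else if a = Suc b then c b else 0)"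
  "\<not> two a \<Longrightarrow> two b \<Longrightarrow> block_tridiagonal p0 p1 c (n a) (Suc (n b)) = 0"
  "two a \<Longrightarrow> block_tridiagonal p0 p1 c (n a) (n b) = 0"
  "two a \<Longrightarrow> two b \<Longrightarrow> block_tridiagonal p0 p1 c (n a) (Suc (n b)) = (if a = b then 1 else 0)"
  "two a \<Longrightarrow> block_tridiagonal p0 p1 c (Suc (n a)) (n b) =
     (if a = b then - p0 a else if b = Suc a then 1 else if a = Suc b then c b else 0)"
  "two a \<Longrightarrow> two b \<Longrightarrow> block_tridiagonal p0 p1 c (Suc (n a)) (Suc (n b)) = (if a = b then - p1 a else 0)"
  by (auto simp: block_tridiagonal_def block_matrix_def lower_left_block_def diag_block_def
      block_size_two)

text \<open>The factorization \<open>J = U L\<close> of a block tridiagonal matrix, written out in the entries of the factors.\<close>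

definition UL_equations ::
    "(nat \<Rightarrow> real) \<Rightarrow> (nat \<Rightarrow> real) \<Rightarrow> (nat \<Rightarrow> real) \<Rightarrow> (nat \<Rightarrow> real) \<Rightarrow> (nat \<Rightarrow> real) \<Rightarrow> (nat \<Rightarrow> real) \<Rightarrow> bool" where
  "UL_equations p0 p1 c l u0 u1 \<longleftrightarrow> (\<forall>a.
     - p0 a = u0 a + l (Suc a) \<and> c a = u0 (Suc a) * l (Suc a) \<and> (two a \<longrightarrow> - p1 a = u1 a))"

lemma UL_iff:
  "block_tridiagonal p0 p1 c = imult (block_U n u0 u1) (block_L n l)
    \<longleftrightarrow> UL_equations p0 p1 c l u0 u1"
proof
  assume eq: "block_tridiagonal p0 p1 c = imult (block_U n u0 u1) (block_L n l)"
  have ent: "block_tridiagonal p0 p1 c i k = imult (block_U n u0 u1) (block_L n l) i k" for i k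
    using eq by simp
  show "UL_equations p0 p1 c l u0 u1"
    unfolding UL_equations_def
  proof (intro allI conjI impI)
    fix a
    show "- p0 a = u0 a + l (Suc a)"
      using ent[of "n a" "n a"] ent[of "Suc (n a)" "n a"]
      by (cases "two a") (auto simp: imult_U_single imult_U_second)
    show "c a = u0 (Suc a) * l (Suc a)"
      using ent[of "n (Suc a)" "n a"] ent[of "Suc (n (Suc a))" "n a"]
      by (cases "two (Suc a)") (auto simp: imult_U_single imult_U_second)
    assume "two a"
    then show "- p1 a = u1 a"
      using ent[of "Suc (n a)" "Suc (n a)"] by (auto simp: imult_U_second)
  qed
next
  assume "UL_equations p0 p1 c l u0 u1"
  then have p0: "- p0 a = u0 a + l (Suc a)" and c: "c a = u0 (Suc a) * l (Suc a)"
    and p1: "two a \<Longrightarrow> - p1 a = u1 a" for a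
    unfolding UL_equations_def by auto
  show "block_tridiagonal p0 p1 c = imult (block_U n u0 u1) (block_L n l)"
  proof (rule imatrix_eqI)
    fix a k
    show "block_tridiagonal p0 p1 c (n a) (n k) = imult (block_U n u0 u1) (block_L n l) (n a) (n k)"
      by (cases "two a") (auto simp: imult_U_single imult_U_first p0 c)
    assume k: "two k"
    then show "block_tridiagonal p0 p1 c (n a) (Suc (n k))
        = imult (block_U n u0 u1) (block_L n l) (n a) (Suc (n k))"
      by (cases "two a") (auto simp: imult_U_single imult_U_first)
  next
    fix a k assume a: "two a"
    then show "block_tridiagonal p0 p1 c (Suc (n a)) (n k)
        = imult (block_U n u0 u1) (block_L n l) (Suc (n a)) (n k)"
      by (auto simp: imult_U_second p0 c)
    show "two k \<Longrightarrow> block_tridiagonal p0 p1 c (Suc (n a)) (Suc (n k))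
        = imult (block_U n u0 u1) (block_L n l) (Suc (n a)) (Suc (n k))"
      using a by (auto simp: imult_U_second p1)
  qed
qed

text \<open>Once the first entry \<open>u0 0\<close> is prescribed, the equations determine \<open>l (Suc a)\<close> and
  \<open>u0 (Suc a)\<close> in turn, because the numbers \<open>l\<close> of the known solution do not vanish.\<close>

lemma UL_factor_U_eq:
  assumes "UL_equations p0 p1 c l u0 u1" "\<And>j. l (Suc j) \<noteq> 0"
  shows "UL_factor_U n (block_tridiagonal p0 p1 c) (u0 0) = block_U n u0 u1"
  unfolding UL_factor_U_def
proof (rule the_equality)
  show "\<exists>l u0' u1'. block_U n u0 u1 = block_U n u0' u1' \<and> u0' 0 = u0 0
      \<and> block_tridiagonal p0 p1 c = imult (block_U n u0 u1) (block_L n l)"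
    using assms(1) UL_iff by blast
next
  fix U assume "\<exists>l v0 v1. U = block_U n v0 v1 \<and> v0 0 = u0 0
      \<and> block_tridiagonal p0 p1 c = imult U (block_L n l)"
  then obtain m v0 v1 where U: "U = block_U n v0 v1" and v: "v0 0 = u0 0"
    and E: "UL_equations p0 p1 c m v0 v1"
    using UL_iff by blast
  have E: "- p0 a = v0 a + m (Suc a)" "c a = v0 (Suc a) * m (Suc a)" "two a \<Longrightarrow> - p1 a = v1 a" for a
    using E unfolding UL_equations_def by auto
  have F: "- p0 a = u0 a + l (Suc a)" "c a = u0 (Suc a) * l (Suc a)" "two a \<Longrightarrow> - p1 a = u1 a" for a
    using assms(1) unfolding UL_equations_def by auto
  have "v0 a = u0 a" for a
  proof (induction a)
    case (Suc a)
    have "m (Suc a) = l (Suc a)" using E(1)[of a] F(1)[of a] Suc by simp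
    then show ?case using E(2)[of a] F(2)[of a] assms(2)[of a] by simp
  qed (rule v)
  moreover have "v1 a = u1 a" if "two a" for a
    using E(3)[OF that] F(3)[OF that] by simp
  ultimately show "U = block_U n u0 u1" unfolding U by (rule block_U_cong)
qed

end

section \<open>Bounded banded matrices\<close>

text \<open>The entries of a bounded matrix are bounded, as one sees on the unit vectors; a tridiagonal
  matrix with bounded entries is bounded.\<close>

lemma bounded_l2_entry:
  assumes "bounded_l2 A"
  shows "\<exists>C. \<forall>i j. \<bar>A i j\<bar> \<le> C"
proof -
  from assms obtain C where C: "\<And>x. in_l2 x \<Longrightarrow> in_l2 (iapply A x) \<and> l2_norm (iapply A x) \<le> C * l2_norm x"
    unfolding bounded_l2_def by blast
  have "\<bar>A i j\<bar> \<le> C" for i j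
  proof -
    define e :: "nat \<Rightarrow> complex" where "e = (\<lambda>k. if k = j then 1 else 0)"
    have s: "(\<lambda>k. (cmod (e k))\<^sup>2) sums (\<Sum>k\<in>{j}. (cmod (e k))\<^sup>2)"
      by (rule sums_finite) (auto simp: e_def)
    have e: "in_l2 e" "l2_norm e = 1"
      using s by (auto simp: in_l2_def l2_norm_def sums_iff e_def)
    have "iapply A e i = (\<Sum>k\<in>{j}. complex_of_real (A i k) * e k)"
      unfolding iapply_def by (rule suminf_finite) (auto simp: e_def)
    then have app: "iapply A e i = complex_of_real (A i j)" by (simp add: e_def)
    have "summable (\<lambda>k. (cmod (iapply A e k))\<^sup>2)" using C[OF e(1)] by (simp add: in_l2_def)
    then have "(\<Sum>k\<in>{i}. (cmod (iapply A e k))\<^sup>2) \<le> (\<Sum>k. (cmod (iapply A e k))\<^sup>2)"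
      by (rule sum_le_suminf) auto
    then have "sqrt ((cmod (iapply A e i))\<^sup>2) \<le> l2_norm (iapply A e)"
      unfolding l2_norm_def by (intro real_sqrt_le_mono) simp
    also have "\<dots> \<le> C" using C[OF e(1)] e(2) by simp
    finally show ?thesis by (simp add: app)
  qed
  then show ?thesis by blast
qed

lemma bounded_l2_banded:
  assumes band: "\<And>i j. A i j \<noteq> 0 \<Longrightarrow> i \<le> Suc j \<and> j \<le> Suc i" and M: "\<And>i j. \<bar>A i j\<bar> \<le> M"
  shows "bounded_l2 A"
proof -
  have M0: "M \<ge> 0" using M[of 0 0] by linarith
  have "(\<forall>i. summable (\<lambda>j. complex_of_real (A i j) * x j)) \<and> in_l2 (iapply A x)
      \<and> l2_norm (iapply A x) \<le> (4 * M) * l2_norm x" if x: "in_l2 x" for x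
  proof -
    define y where "y i = (cmod (x i))\<^sup>2" for i
    have y0: "y i \<ge> 0" for i by (simp add: y_def)
    have sy: "summable y" using x by (simp add: in_l2_def y_def[abs_def])
    then have sy1: "summable (\<lambda>i. y (Suc i))" by (simp add: summable_Suc_iff)
    have syp: "summable (\<lambda>i. y (i - 1))"
      using sy by (subst summable_Suc_iff[symmetric]) simp
    have fin: "complex_of_real (A i j) * x j = 0" if "j \<notin> {i - 1, i, Suc i}" for i j
    proof -
      have "j \<in> {i - 1, i, Suc i}" if "i \<le> Suc j" "j \<le> Suc i" using that by auto
      then have "A i j = 0" using band[of i j] that by blast
      then show ?thesis by simp
    qed
    have summ: "summable (\<lambda>j. complex_of_real (A i j) * x j)" for i
      by (rule summable_finite[of "{i - 1, i, Suc i}"]) (use fin in auto)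
    have app: "iapply A x i = (\<Sum>j\<in>{i - 1, i, Suc i}. complex_of_real (A i j) * x j)" for i
      unfolding iapply_def by (rule suminf_finite) (use fin in auto)
    \<comment> \<open>For \<open>i = 0\<close> the truncated index \<open>i - 1\<close> repeats the entry 0, which only enlarges the bound.\<close>
    have sq: "(cmod (iapply A x i))\<^sup>2 \<le> 3 * M\<^sup>2 * (y (i - 1) + y i + y (Suc i))" for i
    proof -
      have "cmod (iapply A x i) \<le> (\<Sum>j\<in>{i - 1, i, Suc i}. M * cmod (x j))"
        unfolding app using M by (intro sum_norm_le) (auto simp: norm_mult intro!: mult_right_mono)
      also have "\<dots> \<le> M * cmod (x (i - 1)) + M * cmod (x i) + M * cmod (x (Suc i))"
        using M0 by (cases i) auto
      finally have le: "cmod (iapply A x i) \<le> M * (cmod (x (i - 1)) + cmod (x i) + cmod (x (Suc i)))"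
        by (simp add: algebra_simps)
      have sq3: "(p + q + r)\<^sup>2 \<le> 3 * (p\<^sup>2 + q\<^sup>2 + r\<^sup>2)" for p q r :: real
        using sum_squares_ge_zero[of "p - q" "q - r"] zero_le_power2[of "p - r"]
        by (simp add: power2_eq_square algebra_simps)
      have "(cmod (iapply A x i))\<^sup>2 \<le> M\<^sup>2 * (cmod (x (i - 1)) + cmod (x i) + cmod (x (Suc i)))\<^sup>2"
        using power_mono[OF le, of 2] by (simp add: power_mult_distrib)
      also have "\<dots> \<le> M\<^sup>2 * (3 * (y (i - 1) + y i + y (Suc i)))"
        unfolding y_def by (intro mult_left_mono sq3) auto
      finally show ?thesis by (simp add: algebra_simps)
    qed
    have sb: "summable (\<lambda>i. 3 * M\<^sup>2 * (y (i - 1) + y i + y (Suc i)))"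
      by (intro summable_mult summable_add syp sy sy1)
    have l2: "summable (\<lambda>i. (cmod (iapply A x i))\<^sup>2)"
      by (rule summable_comparison_test_ev[OF _ sb]) (use sq in auto)
    have s1: "(\<Sum>i. y (Suc i)) \<le> suminf y" using suminf_split_head[OF sy] y0[of 0] by simp
    have "(\<Sum>i. y (i - 1)) = y 0 + suminf y" using suminf_split_head[OF syp] by simp
    moreover have "y 0 \<le> suminf y" using sum_le_suminf[OF sy, of "{0}"] y0 by auto
    ultimately have sp: "(\<Sum>i. y (i - 1)) \<le> 2 * suminf y" by simp
    have "(\<Sum>i. (cmod (iapply A x i))\<^sup>2) \<le> (\<Sum>i. 3 * M\<^sup>2 * (y (i - 1) + y i + y (Suc i)))"
      by (rule suminf_le[OF sq l2 sb])
    also have "\<dots> = 3 * M\<^sup>2 * ((\<Sum>i. y (i - 1)) + suminf y + (\<Sum>i. y (Suc i)))"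
      using syp sy sy1 by (simp add: suminf_mult suminf_add summable_add)
    also have "\<dots> \<le> 3 * M\<^sup>2 * (4 * suminf y)"
      using s1 sp by (intro mult_left_mono) auto
    also have "\<dots> \<le> (4 * M)\<^sup>2 * suminf y"
      using suminf_nonneg[OF sy y0] by (simp add: power_mult_distrib mult_right_mono)
    finally have "l2_norm (iapply A x) \<le> sqrt ((4 * M)\<^sup>2 * suminf y)"
      unfolding l2_norm_def by (rule real_sqrt_le_mono)
    also have "\<dots> = 4 * M * l2_norm x"
      using M0 by (simp add: l2_norm_def y_def[abs_def] real_sqrt_mult)
    finally show ?thesis using summ l2 by (simp add: in_l2_def)
  qed
  then show ?thesis unfolding bounded_l2_def by blast
qed

section \<open>The factorizations for orthogonal polynomials\<close>

context positive_functional
begin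

sublocale blocks: block_structure nu
  by unfold_locales (auto simp: nu_Suc)

lemma two_iff: "blocks.two j \<longleftrightarrow> poly (P (Suc (nu j))) 0 = 0"
  unfolding blocks.two_def nu_Suc by auto

text \<open>The quotients that decide about boundedness, and the entries \<open>u0\<close>, \<open>u1\<close>, \<open>l\<close> of the factors of
  the Jacobi matrix. The coefficient \<open>l 0\<close> does not occur in \<open>L\<close> and is given the value 0.\<close>

definition tau :: "nat \<Rightarrow> real" where
  "tau n = poly (P (Suc n)) 0 / poly (P n) 0"

definition U0 :: "nat \<Rightarrow> real" where
  "U0 j = (if blocks.two j then c (nu j) else - tau (nu j))"

definition U1 :: "nat \<Rightarrow> real" where
  "U1 j = b (Suc (nu j))"

definition Lc :: "nat \<Rightarrow> real" where
  "Lc a = (case a of 0 \<Rightarrow> 0 | Suc d \<Rightarrow> if blocks.two d then c (Suc (nu d)) else c (nu d) / U0 d)"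

lemma tau_eq_0_iff: "tau (nu j) = 0 \<longleftrightarrow> blocks.two j"
  using nu_nonzero[of j] by (simp add: tau_def two_iff)

lemma U0_nonzero: "U0 j \<noteq> 0"
  using c_pos[of "nu j"] tau_eq_0_iff[of j] by (simp add: U0_def)

lemma Lc_nonzero: "Lc (Suc j) \<noteq> 0"
  using c_pos[of "nu j"] c_pos[of "Suc (nu j)"] U0_nonzero[of j] by (simp add: Lc_def)

text \<open>The three-term recurrence at the origin.\<close>

lemma b_nu: "b (nu a) = - tau (nu a) + (case a of 0 \<Rightarrow> 0 | Suc d \<Rightarrow> if blocks.two d then 0 else Lc a)"
proof (cases a)
  case 0
  then show ?thesis using P_at_0[of 0] by (simp add: tau_def)
next
  case (Suc d)
  note ne = nu_nonzero[of a] nu_nonzero[of d]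
  show ?thesis
  proof (cases "blocks.two d")
    case True
    then have n: "nu a = Suc (Suc (nu d))" "poly (P (Suc (nu d))) 0 = 0"
      using Suc blocks.n_Suc_two[of d] by (auto simp: two_iff)
    then have "poly (P (Suc (nu a))) 0 + b (nu a) * poly (P (nu a)) 0 = 0"
      using P_at_0[of "nu a"] by simp
    then show ?thesis using Suc True ne(1) by (simp add: tau_def field_simps)
  next
    case False
    then have n: "nu a = Suc (nu d)" using Suc blocks.n_Suc_two[of d] by simp
    then have e: "poly (P (Suc (nu a))) 0 + b (nu a) * poly (P (nu a)) 0 + c (nu d) * poly (P (nu d)) 0 = 0"
      using P_at_0[of "nu a"] by simp
    have "Lc a = - c (nu d) * poly (P (nu d)) 0 / poly (P (nu a)) 0"
      using Suc False ne n by (simp add: Lc_def U0_def tau_def del: blocks.first_eq_Suc_single)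
    then show ?thesis using Suc False e ne(1) by (simp add: tau_def field_simps)
  qed
qed

lemma LU_equations_P: "blocks.LU_equations b c Lc U0 U1"
  unfolding blocks.LU_equations_def
proof (intro allI conjI)
  fix a
  show "b (nu a) = (if blocks.two a then 0 else U0 a)
      + (case a of 0 \<Rightarrow> 0 | Suc d \<Rightarrow> if blocks.two d then 0 else Lc a)"
    using b_nu[of a] tau_eq_0_iff[of a] by (simp add: U0_def)
  show "if blocks.two a then c (nu a) = U0 a \<and> b (Suc (nu a)) = U1 a \<and> c (Suc (nu a)) = Lc (Suc a)
      else c (nu a) = Lc (Suc a) * U0 a"
    using U0_nonzero[of a] by (auto simp: Lc_def U1_def) (simp_all add: U0_def)
qed

lemma LU_factor_P: "LU_factor_U nu (blocks.tridiagonal b c) = block_U nu U0 U1"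
  by (rule blocks.LU_factor_U_eq[OF LU_equations_P]) (metis c_pos less_irrefl)

text \<open>All entries of \<open>U\<close> other than the numbers \<open>- tau n\<close> are 0, 1 or coefficients of the recurrence,
  which have modulus at most 1.\<close>

lemma bounded_block_U: "bounded_l2 (block_U nu U0 U1) \<longleftrightarrow> (\<exists>C. \<forall>j. \<bar>tau (nu j)\<bar> \<le> C)"
proof
  assume "bounded_l2 (block_U nu U0 U1)"
  then obtain C where C: "\<And>i j. \<bar>block_U nu U0 U1 i j\<bar> \<le> C" using bounded_l2_entry by blast
  have "\<bar>tau (nu j)\<bar> \<le> C" for j
    using C[of "nu j" "nu j"] tau_eq_0_iff[of j] by (cases "blocks.two j") (auto simp: U0_def)
  then show "\<exists>C. \<forall>j. \<bar>tau (nu j)\<bar> \<le> C" by blast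
next
  assume "\<exists>C. \<forall>j. \<bar>tau (nu j)\<bar> \<le> C"
  then obtain C where C: "\<And>j. \<bar>tau (nu j)\<bar> \<le> C" by blast
  have c1: "\<bar>c j\<bar> \<le> 1" for j using c_pos[of j] c_bound[of j] by linarith
  have C0: "C \<ge> 0" using C[of 0] by linarith
  have u0: "\<bar>U0 j\<bar> \<le> 1 + C" for j
    using c1[of "nu j"] C[of j] C0 by (simp add: U0_def)
  have u1: "\<bar>U1 j\<bar> \<le> 1 + C" for j
    using b_bound[of "Suc (nu j)"] C0 by (simp add: U1_def)
  show "bounded_l2 (block_U nu U0 U1)"
  proof (rule bounded_l2_banded[where M = "1 + C"])
    fix i j
    show "\<bar>block_U nu U0 U1 i j\<bar> \<le> 1 + C"
    proof (cases i rule: blocks.index_cases; cases j rule: blocks.index_cases)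
      fix p q assume "i = nu p" "j = nu q"
      then show ?thesis using u0[of p] C0 by (cases "blocks.two p") auto
    next
      fix p q assume "i = nu p" "j = Suc (nu q)" "blocks.two q"
      then show ?thesis using C0 by (cases "blocks.two p") auto
    qed (use u0 u1 C0 in auto)
    have le: "nu p \<le> nu (Suc p)" "nu (Suc p) \<le> Suc (Suc (nu p))"
      "\<not> blocks.two p \<Longrightarrow> nu (Suc p) \<le> Suc (nu p)" for p
      by (simp_all add: blocks.n_Suc_two)
    assume nz: "block_U nu U0 U1 i j \<noteq> 0"
    show "i \<le> Suc j \<and> j \<le> Suc i"
    proof (cases i rule: blocks.index_cases; cases j rule: blocks.index_cases)
      fix p q assume "i = nu p" "j = nu q"
      then show ?thesis using nz le[of p]
        by (cases "blocks.two p") (auto split: if_splits)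
    next
      fix p q assume "i = nu p" "j = Suc (nu q)" "blocks.two q"
      then show ?thesis using nz by (cases "blocks.two p") (auto split: if_splits)
    next
      fix p q assume "i = Suc (nu p)" "blocks.two p" "j = nu q"
      then show ?thesis using nz le[of p] by (auto split: if_splits)
    qed (use nz in \<open>auto split: if_splits\<close>)
  qed
qed

end

section \<open>Expansions at infinity and continued fractions\<close>

lemma sector_infinity_le: "sector_infinity \<le> at_infinity"
  unfolding sector_infinity_def by (rule SUP_least) simp

text \<open>The imaginary axis eventually lies in a sector, so the filter is proper.\<close>

lemma filterlim_ray: "filterlim (\<lambda>r. \<i> * complex_of_real r) sector_infinity at_top"
proof -
  have "filterlim (\<lambda>r. \<i> * complex_of_real r) at_infinity at_top"
    by (intro filterlim_norm_at_top_imp_at_infinity filterlim_at_top_mono[OF filterlim_ident])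
      (auto simp: norm_mult intro!: always_eventually)
  moreover have "filterlim (\<lambda>r. \<i> * complex_of_real r)
      (principal {z. 1 < Arg z \<and> Arg z < pi - 1}) at_top"
    unfolding filterlim_principal
  proof (rule eventually_mono[OF eventually_gt_at_top[of 0]])
    fix r :: real assume "r > 0"
    then have "Arg (\<i> * complex_of_real r) = pi / 2" by (simp add: Arg_ii)
    then show "\<i> * complex_of_real r \<in> {z. 1 < Arg z \<and> Arg z < pi - 1}"
      using pi_gt3 by simp
  qed
  ultimately have "filterlim (\<lambda>r. \<i> * complex_of_real r)
      (inf at_infinity (principal {z. 1 < Arg z \<and> Arg z < pi - 1})) at_top"
    by (simp add: filterlim_inf)
  moreover have "inf at_infinity (principal {z. 1 < Arg z \<and> Arg z < pi - 1}) \<le> sector_infinity"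
    unfolding sector_infinity_def by (rule SUP_upper) simp
  ultimately show ?thesis by (rule filterlim_mono) simp_all
qed

lemma sector_infinity_neq_bot: "sector_infinity \<noteq> bot"
proof
  assume "sector_infinity = bot"
  then have "filterlim (\<lambda>r::real. \<i> * complex_of_real r) bot at_top" using filterlim_ray by simp
  then show False by (simp add: filterlim_def filtermap_bot_iff bot_unique)
qed

lemma tendsto_sector: "(f \<longlongrightarrow> l) at_infinity \<Longrightarrow> (f \<longlongrightarrow> l) sector_infinity"
  by (rule tendsto_mono[OF sector_infinity_le])

lemma eventually_sector: "eventually P at_infinity \<Longrightarrow> eventually P sector_infinity"
  by (rule filter_leD[OF sector_infinity_le])

lemma asymptotic_to_unique:
  assumes "asymptotic_to f s" "asymptotic_to f s'"
  shows "s = s'"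
proof (rule ccontr)
  assume "s \<noteq> s'"
  then obtain j0 where "s j0 \<noteq> s' j0" by auto
  define j where "j = (LEAST j. s j \<noteq> s' j)"
  have j: "s j \<noteq> s' j" "\<And>i. i < j \<Longrightarrow> s i = s' i"
    unfolding j_def using LeastI[of "\<lambda>j. s j \<noteq> s' j", OF \<open>s j0 \<noteq> s' j0\<close>] not_less_Least by blast+
  let ?g = "\<lambda>z::complex. 1 / z ^ (j + 1)"
  have "(\<lambda>z. f z + (\<Sum>i\<le>j. complex_of_real (s i) / z ^ (i + 1))) \<in> o[sector_infinity](?g)"
    and "(\<lambda>z. f z + (\<Sum>i\<le>j. complex_of_real (s' i) / z ^ (i + 1))) \<in> o[sector_infinity](?g)"
    using assms unfolding asymptotic_to_def by blast+
  then have "(\<lambda>z. (f z + (\<Sum>i\<le>j. complex_of_real (s i) / z ^ (i + 1)))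
      - (f z + (\<Sum>i\<le>j. complex_of_real (s' i) / z ^ (i + 1)))) \<in> o[sector_infinity](?g)"
    by (rule sum_in_smallo(2))
  moreover have "(f z + (\<Sum>i\<le>j. complex_of_real (s i) / z ^ (i + 1)))
      - (f z + (\<Sum>i\<le>j. complex_of_real (s' i) / z ^ (i + 1))) = complex_of_real (s j - s' j) * ?g z" for z
  proof -
    have "(\<Sum>i\<le>j. complex_of_real (s i) / z ^ (i + 1)) - (\<Sum>i\<le>j. complex_of_real (s' i) / z ^ (i + 1))
        = (\<Sum>i\<le>j. if i = j then complex_of_real (s j - s' j) * ?g z else 0)"
      unfolding sum_subtractf[symmetric] using j(2)
      by (intro sum.cong) (auto simp: diff_divide_distrib)
    then show ?thesis by simp
  qed
  ultimately have "(\<lambda>z. complex_of_real (s j - s' j) * ?g z) \<in> o[sector_infinity](?g)" by simp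
  then have "?g \<in> o[sector_infinity](?g)" 
    by (rule landau_o.small.cmult_in_iff[THEN iffD1, rotated]) (use j(1) in simp)
  then have "eventually (\<lambda>z. ?g z = 0) sector_infinity" by (simp add: landau_o.small_refl_iff)
  moreover have "eventually (\<lambda>z. z \<noteq> 0) sector_infinity"
    by (intro eventually_sector eventually_not_equal_at_infinity)
  ultimately have "eventually (\<lambda>z. False) sector_infinity" by eventually_elim simp
  then show False using sector_infinity_neq_bot by simp
qed

lemma asym_coeffs_eq: "asymptotic_to f s \<Longrightarrow> asym_coeffs f = s"
  unfolding asym_coeffs_def by (rule the_equality) (auto intro: asymptotic_to_unique)

text \<open>The function is given near infinity by a convergent power series in \<open>1 / z\<close> with real
  coefficients. Such expansions can be divided, and they are asymptotic expansions.\<close>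

definition fps_of :: "real fps \<Rightarrow> complex fps" where
  "fps_of A = Abs_fps (\<lambda>n. complex_of_real (fps_nth A n))"

definition expands :: "(complex \<Rightarrow> complex) \<Rightarrow> real fps \<Rightarrow> bool" where
  "expands f A \<longleftrightarrow> (\<exists>G. G has_fps_expansion fps_of A \<and> (\<forall>\<^sub>F z in at_infinity. f z = G (1 / z)))"

lemma fps_nth_fps_of [simp]: "fps_nth (fps_of A) n = complex_of_real (fps_nth A n)"
  by (simp add: fps_of_def)

lemma fps_of_eq_0_iff [simp]: "fps_of A = 0 \<longleftrightarrow> A = 0"
  by (simp add: fps_eq_iff)

lemma fps_of_mult: "fps_of (A * B) = fps_of A * fps_of B"
  by (simp add: fps_eq_iff fps_mult_nth)

lemma subdegree_fps_of [simp]: "subdegree (fps_of A) = subdegree A"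
  by (simp add: subdegree_def)

lemma fps_of_divide:
  assumes "B \<noteq> 0" "subdegree B \<le> subdegree A"
  shows "fps_of (A / B) = fps_of A / fps_of B"
proof -
  have "fps_of A = fps_of (A / B) * fps_of B"
    using fps_times_divide_eq[OF assms] by (simp add: fps_of_mult[symmetric])
  then show ?thesis using assms(1) by (simp add: fps_divide_times_eq)
qed

lemma filterlim_one_over_at_infinity: "filterlim (\<lambda>z::complex. 1 / z) (at 0) at_infinity"
proof -
  have eq: "(\<lambda>z::complex. 1 / z) = inverse" by (simp add: fun_eq_iff inverse_eq_divide)
  have "((\<lambda>z::complex. 1 / z) \<longlongrightarrow> 0) at_infinity"
    unfolding eq by (rule tendsto_inverse_0)
  moreover have "\<forall>\<^sub>F z::complex in at_infinity. 1 / z \<noteq> 0"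
    using eventually_not_equal_at_infinity[of 0] by eventually_elim simp
  ultimately show ?thesis by (simp add: filterlim_at)
qed

lemma expands_cong:
  assumes "expands f A" "\<forall>\<^sub>F z in at_infinity. g z = f z"
  shows "expands g A"
proof -
  obtain F where F: "F has_fps_expansion fps_of A" "\<forall>\<^sub>F z in at_infinity. f z = F (1 / z)"
    using assms(1) unfolding expands_def by blast
  from F(2) assms(2) have "\<forall>\<^sub>F z in at_infinity. g z = F (1 / z)" by eventually_elim simp
  then show ?thesis unfolding expands_def using F(1) by blast
qed

lemma expands_divide:
  assumes "expands f A" "expands g B" "B \<noteq> 0" "subdegree B \<le> subdegree A"
  shows "expands (\<lambda>z. f z / g z) (A / B)"
proof -
  obtain F G where F: "F has_fps_expansion fps_of A" "\<forall>\<^sub>F z in at_infinity. f z = F (1 / z)"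
    and G: "G has_fps_expansion fps_of B" "\<forall>\<^sub>F z in at_infinity. g z = G (1 / z)"
    using assms(1,2) unfolding expands_def by blast
  have "\<forall>\<^sub>F z in at_infinity. f z / g z = (if 1 / z = 0
      then fps_nth (fps_of A) (subdegree (fps_of B)) / fps_nth (fps_of B) (subdegree (fps_of B))
      else F (1 / z) / G (1 / z))"
    using F(2) G(2) eventually_not_equal_at_infinity[of 0] by eventually_elim auto
  then show ?thesis
    unfolding expands_def fps_of_divide[OF assms(3,4)]
    using has_fps_expansion_divide[OF F(1) G(1)] assms(3,4) by fastforce
qed

lemma expands_cmult:
  assumes "expands f A"
  shows "expands (\<lambda>z. complex_of_real k * f z) (fps_const k * A)"
proof -
  obtain F where F: "F has_fps_expansion fps_of A" "\<forall>\<^sub>F z in at_infinity. f z = F (1 / z)"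
    using assms unfolding expands_def by blast
  have "fps_of (fps_const k * A) = fps_const (complex_of_real k) * fps_of A"
    by (simp add: fps_eq_iff)
  moreover have "(\<lambda>w. complex_of_real k * F w) has_fps_expansion fps_const (complex_of_real k) * fps_of A"
    by (rule has_fps_expansion_cmult_left[OF F(1)])
  ultimately show ?thesis unfolding expands_def
    using F(2) by (auto intro!: exI[of _ "\<lambda>w. complex_of_real k * F w"] elim: eventually_mono)
qed

lemma expands_lead:
  assumes "expands f A" "m \<le> subdegree A"
  shows "((\<lambda>z. z ^ m * f z) \<longlongrightarrow> complex_of_real (fps_nth A m)) at_infinity"
proof -
  obtain F where F: "F has_fps_expansion fps_of A" "\<forall>\<^sub>F z in at_infinity. f z = F (1 / z)"
    using assms unfolding expands_def by blast
  let ?h = "\<lambda>x. if x = 0 then complex_of_real (fps_nth A m) else F x / x ^ m"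
  have "?h has_fps_expansion fps_shift m (fps_of A)"
    using F(1) assms(2) by (intro has_fps_expansion_shift) auto
  then have "(?h \<longlongrightarrow> complex_of_real (fps_nth A m)) (nhds 0)"
    by (drule_tac has_fps_expansion_imp_tendsto_0) simp
  then have "(?h \<longlongrightarrow> complex_of_real (fps_nth A m)) (at 0)"
    by (rule tendsto_mono[OF at_within_le_nhds])
  then have "((\<lambda>z. ?h (1 / z)) \<longlongrightarrow> complex_of_real (fps_nth A m)) at_infinity"
    by (rule filterlim_compose[OF _ filterlim_one_over_at_infinity])
  moreover have "\<forall>\<^sub>F z in at_infinity. ?h (1 / z) = z ^ m * f z"
    using F(2) eventually_not_equal_at_infinity[of 0]
    by eventually_elim (simp add: power_one_over field_simps)
  ultimately show ?thesis by (rule Lim_transform_eventually)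
qed

lemma expands_nonzero:
  assumes "expands f A" "A \<noteq> 0"
  shows "\<forall>\<^sub>F z in at_infinity. f z \<noteq> 0"
proof -
  have "complex_of_real (fps_nth A (subdegree A)) \<noteq> 0" using assms(2) by simp
  with expands_lead[OF assms(1) order_refl] have "\<forall>\<^sub>F z in at_infinity. z ^ subdegree A * f z \<noteq> 0"
    by (rule tendsto_imp_eventually_ne)
  then show ?thesis by eventually_elim auto
qed

lemma expands_tendsto_0:
  assumes "expands f A" "fps_nth A 0 = 0"
  shows "(f \<longlongrightarrow> 0) at_infinity"
  using expands_lead[OF assms(1), of 0] assms(2) by simp

lemma expands_asymptotic:
  assumes "expands f A" "fps_nth A 0 = 0"
  shows "asymptotic_to f (\<lambda>j. - fps_nth A (Suc j))"
  unfolding asymptotic_to_def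
proof
  fix N
  obtain F where F: "F has_fps_expansion fps_of A" "\<forall>\<^sub>F z in at_infinity. f z = F (1 / z)"
    using assms unfolding expands_def by blast
  define T where "T = (\<Sum>k\<le>Suc N. fps_const (fps_nth (fps_of A) k) * fps_X ^ k)"
  have Tn: "fps_nth T m = (if m \<le> Suc N then fps_nth (fps_of A) m else 0)" for m
  proof -
    have "fps_nth T m = (\<Sum>k\<le>Suc N. if k = m then fps_nth (fps_of A) k else 0)"
      unfolding T_def fps_sum_nth by (intro sum.cong) (auto simp: fps_X_power_nth)
    then show ?thesis by (simp only: sum.delta finite_atMost atMost_iff)
  qed
  have "(\<lambda>w. \<Sum>k\<le>Suc N. fps_nth (fps_of A) k * w ^ k) has_fps_expansion T"
    unfolding T_def by (intro fps_expansion_intros)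
  then have D: "(\<lambda>w. F w - (\<Sum>k\<le>Suc N. fps_nth (fps_of A) k * w ^ k)) has_fps_expansion (fps_of A - T)"
    by (intro has_fps_expansion_diff F(1))
  let ?d = "\<lambda>w. F w - (\<Sum>k\<le>Suc N. fps_nth (fps_of A) k * w ^ k)"
  have "?d \<in> o[at 0](\<lambda>w. w ^ Suc N)"
  proof (cases "fps_of A - T = 0")
    case True
    then have "\<forall>\<^sub>F w in nhds 0. ?d w = 0" using D by (simp add: has_fps_expansion_0_iff)
    then have "\<forall>\<^sub>F w in at 0. ?d w = 0" by (simp add: eventually_at_filter eventually_mono)
    then show ?thesis by (rule landau_o.small.in_cong[THEN iffD2]) simp
  next
    case False
    then have sd: "Suc (Suc N) \<le> subdegree (fps_of A - T)"
      by (intro subdegree_geI) (auto simp: Tn)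
    let ?h = "\<lambda>w. if w = 0 then fps_nth (fps_of A - T) (Suc N) else ?d w / w ^ Suc N"
    have "?h has_fps_expansion fps_shift (Suc N) (fps_of A - T)"
      using D sd by (intro has_fps_expansion_shift) auto
    then have "(?h \<longlongrightarrow> fps_nth (fps_shift (Suc N) (fps_of A - T)) 0) (nhds 0)"
      by (rule has_fps_expansion_imp_tendsto_0)
    then have "(?h \<longlongrightarrow> 0) (at 0)"
      by (intro tendsto_mono[OF at_within_le_nhds]) (simp add: Tn)
    moreover have "\<forall>\<^sub>F w in at 0. ?h w = ?d w / w ^ Suc N"
      by (auto simp: eventually_at_filter)
    ultimately have "((\<lambda>w. ?d w / w ^ Suc N) \<longlongrightarrow> 0) (at 0)"
      by (rule Lim_transform_eventually)
    then show ?thesis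
      by (rule smalloI_tendsto) (auto simp: eventually_at_filter)
  qed
  then have "(\<lambda>z. ?d (1 / z)) \<in> o[at_infinity](\<lambda>z. (1 / z) ^ Suc N)"
    by (rule landau_o.small.compose[OF _ filterlim_one_over_at_infinity])
  moreover have "\<forall>\<^sub>F z in at_infinity. ?d (1 / z)
      = f z + (\<Sum>j\<le>N. complex_of_real (- fps_nth A (Suc j)) / z ^ (j + 1))"
    using F(2)
  proof eventually_elim
    case (elim z)
    show ?case unfolding elim sum.atMost_Suc_shift
      by (simp add: assms(2) power_one_over sum_negf divide_inverse power_inverse)
  qed
  ultimately have "(\<lambda>z. f z + (\<Sum>j\<le>N. complex_of_real (- fps_nth A (Suc j)) / z ^ (j + 1)))
      \<in> o[at_infinity](\<lambda>z. (1 / z) ^ Suc N)"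
    using landau_o.small.in_cong by force
  then have "(\<lambda>z. f z + (\<Sum>j\<le>N. complex_of_real (- fps_nth A (Suc j)) / z ^ (j + 1)))
      \<in> o[sector_infinity](\<lambda>z. (1 / z) ^ Suc N)"
    by (rule landau_o.small.filter_mono[OF sector_infinity_le])
  then show "(\<lambda>z. f z + (\<Sum>j\<le>N. complex_of_real (- fps_nth A (Suc j)) / z ^ (j + 1)))
      \<in> o[sector_infinity](\<lambda>z. 1 / z ^ (N + 1))"
    by (simp add: power_one_over)
qed

lemma expands_asym_coeffs:
  "expands f A \<Longrightarrow> fps_nth A 0 = 0 \<Longrightarrow> asym_coeffs f = (\<lambda>j. - fps_nth A (Suc j))"
  by (rule asym_coeffs_eq[OF expands_asymptotic])

lemma expands_first_coeff:
  assumes "expands f A" "subdegree A > 0"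
  shows "first_coeff f = - fps_nth A (subdegree A)"
proof -
  obtain m where m: "subdegree A = Suc m" using assms(2) by (cases "subdegree A") auto
  have A0: "fps_nth A 0 = 0" using assms(2) by (rule nth_less_subdegree_zero)
  have "A \<noteq> 0" using assms(2) by auto
  have "(LEAST j. asym_coeffs f j \<noteq> 0) = m"
    unfolding expands_asym_coeffs[OF assms(1) A0]
  proof (rule Least_equality)
    show "- fps_nth A (Suc m) \<noteq> 0" using \<open>A \<noteq> 0\<close> nth_subdegree_nonzero[of A] m by simp
    show "m \<le> j" if "- fps_nth A (Suc j) \<noteq> 0" for j
      using that subdegree_leI[of A "Suc j"] m by simp
  qed
  then show ?thesis unfolding first_coeff_def expands_asym_coeffs[OF assms(1) A0] m by simp
qed

lemma cpoly_tendsto_0_imp_0: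
  assumes "(cpoly q \<longlongrightarrow> 0) sector_infinity"
  shows "q = 0"
proof -
  let ?q = "map_poly complex_of_real q"
  have ev: "cpoly q = poly ?q" by (simp add: cpoly_def fun_eq_iff)
  show ?thesis
  proof (cases "degree ?q = 0")
    case True
    then obtain a where a: "?q = [:a:]" by (auto elim: degree_eq_zeroE)
    then have "cpoly q = (\<lambda>z. a)" using ev by (simp add: fun_eq_iff)
    then have "((\<lambda>z. a) \<longlongrightarrow> 0) sector_infinity" using assms by simp
    then have "a = 0" using sector_infinity_neq_bot by (simp add: tendsto_const_iff)
    then have "?q = 0" using a by simp
    then show ?thesis by (simp add: map_poly_eq_0_iff)
  next
    case False
    then have "filterlim (poly ?q) at_infinity at_infinity" by (intro filterlim_poly_at_infinity) auto
    then have "filterlim (poly ?q) at_infinity sector_infinity"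
      by (rule filterlim_mono) (simp_all add: sector_infinity_le)
    then show ?thesis
      using not_tendsto_and_filterlim_at_infinity[OF sector_infinity_neq_bot] assms ev by auto
  qed
qed

lemma cf_poly_eq:
  assumes "lead_coeff p = 1" "first_coeff f \<noteq> 0"
    and lim: "((\<lambda>z. - 1 / f z - complex_of_real (first_coeff f) * cpoly p z) \<longlongrightarrow> 0) at_infinity"
  shows "cf_poly f = p"
  unfolding cf_poly_def
proof (rule the_equality)
  show "lead_coeff p = 1 \<and>
     ((\<lambda>z. - 1 / f z - complex_of_real (first_coeff f) * cpoly p z) \<longlongrightarrow> 0) sector_infinity"
    using assms(1) tendsto_sector[OF lim] by blast
next
  fix q assume q: "lead_coeff q = 1 \<and>
     ((\<lambda>z. - 1 / f z - complex_of_real (first_coeff f) * cpoly q z) \<longlongrightarrow> 0) sector_infinity"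
  have "((\<lambda>z. ((- 1 / f z - complex_of_real (first_coeff f) * cpoly p z)
      - (- 1 / f z - complex_of_real (first_coeff f) * cpoly q z)) / complex_of_real (first_coeff f))
      \<longlongrightarrow> (0 - 0) / complex_of_real (first_coeff f)) sector_infinity"
    using assms(2) q tendsto_sector[OF lim] by (intro tendsto_intros) auto
  moreover have "((- 1 / f z - complex_of_real (first_coeff f) * cpoly p z)
      - (- 1 / f z - complex_of_real (first_coeff f) * cpoly q z)) / complex_of_real (first_coeff f)
      = cpoly (q - p) z" for z
  proof -
    have "map_poly complex_of_real (q - p) = map_poly complex_of_real q - map_poly complex_of_real p"
      by (simp add: poly_eq_iff coeff_map_poly)
    then have c: "cpoly (q - p) z = cpoly q z - cpoly p z" by (simp add: cpoly_def)
    show ?thesis using assms(2) unfolding c by (simp add: field_simps)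
  qed
  ultimately have "(cpoly (q - p) \<longlongrightarrow> 0) sector_infinity" by simp
  then show "q = p" using cpoly_tendsto_0_imp_0[of "q - p"] by simp
qed

lemma cf_b_eq:
  assumes "expands (cf_remainder f) R" "subdegree R > 0"
  shows "cf_b f = sqrt \<bar>fps_nth R (subdegree R)\<bar>"
proof -
  let ?r = "fps_nth R (subdegree R)"
  have r: "?r \<noteq> 0" using assms(2) by force
  have fc: "first_coeff (\<lambda>z. cf_remainder f z / complex_of_real (x\<^sup>2)) = - ?r / x\<^sup>2" if "x > 0" for x
  proof -
    have e: "expands (\<lambda>z. complex_of_real (1 / x\<^sup>2) * cf_remainder f z) (fps_const (1 / x\<^sup>2) * R)"
      by (rule expands_cmult[OF assms(1)])
    have "fps_const (1 / x\<^sup>2) \<noteq> 0" "R \<noteq> 0" using that assms(2) by auto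
    then have "subdegree (fps_const (1 / x\<^sup>2) * R) = subdegree R" by (simp add: subdegree_mult)
    then show ?thesis using expands_first_coeff[OF e] assms(2) by simp
  qed
  have norm: "normalized (\<lambda>z. cf_remainder f z / complex_of_real (x\<^sup>2)) \<longleftrightarrow> x\<^sup>2 = \<bar>?r\<bar>" if "x > 0" for x
    unfolding normalized_def fc[OF that] using that by (auto simp: abs_divide field_simps)
  show ?thesis unfolding cf_b_def
  proof (rule the_equality)
    show "0 < sqrt \<bar>?r\<bar> \<and>
        normalized (\<lambda>z. cf_remainder f z / complex_of_real ((sqrt \<bar>?r\<bar>)\<^sup>2))"
      using norm[of "sqrt \<bar>?r\<bar>"] r by simp
    fix x assume "0 < x \<and> normalized (\<lambda>z. cf_remainder f z / complex_of_real (x\<^sup>2))"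
    then have "x > 0" "x\<^sup>2 = \<bar>?r\<bar>" using norm by blast+
    then show "x = sqrt \<bar>?r\<bar>" by (simp add: real_sqrt_unique)
  qed
qed

text \<open>A continued fraction read off from a three-term recurrence. If \<open>\<Psi> j\<close> expands at infinity
  with leading term \<open>- H j / z ^ n j\<close>, then the functions \<open>cf_seq (\<Psi> 1) j\<close> are constant multiples of
  \<open>\<Psi> (Suc j) / \<Psi> j\<close>, and the partial quotients are the coefficients of the recurrence.\<close>

locale three_term_expansion =
  fixes \<Psi> :: "nat \<Rightarrow> complex \<Rightarrow> complex" and A :: "nat \<Rightarrow> real fps" and n :: "nat \<Rightarrow> nat"
    and H :: "nat \<Rightarrow> real" and p :: "nat \<Rightarrow> real poly"
  assumes expands: "expands (\<Psi> j) (A j)"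
    and A_subdegree: "subdegree (A j) = n j" and A_lead: "fps_nth (A j) (n j) = - H j"
    and H_nonzero: "H j \<noteq> 0" and n_less: "n j < n (Suc j)" and p_monic: "lead_coeff (p j) = 1"
    and recurrence: "\<forall>\<^sub>F z in at_infinity. \<Psi> (Suc (Suc j)) z
      = cpoly (p j) z * \<Psi> (Suc j) z - complex_of_real (H (Suc j) / H j) * \<Psi> j z"
    and \<Psi>_0: "\<Psi> 0 = (\<lambda>z. - 1)" and H_0: "H 0 = 1"
begin

text \<open>The coefficients of the recurrence, and the factors relating \<open>cf_seq (\<Psi> 1) j\<close> to the
  quotients.\<close>

definition \<gamma> :: "nat \<Rightarrow> real" where "\<gamma> j = H (Suc j) / H j"

definition \<kappa> :: "nat \<Rightarrow> real" where "\<kappa> j = - sgn (H j) / \<bar>\<gamma> j\<bar>"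

lemma A_nonzero: "A j \<noteq> 0"
  using A_lead[of j] H_nonzero[of j] by auto

lemma \<gamma>_nonzero: "\<gamma> j \<noteq> 0"
  using H_nonzero[of j] H_nonzero[of "Suc j"] by (simp add: \<gamma>_def)

lemma \<kappa>_nonzero: "\<kappa> j \<noteq> 0"
  using H_nonzero[of j] \<gamma>_nonzero[of j] by (simp add: \<kappa>_def sgn_zero_iff)

lemma \<kappa>_\<gamma>: "\<kappa> j * \<gamma> j = - sgn (H (Suc j))"
  using H_nonzero[of j] H_nonzero[of "Suc j"]
  by (simp add: \<kappa>_def \<gamma>_def sgn_if abs_if divide_less_0_iff field_simps)

lemma quotient_expands:
  "expands (\<lambda>z. \<Psi> (Suc j) z / \<Psi> j z) (A (Suc j) / A j)"
  by (rule expands_divide[OF expands expands A_nonzero]) (use n_less[of j] in \<open>simp add: A_subdegree\<close>)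

lemma quotient_subdegree: "subdegree (A (Suc j) / A j) = n (Suc j) - n j"
  using fps_divide_subdegree[OF A_nonzero A_nonzero, of j "Suc j"] n_less[of j]
  by (simp add: A_subdegree)

lemma quotient_lead: "fps_nth (A (Suc j) / A j) (n (Suc j) - n j) = \<gamma> j"
proof -
  have "fps_nth (A (Suc j) / A j * A j) (n (Suc j) - n j + n j)
      = fps_nth (A (Suc j) / A j) (n (Suc j) - n j) * fps_nth (A j) (n j)"
    using nth_subdegree_mult[of "A (Suc j) / A j" "A j"]
    by (simp only: quotient_subdegree A_subdegree)
  moreover have "A (Suc j) / A j * A j = A (Suc j)"
    using n_less[of j] by (intro fps_times_divide_eq A_nonzero) (simp add: A_subdegree)
  ultimately have "- H (Suc j) = fps_nth (A (Suc j) / A j) (n (Suc j) - n j) * (- H j)"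
    using n_less[of j] by (simp add: A_lead)
  then show ?thesis using H_nonzero[of j] by (simp add: \<gamma>_def field_simps)
qed

lemma scaled_quotient:
  assumes "k \<noteq> 0" "\<forall>\<^sub>F z in at_infinity. f z = complex_of_real k * (\<Psi> (Suc j) z / \<Psi> j z)"
  shows "expands f (fps_const k * (A (Suc j) / A j))"
    and "subdegree (fps_const k * (A (Suc j) / A j)) = n (Suc j) - n j"
    and "first_coeff f = - k * \<gamma> j"
proof -
  show e: "expands f (fps_const k * (A (Suc j) / A j))"
    using expands_cong[OF expands_cmult[OF quotient_expands] assms(2)] .
  have "A (Suc j) / A j \<noteq> 0" using quotient_lead[of j] \<gamma>_nonzero[of j] by auto
  then show d: "subdegree (fps_const k * (A (Suc j) / A j)) = n (Suc j) - n j"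
    using assms(1) by (simp add: subdegree_mult quotient_subdegree)
  show "first_coeff f = - k * \<gamma> j"
    using expands_first_coeff[OF e] n_less[of j] unfolding d by (simp add: quotient_lead)
qed

text \<open>One step of the expansion: dividing the recurrence by \<open>\<Psi> (Suc j)\<close> expresses \<open>- 1 / f\<close> by the
  polynomial \<open>p j\<close> and the next quotient, which vanishes at infinity.\<close>

lemma cf_step:
  assumes f: "\<forall>\<^sub>F z in at_infinity. f z = complex_of_real (\<kappa> j) * (\<Psi> (Suc j) z / \<Psi> j z)"
  shows "first_coeff f = sgn (H (Suc j))" and "cf_poly f = p j" and "(cf_b f)\<^sup>2 = \<bar>\<gamma> (Suc j)\<bar>"
    and "\<forall>\<^sub>F z in at_infinity.
      cf_next f z = complex_of_real (\<kappa> (Suc j)) * (\<Psi> (Suc (Suc j)) z / \<Psi> (Suc j) z)"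
proof -
  show fc: "first_coeff f = sgn (H (Suc j))"
    using scaled_quotient(3)[OF \<kappa>_nonzero f] \<kappa>_\<gamma>[of j] by simp
  let ?e = "sgn (H (Suc j))"
  have e: "?e \<noteq> 0" "?e * ?e = 1" using H_nonzero[of "Suc j"] by (auto simp: sgn_if)
  have inv: "\<forall>\<^sub>F z in at_infinity. - 1 / f z
      = complex_of_real ?e * (cpoly (p j) z - \<Psi> (Suc (Suc j)) z / \<Psi> (Suc j) z)"
    using f recurrence[of j] expands_nonzero[OF expands A_nonzero, of j]
      expands_nonzero[OF expands A_nonzero, of "Suc j"]
  proof eventually_elim
    case (elim z)
    have "\<gamma> j = - ?e / \<kappa> j" using \<kappa>_\<gamma>[of j] \<kappa>_nonzero[of j] by (simp add: field_simps)
    then have "complex_of_real (\<gamma> j) = - complex_of_real ?e / complex_of_real (\<kappa> j)" by simp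
    moreover have "complex_of_real (\<gamma> j) * (\<Psi> j z / \<Psi> (Suc j) z)
        = cpoly (p j) z - \<Psi> (Suc (Suc j)) z / \<Psi> (Suc j) z"
      using elim by (simp add: \<gamma>_def[symmetric] field_simps)
    ultimately have "complex_of_real ?e * (cpoly (p j) z - \<Psi> (Suc (Suc j)) z / \<Psi> (Suc j) z)
        = - complex_of_real (?e * ?e) / complex_of_real (\<kappa> j) * (\<Psi> j z / \<Psi> (Suc j) z)"
      by (metis (no_types, opaque_lifting) mult.assoc mult_minus_right of_real_mult times_divide_eq_right)
    also have "\<dots> = - 1 / f z" using elim \<kappa>_nonzero[of j] unfolding e(2) by simp
    finally show ?case by simp
  qed
  have G0: "((\<lambda>z. \<Psi> (Suc (Suc j)) z / \<Psi> (Suc j) z) \<longlongrightarrow> 0) at_infinity"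
    using n_less[of "Suc j"]
    by (intro expands_tendsto_0[OF quotient_expands] nth_less_subdegree_zero) (simp add: quotient_subdegree)
  have "\<forall>\<^sub>F z in at_infinity. complex_of_real (- ?e) * (\<Psi> (Suc (Suc j)) z / \<Psi> (Suc j) z)
      = - 1 / f z - complex_of_real (first_coeff f) * cpoly (p j) z"
    using inv by eventually_elim (simp add: fc algebra_simps)
  moreover have "((\<lambda>z. complex_of_real (- ?e) * (\<Psi> (Suc (Suc j)) z / \<Psi> (Suc j) z)) \<longlongrightarrow> 0) at_infinity"
    using tendsto_mult_right_zero[OF G0] .
  ultimately have "((\<lambda>z. - 1 / f z - complex_of_real (first_coeff f) * cpoly (p j) z) \<longlongrightarrow> 0) at_infinity"
    by (rule Lim_transform_eventually[rotated])
  then show p: "cf_poly f = p j"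
    using e(1) fc by (intro cf_poly_eq p_monic) simp_all
  have rem: "\<forall>\<^sub>F z in at_infinity.
      cf_remainder f z = complex_of_real (- ?e) * (\<Psi> (Suc (Suc j)) z / \<Psi> (Suc j) z)"
    using inv by eventually_elim (simp add: cf_remainder_def p fc algebra_simps)
  have me: "- ?e \<noteq> 0" using e(1) by simp
  note sq = scaled_quotient(1,2)[OF me rem]
  have "cf_b f = sqrt \<bar>fps_nth (fps_const (- ?e) * (A (Suc (Suc j)) / A (Suc j))) (n (Suc (Suc j)) - n (Suc j))\<bar>"
    using cf_b_eq[OF sq(1)] n_less[of "Suc j"] unfolding sq(2) by simp
  also have "\<dots> = sqrt \<bar>\<gamma> (Suc j)\<bar>" 
    using H_nonzero[of "Suc j"] by (simp add: quotient_lead abs_mult sgn_if)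
  finally have cb: "cf_b f = sqrt \<bar>\<gamma> (Suc j)\<bar>" .
  then show cb2: "(cf_b f)\<^sup>2 = \<bar>\<gamma> (Suc j)\<bar>" by simp
  from rem show "\<forall>\<^sub>F z in at_infinity.
      cf_next f z = complex_of_real (\<kappa> (Suc j)) * (\<Psi> (Suc (Suc j)) z / \<Psi> (Suc j) z)"
    by eventually_elim (simp add: cf_next_def cb2 \<kappa>_def del: of_real_power)
qed

lemma cf_seq_eq:
  "\<forall>\<^sub>F z in at_infinity. cf_seq (\<Psi> 1) j z = complex_of_real (\<kappa> j) * (\<Psi> (Suc j) z / \<Psi> j z)"
proof (induction j)
  case 0
  have "first_coeff (\<Psi> 1) = H 1"
  proof -
    have "\<forall>\<^sub>F z in at_infinity. \<Psi> 1 z = complex_of_real (- 1) * (\<Psi> (Suc 0) z / \<Psi> 0 z)"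
      by (simp add: \<Psi>_0)
    from scaled_quotient(3)[OF _ this] show ?thesis by (simp add: \<gamma>_def H_0)
  qed
  then show ?case by (simp add: \<kappa>_def \<gamma>_def \<Psi>_0 H_0)
next
  case (Suc j)
  then show ?case using cf_step(4)[OF Suc] by simp
qed

lemma cf_seq_poly: "cf_poly (cf_seq (\<Psi> 1) j) = p j"
  by (rule cf_step(2)[OF cf_seq_eq])

lemma gen_jacobi_c_eq: "gen_jacobi_c (\<Psi> 1) j = \<gamma> (Suc j)"
  unfolding gen_jacobi_c_def cf_step(1)[OF cf_seq_eq] cf_step(3)[OF cf_seq_eq]
  using H_nonzero[of "Suc j"] H_nonzero[of "Suc (Suc j)"]
  by (simp add: \<gamma>_def sgn_if abs_if divide_less_0_iff)

end

section \<open>The functional of a measure and its Cauchy transforms\<close>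

text \<open>A finite measure with infinite support that is carried by two intervals on either side of
  the origin.\<close>

locale two_interval_measure =
  fixes \<sigma> :: "real measure" and \<alpha> \<beta> :: real
  assumes bounds: "- 1 \<le> \<alpha>" "\<alpha> \<le> 0" "0 \<le> \<beta>" "\<beta> \<le> 1"
    and measure: "borel_measure \<sigma>" and null: "emeasure \<sigma> (- ({- 1..\<alpha>} \<union> {\<beta>..1})) = 0"
    and infinite_support: "infinite (msupport \<sigma>)"
begin

text \<open>The carrier, and integration of polynomials as a functional.\<close>

definition E :: "real set" where "E = {- 1..\<alpha>} \<union> {\<beta>..1}"

definition I :: "real poly \<Rightarrow> real" where "I p = (\<integral>t. poly p t \<partial>\<sigma>)"

text \<open>The Cauchy transform of the measure with density \<open>g\<close>.\<close>

definition C :: "real poly \<Rightarrow> complex \<Rightarrow> complex" where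
  "C g z = (\<integral>t. complex_of_real (poly g t) / (complex_of_real t - z) \<partial>\<sigma>)"

sublocale finite_measure \<sigma>
  using measure by (simp add: borel_measure_def)

lemma sets_eq [measurable_cong]: "sets \<sigma> = sets borel"
  using measure by (simp add: borel_measure_def)

lemma AE_E: "AE t in \<sigma>. t \<in> E"
  using null by (intro AE_I[of _ _ "- E"]) (auto simp: E_def sets_eq)

lemma E_bounds: "E \<subseteq> {-1..1}"
  using bounds by (auto simp: E_def)

lemma integrable_bounded_E:
  fixes f :: "real \<Rightarrow> 'b :: {banach, second_countable_topology}"
  assumes "f \<in> borel_measurable borel" "\<And>t. t \<in> E \<Longrightarrow> norm (f t) \<le> B"
  shows "integrable \<sigma> f"
proof (rule integrable_const_bound)
  show "AE t in \<sigma>. norm (f t) \<le> B" using AE_E by eventually_elim (rule assms(2))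
  show "f \<in> borel_measurable \<sigma>" using assms(1) by measurable
qed

lemma poly_measurable [measurable]: "(\<lambda>t. poly (p :: real poly) t) \<in> borel_measurable borel"
  by (intro borel_measurable_continuous_onI continuous_intros)

lemma poly_bounded: "\<exists>B. \<forall>t\<in>E. \<bar>poly p t\<bar> \<le> B"
proof -
  have "compact (poly p ` {- 1..1})" by (intro compact_continuous_image continuous_intros) simp
  then obtain B where "\<And>t. t \<in> {- 1..1} \<Longrightarrow> \<bar>poly p t\<bar> \<le> B"
    using compact_imp_bounded bounded_iff by (metis image_eqI real_norm_def)
  then show ?thesis using E_bounds by blast
qed

lemma integrable_poly: "integrable \<sigma> (poly p)"
proof -
  obtain B where "\<And>t. t \<in> E \<Longrightarrow> \<bar>poly p t\<bar> \<le> B" using poly_bounded by blast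
  then show ?thesis by (intro integrable_bounded_E[of _ B]) auto
qed

text \<open>If the integral of a nonnegative polynomial vanishes, the polynomial is zero on the support,
  which is infinite.\<close>

lemma I_strictly_positive:
  assumes "p \<noteq> 0" and nn: "\<And>t. t \<in> E \<Longrightarrow> poly p t \<ge> 0"
  shows "I p > 0"
proof -
  have ae: "AE t in \<sigma>. 0 \<le> poly p t" using AE_E by eventually_elim (rule nn)
  have "I p \<noteq> 0"
  proof
    assume "I p = 0"
    then have z: "AE t in \<sigma>. poly p t = 0"
      using integral_nonneg_eq_0_iff_AE[OF integrable_poly ae] by (simp add: I_def)
    have op: "open {t. poly p t \<noteq> 0}"
      by (intro open_Collect_neq continuous_intros)
    have "emeasure \<sigma> {t \<in> space \<sigma>. \<not> poly p t = 0} = 0"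
      using z by (subst (asm) AE_iff_measurable[OF _ refl]) (auto simp: sets_eq)
    moreover have "space \<sigma> = UNIV" using sets_eq_imp_space_eq[OF sets_eq] by simp
    ultimately have "emeasure \<sigma> {t. poly p t \<noteq> 0} = 0" by simp
    then have "msupport \<sigma> \<subseteq> {t. poly p t = 0}"
      using op unfolding msupport_def by force
    then show False using poly_roots_finite[OF assms(1)] infinite_support finite_subset by blast
  qed
  moreover have "I p \<ge> 0" unfolding I_def by (rule integral_nonneg_AE[OF ae])
  ultimately show ?thesis by simp
qed

sublocale positive_functional I E
proof
  show "I (p + q) = I p + I q" for p q
    using integrable_poly[of p] integrable_poly[of q] by (simp add: I_def)
  show "I (Polynomial.smult c p) = c * I p" for c p
    by (simp add: I_def)
  show "p \<noteq> 0 \<Longrightarrow> (\<And>t. t \<in> E \<Longrightarrow> poly p t \<ge> 0) \<Longrightarrow> I p > 0" for p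
    by (rule I_strictly_positive)
  show "E \<subseteq> {- 1..1}" by (rule E_bounds)
qed

lemma kernel_measurable [measurable]:
  "(\<lambda>t. complex_of_real (poly g t) / (complex_of_real t - z)) \<in> borel_measurable borel"
  by measurable

lemma dist_E: "t \<in> E \<Longrightarrow> cmod z - 1 \<le> cmod (complex_of_real t - z)"
proof -
  assume "t \<in> E"
  then have "cmod (complex_of_real t) \<le> 1" using E_bounds by (auto simp: abs_le_iff)
  then show ?thesis
    using norm_triangle_ineq2[of z "complex_of_real t"] norm_minus_commute[of z "complex_of_real t"]
    by linarith
qed

lemma kernel_bound:
  assumes "cmod z > 1" "t \<in> E" "\<bar>poly g t\<bar> \<le> B"
  shows "cmod (complex_of_real (poly g t) / (complex_of_real t - z)) \<le> B / (cmod z - 1)"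
  using assms dist_E[OF assms(2), of z] by (auto simp: norm_divide intro!: frac_le)

lemma integrable_kernel:
  assumes "cmod z > 1"
  shows "integrable \<sigma> (\<lambda>t. complex_of_real (poly g t) / (complex_of_real t - z))"
proof -
  obtain B where "\<And>t. t \<in> E \<Longrightarrow> \<bar>poly g t\<bar> \<le> B" using poly_bounded by blast
  then show ?thesis using kernel_bound[OF assms]
    by (intro integrable_bounded_E[of _ "B / (cmod z - 1)"]) auto
qed

lemma C_add: "cmod z > 1 \<Longrightarrow> C (p + q) z = C p z + C q z"
  using integrable_kernel[of z p] integrable_kernel[of z q] by (simp add: C_def add_divide_distrib)

lemma C_smult: "C (Polynomial.smult k p) z = complex_of_real k * C p z"
  by (simp add: C_def flip: times_divide_eq_right)

lemma C_mult_X: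
  assumes "cmod z > 1"
  shows "C ([:0, 1:] * g) z = z * C g z + complex_of_real (I g)"
proof -
  have "C ([:0, 1:] * g) z = (\<integral>t. z * (complex_of_real (poly g t) / (complex_of_real t - z))
      + complex_of_real (poly g t) \<partial>\<sigma>)"
    unfolding C_def
  proof (rule integral_cong_AE)
    show "AE t in \<sigma>. complex_of_real (poly ([:0, 1:] * g) t) / (complex_of_real t - z)
        = z * (complex_of_real (poly g t) / (complex_of_real t - z)) + complex_of_real (poly g t)"
      using AE_E
    proof eventually_elim
      case (elim t)
      then have "complex_of_real t - z \<noteq> 0" using dist_E[of t z] assms by auto
      then show ?case by (simp add: field_simps)
    qed
  qed measurable
  also have "\<dots> = z * C g z + complex_of_real (I g)"
  proof -
    have "(\<integral>t. z * (complex_of_real (poly g t) / (complex_of_real t - z)) + complex_of_real (poly g t) \<partial>\<sigma>)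
        = (\<integral>t. z * (complex_of_real (poly g t) / (complex_of_real t - z)) \<partial>\<sigma>)
          + (\<integral>t. complex_of_real (poly g t) \<partial>\<sigma>)"
      by (intro Bochner_Integration.integral_add integrable_mult_right integrable_kernel
          integrable_of_real integrable_poly assms)
    also have "(\<integral>t. z * (complex_of_real (poly g t) / (complex_of_real t - z)) \<partial>\<sigma>) = z * C g z"
      unfolding C_def by (rule integral_mult_right_zero)
    also have "(\<integral>t. complex_of_real (poly g t) \<partial>\<sigma>) = complex_of_real (I g)"
      unfolding I_def by (rule integral_complex_of_real)
    finally show ?thesis .
  qed
  finally show ?thesis .
qed

lemma C_bound:
  assumes "cmod z > 1" "\<And>t. t \<in> E \<Longrightarrow> \<bar>poly g t\<bar> \<le> B"
  shows "cmod (C g z) \<le> I 1 * B / (cmod z - 1)"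
proof -
  have "cmod (C g z) \<le> (\<integral>t. cmod (complex_of_real (poly g t) / (complex_of_real t - z)) \<partial>\<sigma>)"
    unfolding C_def by (rule integral_norm_bound)
  also have "\<dots> \<le> (\<integral>t. B / (cmod z - 1) \<partial>\<sigma>)"
  proof (rule integral_mono_AE)
    show "integrable \<sigma> (\<lambda>t. cmod (complex_of_real (poly g t) / (complex_of_real t - z)))"
      by (rule integrable_norm[OF integrable_kernel[OF assms(1)]])
    show "AE t in \<sigma>. cmod (complex_of_real (poly g t) / (complex_of_real t - z)) \<le> B / (cmod z - 1)"
      using AE_E by eventually_elim (use kernel_bound[OF assms(1)] assms(2) in auto)
  qed simp
  also have "\<dots> = I 1 * B / (cmod z - 1)" by (simp add: I_def)
  finally show ?thesis .
qed

lemma C_partial_sum: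
  assumes "cmod z > 1"
  shows "C g z = - (\<Sum>m<N. complex_of_real (I ([:0, 1:] ^ m * g)) / z ^ Suc m) + C ([:0, 1:] ^ N * g) z / z ^ N"
proof (induction N)
  case (Suc N)
  have z: "z \<noteq> 0" using assms by auto
  have "C ([:0, 1:] ^ Suc N * g) z = z * C ([:0, 1:] ^ N * g) z + complex_of_real (I ([:0, 1:] ^ N * g))"
    using C_mult_X[OF assms, of "[:0, 1:] ^ N * g"] by (simp only: power_Suc mult.assoc)
  then have "C ([:0, 1:] ^ N * g) z / z ^ N
      = C ([:0, 1:] ^ Suc N * g) z / z ^ Suc N - complex_of_real (I ([:0, 1:] ^ N * g)) / z ^ Suc N"
    using z by (simp add: field_simps)
  then show ?case using Suc.IH by (simp only: sum.lessThan_Suc) simp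
qed simp

text \<open>The expansion of the transform \<open>C g\<close> in powers of \<open>1 / z\<close>.\<close>

definition moment_fps :: "real poly \<Rightarrow> real fps" where
  "moment_fps g = Abs_fps (\<lambda>n. if n = 0 then 0 else - I ([:0, 1:] ^ (n - 1) * g))"

lemma C_sums:
  assumes "cmod w < 1" "w \<noteq> 0"
  shows "(\<lambda>n. fps_nth (fps_of (moment_fps g)) n * w ^ n) sums C g (1 / w)"
proof -
  have w1: "cmod (1 / w) > 1" using assms by (simp add: norm_divide)
  obtain B where B: "\<And>t. t \<in> E \<Longrightarrow> \<bar>poly g t\<bar> \<le> B" using poly_bounded by blast
  have B': "\<bar>poly ([:0, 1:] ^ N * g) t\<bar> \<le> B" if "t \<in> E" for t N
  proof -
    have "\<bar>t\<bar> \<le> 1" using that E_bounds by (auto simp: abs_le_iff)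
    then have "\<bar>t\<bar> ^ N * \<bar>poly g t\<bar> \<le> 1 * \<bar>poly g t\<bar>" by (intro mult_right_mono power_le_one) auto
    then show ?thesis using B[OF that] by (simp add: abs_mult power_abs)
  qed
  let ?K = "I 1 * B / (cmod (1 / w) - 1)"
  have sum: "(\<Sum>n<Suc N. fps_nth (fps_of (moment_fps g)) n * w ^ n)
      = C g (1 / w) - C ([:0, 1:] ^ N * g) (1 / w) * w ^ N" for N
    using C_partial_sum[OF w1, of g N] unfolding sum.lessThan_Suc_shift
    by (simp add: moment_fps_def power_one_over sum_negf)
  have "(\<lambda>N. C ([:0, 1:] ^ N * g) (1 / w) * w ^ N) \<longlonglongrightarrow> 0"
  proof (rule tendsto_0_le[where K = ?K])
    show "(\<lambda>N. w ^ N) \<longlonglongrightarrow> 0" using assms by (rule_tac LIMSEQ_power_zero) simp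
    show "\<forall>\<^sub>F N in sequentially. norm (C ([:0, 1:] ^ N * g) (1 / w) * w ^ N) \<le> norm (w ^ N) * ?K"
    proof (intro always_eventually allI)
      fix N
      have "cmod (C ([:0, 1:] ^ N * g) (1 / w)) * cmod (w ^ N) \<le> ?K * cmod (w ^ N)"
        by (intro mult_right_mono C_bound[OF w1 B']) auto
      then show "norm (C ([:0, 1:] ^ N * g) (1 / w) * w ^ N) \<le> norm (w ^ N) * ?K"
        by (simp only: norm_mult mult.commute)
    qed
  qed
  then have "(\<lambda>N. C g (1 / w) - C ([:0, 1:] ^ N * g) (1 / w) * w ^ N) \<longlonglongrightarrow> C g (1 / w) - 0"
    by (intro tendsto_intros)
  then have "(\<lambda>N. \<Sum>n<Suc N. fps_nth (fps_of (moment_fps g)) n * w ^ n) \<longlonglongrightarrow> C g (1 / w)"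
    by (simp only: sum diff_zero)
  then show ?thesis unfolding sums_def by (rule LIMSEQ_imp_Suc)
qed

lemma C_expands: "expands (C g) (moment_fps g)"
proof -
  let ?G = "\<lambda>w. if w = 0 then 0 else C g (1 / w)"
  have "\<forall>\<^sub>F w in nhds 0. (\<lambda>n. fps_nth (fps_of (moment_fps g)) n * w ^ n) sums ?G w"
  proof -
    have "\<forall>\<^sub>F w::complex in nhds 0. w \<in> ball 0 1" by (rule eventually_nhds_in_open) auto
    then show ?thesis
    proof eventually_elim
      case (elim w)
      show ?case
      proof (cases "w = 0")
        case True
        have "(\<lambda>n. fps_nth (fps_of (moment_fps g)) n * 0 ^ n) sums fps_nth (fps_of (moment_fps g)) 0"
          by (rule powser_sums_zero)
        then show ?thesis using True by (simp add: moment_fps_def)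
      next
        case False
        then show ?thesis using C_sums[of w g] elim by simp
      qed
    qed
  qed
  then have "?G has_fps_expansion fps_of (moment_fps g)" by (rule has_fps_expansionI)
  moreover have "\<forall>\<^sub>F z in at_infinity. C g z = ?G (1 / z)"
    using eventually_not_equal_at_infinity[of 0] by eventually_elim simp
  ultimately show ?thesis unfolding expands_def by blast
qed

end

section \<open>The Jacobi matrices of the two transforms\<close>

lemma (in positive_functional) jacobi_recurrence_unique:
  assumes "\<And>j. [:0, 1:] * P j = P (Suc j) + Polynomial.smult (b' j) (P j)
     + (if j = 0 then 0 else Polynomial.smult (c' (j - 1)) (P (j - 1)))"
  shows "b' = b" and "c' = c"
proof -
  have eq: "Polynomial.smult (b' j - b j) (P j)
     + (if j = 0 then 0 else Polynomial.smult (c' (j - 1) - c (j - 1)) (P (j - 1))) = 0" for j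
    using assms[of j] unfolding P_recurrence[of j] by (cases "j = 0") (auto simp: smult_diff_left algebra_simps)
  have "poly.coeff (P (j - 1)) j = 0" if "j \<noteq> 0" for j
    using that by (intro coeff_eq_0) simp
  then have bj: "b' j = b j" for j
    using arg_cong[OF eq[of j], of "\<lambda>p. poly.coeff p j"] by (cases "j = 0") auto
  then show "b' = b" by auto
  have "c' j = c j" for j
    using eq[of "Suc j"] bj[of "Suc j"] P_nonzero[of j] by simp
  then show "c' = c" by auto
qed

context two_interval_measure
begin

lemma integral_mult_eq_I: "(\<integral>t. poly p t * poly q t \<partial>\<sigma>) = I (p * q)"
  by (simp add: I_def)

lemma orth_poly_eq: "orth_poly \<sigma> = P"
proof
  fix j
  show "orth_poly \<sigma> j = P j"
    unfolding orth_poly_def integral_mult_eq_I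
  proof (rule the_equality)
    show "degree (P j) = j \<and> lead_coeff (P j) = 1 \<and> (\<forall>q. q = 0 \<or> degree q < j \<longrightarrow> I (P j * q) = 0)"
      using P_orth P_lead by auto
    fix p assume "degree p = j \<and> lead_coeff p = 1 \<and> (\<forall>q. q = 0 \<or> degree q < j \<longrightarrow> I (p * q) = 0)"
    then show "p = P j" by (intro P_unique) blast+
  qed
qed

lemma jacobi_recurrence_iff: "jacobi_recurrence \<sigma> b' c' \<longleftrightarrow> b' = b \<and> c' = c"
  unfolding jacobi_recurrence_def orth_poly_eq
  using jacobi_recurrence_unique[of b' c'] P_recurrence by blast

lemma jacobi_matrix_eq: "jacobi_matrix \<sigma> = blocks.tridiagonal b c"
proof -
  have bc: "jacobi_b \<sigma> = b" "jacobi_c \<sigma> = c"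
    unfolding jacobi_b_def jacobi_c_def jacobi_recurrence_iff by auto
  show ?thesis unfolding jacobi_matrix_def blocks.tridiagonal_def bc ..
qed

text \<open>The polynomial \<open>W a\<close> is \<open>t\<close> times the monic polynomial of degree \<open>nu a\<close> that is orthogonal
  to lower degrees with respect to \<open>t d\<sigma>(t)\<close>.\<close>

definition W :: "nat \<Rightarrow> real poly" where
  "W a = omega (nu a) (tau (nu a))"

text \<open>The functions \<open>\<Psi>\<close> are the transforms of the measures \<open>W a d\<sigma>\<close>, preceded by the constant \<open>- 1\<close>.
  They satisfy a three-term recurrence with the monic polynomials \<open>pq a\<close>, and \<open>- H a\<close> is the leading
  coefficient of \<open>\<Psi> a\<close> at infinity.\<close>

definition H :: "nat \<Rightarrow> real" where
  "H a = (case a of 0 \<Rightarrow> 1 | Suc d \<Rightarrow> U0 d * h (nu d))"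

definition pq :: "nat \<Rightarrow> real poly" where
  "pq a = (if blocks.two a then [:- (U0 a + Lc (Suc a)), - U1 a, 1:] else [:- (U0 a + Lc (Suc a)), 1:])"

definition \<Psi> :: "nat \<Rightarrow> complex \<Rightarrow> complex" where
  "\<Psi> a = (case a of 0 \<Rightarrow> (\<lambda>z. - 1) | Suc d \<Rightarrow> C (W d))"

definition \<Psi>_fps :: "nat \<Rightarrow> real fps" where
  "\<Psi>_fps a = (case a of 0 \<Rightarrow> fps_const (- 1) | Suc d \<Rightarrow> moment_fps (W d))"

lemma W_two: "blocks.two a \<Longrightarrow> W a = P (Suc (nu a))"
  using tau_eq_0_iff[of a] by (simp add: W_def omega_def)

lemma W_single: "\<not> blocks.two a \<Longrightarrow> W a = P (Suc (nu a)) + Polynomial.smult (U0 a) (P (nu a))"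
  by (simp add: W_def omega_def U0_def)

lemma W_0: "W 0 = [:0, 1:]"
proof -
  have "tau 0 = - b 0" by (simp add: tau_def P_Suc0)
  then show ?thesis by (simp add: W_def omega_def P_Suc0)
qed

lemma h_Suc: "h (Suc n) = c n * h n"
  using h_pos[of n] by (simp add: c_def)

lemma U0_Lc: "U0 (Suc d) * Lc (Suc d) = H (Suc (Suc d)) / H (Suc d)"
proof -
  have "h (nu (Suc d)) = Lc (Suc d) * (U0 d * h (nu d))"
    using U0_nonzero[of d] h_Suc[of "nu d"] h_Suc[of "Suc (nu d)"]
    by (simp add: Lc_def blocks.n_Suc_two) (simp add: U0_def)
  then show ?thesis using U0_nonzero[of d] h_pos[of "nu d"] by (simp add: H_def field_simps)
qed

lemma H_nonzero: "H a \<noteq> 0"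
  using U0_nonzero h_pos by (cases a) (auto simp: H_def less_le)

text \<open>The moments of \<open>W a d\<sigma>\<close>: the first nonzero one has index \<open>nu (a + 1) - 1\<close>.\<close>

lemma X_power_degree: "degree ([:0, 1:: real:] ^ m) = m"
  by (simp add: degree_power_eq)

lemma X_power_coeff: "poly.coeff ([:0, 1:: real:] ^ m) m = 1"
  using lead_coeff_power[of "[:0, 1:: real:]" m] by (simp add: X_power_degree)

lemma I_X_power_P:
  "I ([:0, 1:] ^ m * P n) = (if m < n then 0 else if m = n then h n else I ([:0, 1:] ^ m * P n))"
  using P_orth'[of "[:0, 1:] ^ m" n] I_P_monic[of "[:0, 1:] ^ m" n]
  by (auto simp: X_power_degree X_power_coeff mult.commute)

lemma W_moments_zero:
  assumes "Suc m < nu (Suc a)"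
  shows "I ([:0, 1:] ^ m * W a) = 0"
proof (cases "blocks.two a")
  case True
  then show ?thesis using assms I_X_power_P[of m "Suc (nu a)"]
    by (simp add: W_two blocks.n_Suc_two)
next
  case False
  then have "m < nu a" using assms by (simp add: blocks.n_Suc_two)
  then show ?thesis using I_X_power_P[of m "Suc (nu a)"] I_X_power_P[of m "nu a"]
    by (simp add: W_single[OF False] distrib_left I_add I_smult)
qed

lemma W_moments_lead:
  assumes "Suc m = nu (Suc a)"
  shows "I ([:0, 1:] ^ m * W a) = H (Suc a)"
proof (cases "blocks.two a")
  case True
  then have m: "m = Suc (nu a)" using assms by (simp add: blocks.n_Suc_two del: blocks.first_eq_Suc_Suc)
  show ?thesis unfolding m W_two[OF True] using I_X_power_P[of "Suc (nu a)" "Suc (nu a)"] True h_Suc[of "nu a"]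
    by (simp add: H_def U0_def)
next
  case False
  then have m: "m = nu a" using assms by (simp add: blocks.n_Suc_two del: blocks.first_eq_Suc_single)
  show ?thesis unfolding m W_single[OF False]
    using I_X_power_P[of "nu a" "Suc (nu a)"] I_X_power_P[of "nu a" "nu a"]
    by (simp add: H_def distrib_left I_add I_smult)
qed

text \<open>The identities \<open>R\<close> and \<open>X\<close> below say that \<open>U\<close> maps the vector of the polynomials \<open>P\<close> to \<open>t\<close>
  times that of the new orthogonal polynomials, and that \<open>L\<close> maps the latter back; together they give
  the recurrence that belongs to the product \<open>U L\<close>.\<close>

lemma W_recurrence:
  "W (Suc a) = pq a * W a
    - (case a of 0 \<Rightarrow> 0 | Suc d \<Rightarrow> Polynomial.smult (H (Suc a) / H a) (W d))"
proof -
  define R where "R = (if blocks.two a then [:- U1 a, 1:] else 1)"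
  have pq: "pq a = [:0, 1:] * R - [:U0 a + Lc (Suc a):]"
    by (simp add: pq_def R_def)
  have R: "R * W a = P (nu (Suc a)) + Polynomial.smult (U0 a) (P (nu a))"
  proof (cases "blocks.two a")
    case True
    then show ?thesis
      by (simp add: R_def W_two blocks.n_Suc_two P_SucSuc U1_def U0_def)
  next
    case False
    then show ?thesis by (simp add: R_def W_single blocks.n_Suc_two)
  qed
  have X: "[:0, 1:] * P (nu k) = W k + (case k of 0 \<Rightarrow> 0 | Suc d \<Rightarrow> Polynomial.smult (Lc k) (W d))" for k
  proof (cases k)
    case 0
    then show ?thesis by (simp add: W_0)
  next
    case (Suc d)
    have e: "[:0, 1:] * P (nu k) = P (Suc (nu k)) + Polynomial.smult (b (nu k)) (P (nu k))
        + Polynomial.smult (c (nu k - 1)) (P (nu k - 1))"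
      using P_recurrence[of "nu k"] Suc blocks.n_less_Suc[of d] by simp
    have Wk: "W k = P (Suc (nu k)) - Polynomial.smult (tau (nu k)) (P (nu k))"
      by (simp add: W_def omega_def)
    show ?thesis
    proof (cases "blocks.two d")
      case True
      then have "b (nu k) = - tau (nu k)" "nu k - 1 = Suc (nu d)" "Lc k = c (Suc (nu d))"
        using b_nu[of k] Suc by (simp_all add: Lc_def blocks.n_Suc_two)
      then show ?thesis unfolding e Wk by (simp add: Suc W_two[OF True])
    next
      case False
      have b: "b (nu k) = - tau (nu k) + Lc k" "nu k = Suc (nu d)" "Lc k * U0 d = c (nu d)"
      proof -
        show "b (nu k) = - tau (nu k) + Lc k" using b_nu[of k] Suc False by simp
        show "nu k = Suc (nu d)" using blocks.n_Suc_two[of d] unfolding Suc if_not_P[OF False] .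
        show "Lc k * U0 d = c (nu d)" using Suc False U0_nonzero[of d] by (simp add: Lc_def)
      qed
      have "Polynomial.smult (Lc k) (W d)
          = Polynomial.smult (Lc k) (P (nu k)) + Polynomial.smult (c (nu d)) (P (nu d))"
        unfolding W_single[OF False] by (simp add: smult_add_right b(2,3))
      then show ?thesis unfolding e Wk b(1) by (simp add: Suc[symmetric] b(2) smult_add_left)
        (simp add: Suc smult_diff_left)
    qed
  qed
  have "[:0, 1:] * (R * W a) = W (Suc a) + Polynomial.smult (Lc (Suc a)) (W a)
      + Polynomial.smult (U0 a) (W a)
      + Polynomial.smult (U0 a) (case a of 0 \<Rightarrow> 0 | Suc d \<Rightarrow> Polynomial.smult (Lc a) (W d))"
    unfolding R distrib_left mult_smult_right X by (simp add: smult_add_right)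
  then have "pq a * W a = W (Suc a)
      + Polynomial.smult (U0 a) (case a of 0 \<Rightarrow> 0 | Suc d \<Rightarrow> Polynomial.smult (Lc a) (W d))"
    unfolding pq by (simp add: left_diff_distrib smult_add_left smult_diff_left mult.assoc)
  then show ?thesis using U0_Lc by (cases a) simp_all
qed

text \<open>The transforms inherit the recurrence, since the moments of \<open>W a d\<sigma>\<close> that arise on the way
  vanish. For \<open>a = 0\<close> one moment survives; it is accounted for by \<open>\<Psi> 0 = - 1\<close>.\<close>

lemma \<Psi>_recurrence:
  assumes z: "cmod z > 1"
  shows "\<Psi> (Suc (Suc a)) z
      = cpoly (pq a) z * \<Psi> (Suc a) z - complex_of_real (H (Suc a) / H a) * \<Psi> a z"
proof -
  have corr: "C (pq a * W a) z = cpoly (pq a) z * C (W a) z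
      + complex_of_real (if a = 0 then H 1 else 0)"
  proof (cases "blocks.two a")
    case True
    define k0 k1 where "k0 = - (U0 a + Lc (Suc a))" and "k1 = - U1 a"
    have pq: "pq a = [:k0, k1, 1:]" using True by (simp add: pq_def k0_def k1_def)
    have "pq a * W a = [:0, 1:] * ([:0, 1:] * W a) + (Polynomial.smult k1 ([:0, 1:] * W a)
        + Polynomial.smult k0 (W a))"
      by (simp add: pq)
    then have "C (pq a * W a) z = z * (z * C (W a) z + complex_of_real (I (W a)))
        + complex_of_real (I ([:0, 1:] * W a))
        + (complex_of_real k1 * (z * C (W a) z + complex_of_real (I (W a))) + complex_of_real k0 * C (W a) z)"
      by (simp only: C_add[OF z] C_smult C_mult_X[OF z])
    moreover have "I (W a) = 0" using W_moments_zero[of 0 a] True by (simp add: blocks.n_Suc_two)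
    moreover have "I ([:0, 1:] * W a) = (if a = 0 then H 1 else 0)"
    proof (cases "a = 0")
      case True
      then show ?thesis using W_moments_lead[of 1 0] \<open>blocks.two a\<close> by (simp add: blocks.n_Suc_two)
    next
      case False
      then have "nu a > 0" using blocks.n_eq_iff[of a 0] by simp
      then show ?thesis using W_moments_zero[of 1 a] \<open>blocks.two a\<close> False by (simp add: blocks.n_Suc_two)
    qed
    ultimately show ?thesis by (simp add: cpoly_def pq map_poly_pCons algebra_simps)
  next
    case False
    define k0 where "k0 = - (U0 a + Lc (Suc a))"
    have pq: "pq a = [:k0, 1:]" using False by (simp add: pq_def k0_def)
    have "pq a * W a = [:0, 1:] * W a + Polynomial.smult k0 (W a)" by (simp add: pq)
    then have "C (pq a * W a) z = z * C (W a) z + complex_of_real (I (W a)) + complex_of_real k0 * C (W a) z"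
      by (simp only: C_add[OF z] C_smult C_mult_X[OF z])
    moreover have "I (W a) = (if a = 0 then H 1 else 0)"
    proof (cases "a = 0")
      case True
      then show ?thesis using W_moments_lead[of 0 0] \<open>\<not> blocks.two a\<close> by (simp add: blocks.n_Suc_two)
    next
      case a: False
      then have "nu a > 0" using blocks.n_eq_iff[of a 0] by simp
      then show ?thesis using W_moments_zero[of 0 a] False a by (simp add: blocks.n_Suc_two)
    qed
    ultimately show ?thesis by (simp add: cpoly_def pq map_poly_pCons algebra_simps)
  qed
  show ?thesis
  proof (cases a)
    case 0
    then show ?thesis using corr W_recurrence[of 0] by (simp add: \<Psi>_def H_def)
  next
    case (Suc d)
    have "W (Suc a) = pq a * W a + Polynomial.smult (- (H (Suc a) / H a)) (W d)"
      using W_recurrence[of a] Suc by simp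
    then have "C (W (Suc a)) z = C (pq a * W a) z - complex_of_real (H (Suc a) / H a) * C (W d) z"
      by (simp only: C_add[OF z] C_smult) simp
    then show ?thesis using corr Suc by (simp add: \<Psi>_def)
  qed
qed

lemma \<Psi>_fps_nth:
  shows "fps_nth (\<Psi>_fps a) (nu a) = - H a" and "i < nu a \<Longrightarrow> fps_nth (\<Psi>_fps a) i = 0"
proof -
  have p: "nu (Suc d) \<noteq> 0" for d using blocks.n_less_Suc[of d] by simp
  show "fps_nth (\<Psi>_fps a) (nu a) = - H a"
  proof (cases a)
    case (Suc d)
    then show ?thesis using W_moments_lead[of "nu (Suc d) - 1" d] p[of d]
      by (simp add: \<Psi>_fps_def moment_fps_def)
  qed (simp add: \<Psi>_fps_def H_def)
  show "fps_nth (\<Psi>_fps a) i = 0" if "i < nu a"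
  proof (cases a)
    case (Suc d)
    then show ?thesis using W_moments_zero[of "i - 1" d] that
      by (cases i) (simp_all add: \<Psi>_fps_def moment_fps_def)
  qed (use that in simp)
qed

sublocale cf: three_term_expansion \<Psi> \<Psi>_fps nu H pq
proof
  fix j
  show "expands (\<Psi> j) (\<Psi>_fps j)"
  proof (cases j)
    case 0
    have "fps_of (fps_const (- 1)) = fps_const (- 1)" by (simp add: fps_eq_iff)
    then have "(\<lambda>w. - 1) has_fps_expansion fps_of (fps_const (- 1))"
      using has_fps_expansion_const[of "- 1 :: complex"] by simp
    then show ?thesis using 0 by (auto simp: expands_def \<Psi>_def \<Psi>_fps_def)
  qed (simp add: \<Psi>_def \<Psi>_fps_def C_expands)
  show "subdegree (\<Psi>_fps j) = nu j"
    using \<Psi>_fps_nth H_nonzero[of j] by (intro subdegreeI) auto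
  show "fps_nth (\<Psi>_fps j) (nu j) = - H j" by (rule \<Psi>_fps_nth)
  show "H j \<noteq> 0" by (rule H_nonzero)
  show "nu j < nu (Suc j)" by (rule blocks.n_less_Suc)
  show "lead_coeff (pq j) = 1" by (simp add: pq_def)
  have "\<forall>\<^sub>F z::complex in at_infinity. cmod z \<ge> 2" by (auto simp: eventually_at_infinity)
  then show "\<forall>\<^sub>F z in at_infinity. \<Psi> (Suc (Suc j)) z
      = cpoly (pq j) z * \<Psi> (Suc j) z - complex_of_real (H (Suc j) / H j) * \<Psi> j z"
    by eventually_elim (rule \<Psi>_recurrence, simp)
qed (simp_all add: \<Psi>_def H_def)

lemma \<Psi>_1: "\<Psi> 1 = (\<lambda>z. \<integral>t. complex_of_real t / (complex_of_real t - z) \<partial>\<sigma>)"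
  by (simp add: \<Psi>_def W_0 C_def fun_eq_iff)

lemma moment_eq: "(\<integral>t. t ^ (j + 1) \<partial>\<sigma>) = I (monom 1 (j + 1))"
  by (simp add: I_def poly_monom)

lemma asym_coeffs_\<Psi>: "asym_coeffs (\<Psi> 1) = (\<lambda>j. \<integral>t. t ^ (j + 1) \<partial>\<sigma>)"
proof -
  have e: "expands (\<Psi> 1) (moment_fps [:0, 1:])"
    using C_expands[of "W 0"] by (simp add: \<Psi>_def W_0)
  have "[:0, 1:] ^ j * [:0, 1:] = (monom 1 (j + 1) :: real poly)" for j
    by (simp add: monom_altdef mult.commute)
  then have "- fps_nth (moment_fps [:0, 1:]) (Suc j) = (\<integral>t. t ^ (j + 1) \<partial>\<sigma>)" for j
    unfolding moment_eq by (simp add: moment_fps_def)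
  then show ?thesis using expands_asym_coeffs[OF e] by (simp add: moment_fps_def fun_eq_iff)
qed

lemma normal_index_moments: "normal_index (\<lambda>j. \<integral>t. t ^ (j + 1) \<partial>\<sigma>) = nu"
  by (rule normal_index_eq_nu[OF moment_eq])

lemma gen_jacobi_matrix_eq:
  "gen_jacobi_matrix (\<Psi> 1) = blocks.block_tridiagonal
     (\<lambda>a. poly.coeff (pq a) 0) (\<lambda>a. poly.coeff (pq a) 1) (\<lambda>a. cf.\<gamma> (Suc a))"
  unfolding gen_jacobi_matrix_def Let_def cf.cf_seq_poly cf.gen_jacobi_c_eq asym_coeffs_\<Psi>
    normal_index_moments blocks.block_tridiagonal_def ..

lemma UL_equations_P:
  "blocks.UL_equations (\<lambda>a. poly.coeff (pq a) 0) (\<lambda>a. poly.coeff (pq a) 1) (\<lambda>a. cf.\<gamma> (Suc a)) Lc U0 U1"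
  unfolding blocks.UL_equations_def cf.\<gamma>_def U0_Lc[symmetric] by (simp add: pq_def)

lemma first_moment_ratio: "(\<integral>t. t ^ (nu 1 - 1 + 1) \<partial>\<sigma>) / (\<integral>t. 1 \<partial>\<sigma>) = U0 0"
proof -
  have "nu 1 \<noteq> 0" using blocks.n_less_Suc[of 0] by simp
  then have "I ([:0, 1:] ^ (nu 1 - 1) * W 0) = H 1" using W_moments_lead[of "nu 1 - 1" 0] by simp
  moreover have "[:0, 1:] ^ (nu 1 - 1) * W 0 = monom 1 (nu 1 - 1 + 1)"
    by (simp add: W_0 monom_altdef mult.commute)
  ultimately have "(\<integral>t. t ^ (nu 1 - 1 + 1) \<partial>\<sigma>) = U0 0 * h 0"
    unfolding moment_eq by (simp add: H_def)
  moreover have "h 0 = (\<integral>t. 1 \<partial>\<sigma>)" by (simp add: h_def I_def)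
  ultimately show ?thesis using h_pos[of 0] by simp
qed

text \<open>Both factorizations have the same factor \<open>U\<close>.\<close>

lemma UL_factor_P:
  "UL_factor_U nu (gen_jacobi_matrix (\<Psi> 1)) ((\<integral>t. t ^ (nu 1 - 1 + 1) \<partial>\<sigma>) / (\<integral>t. 1 \<partial>\<sigma>))
    = LU_factor_U nu (jacobi_matrix \<sigma>)"
  unfolding first_moment_ratio gen_jacobi_matrix_eq jacobi_matrix_eq LU_factor_P
  by (rule blocks.UL_factor_U_eq[OF UL_equations_P Lc_nonzero])

lemma bounded_LU_factor: "bounded_l2 (LU_factor_U nu (jacobi_matrix \<sigma>)) \<longleftrightarrow> (\<exists>K. \<forall>j. \<bar>tau (nu j)\<bar> \<le> K)"
  unfolding jacobi_matrix_eq LU_factor_P by (rule bounded_block_U)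

end

section \<open>Diagonal Pade approximants\<close>

lemma poly_bigo_zero:
  fixes D :: "complex poly"
  assumes "degree D \<le> N" "poly D \<in> O[at 0](\<lambda>w. w ^ Suc N)"
  shows "D = 0"
proof (rule ccontr)
  assume "D \<noteq> 0"
  then obtain q where q: "D = [:- 0, 1:] ^ order 0 D * q" "\<not> [:- 0, 1:] dvd q"
    using order_decomp by blast
  define k where "k = order 0 D"
  have k: "k \<le> N" using order_degree[OF \<open>D \<noteq> 0\<close>, of 0] assms(1) by (simp add: k_def)
  have q0: "poly q 0 \<noteq> 0" using q(2) by (simp add: poly_eq_0_iff_dvd)
  have D: "poly D w = w ^ k * poly q w" for w
    by (subst q(1)) (simp add: k_def poly_power)
  obtain K where K: "\<forall>\<^sub>F w in at 0. norm (poly D w) \<le> K * norm (w ^ Suc N)"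
    using assms(2) by (auto elim: landau_o.bigE)
  have "\<forall>\<^sub>F w::complex in at 0. norm (poly q w) \<le> K * norm (w ^ (Suc N - k))"
  proof -
    have "\<forall>\<^sub>F w::complex in at 0. w \<noteq> 0" by (auto simp: eventually_at_filter)
    with K show ?thesis
    proof eventually_elim
      case (elim w)
      have "w ^ Suc N = w ^ k * w ^ (Suc N - k)" using k by (simp flip: power_add)
      then have "norm (w ^ k) * norm (poly q w) \<le> norm (w ^ k) * (K * norm (w ^ (Suc N - k)))"
        using elim(1) by (simp add: D norm_mult mult_ac)
      then show ?case using elim(2) by simp
    qed
  qed
  moreover have "((\<lambda>w::complex. K * norm (w ^ (Suc N - k))) \<longlongrightarrow> K * norm ((0::complex) ^ (Suc N - k))) (at 0)"
    by (intro tendsto_intros)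
  then have "((\<lambda>w::complex. K * norm (w ^ (Suc N - k))) \<longlongrightarrow> 0) (at 0)"
    using k by (simp add: power_0_left)
  ultimately have "((\<lambda>w. poly q w) \<longlongrightarrow> 0) (at 0)"
    by (rule Lim_null_comparison)
  moreover have "((\<lambda>w. poly q w) \<longlongrightarrow> poly q 0) (at 0)"
    by (intro tendsto_intros)
  ultimately have "poly q 0 = 0" using tendsto_unique[of "at (0::complex)"] by force
  then show False using q0 by simp
qed

text \<open>The approximant is unique as a rational function.\<close>

lemma is_pade_unique:
  assumes "is_pade s L M A B" "is_pade s L M A' B'"
  shows "A * B' = A' * B"
proof -
  let ?D = "A * B' - A' * B"
  have deg: "degree A \<le> L" "degree B \<le> M" "degree A' \<le> L" "degree B' \<le> M"
    and B0: "poly B 0 \<noteq> 0" "poly B' 0 \<noteq> 0"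
    using assms by (auto simp: is_pade_def)
  have "degree ?D \<le> L + M"
    using degree_mult_le[of A B'] degree_mult_le[of A' B] deg by (intro degree_diff_le) auto
  moreover have "poly ?D \<in> O[at 0](\<lambda>w. w ^ Suc (L + M))"
  proof -
    let ?S = "\<lambda>z::complex. \<Sum>j<L + M. complex_of_real (s j) / z ^ (j + 1)"
    have "(\<lambda>z. ?S z + poly A (1 / z) / poly B (1 / z)) \<in> O[at_infinity](\<lambda>z. 1 / z ^ (L + M + 1))"
      "(\<lambda>z. ?S z + poly A' (1 / z) / poly B' (1 / z)) \<in> O[at_infinity](\<lambda>z. 1 / z ^ (L + M + 1))"
      using assms unfolding is_pade_def by blast+
    then have "(\<lambda>z. (?S z + poly A (1 / z) / poly B (1 / z)) - (?S z + poly A' (1 / z) / poly B' (1 / z)))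
        \<in> O[at_infinity](\<lambda>z. 1 / z ^ (L + M + 1))"
      by (rule sum_in_bigo)
    then have o: "(\<lambda>z. poly A (1 / z) / poly B (1 / z) - poly A' (1 / z) / poly B' (1 / z))
        \<in> O[at_infinity](\<lambda>z. 1 / z ^ (L + M + 1))" by simp
    have eq: "(\<lambda>w::complex. 1 / w) = inverse" by (simp add: fun_eq_iff inverse_eq_divide)
    have "filterlim (\<lambda>w::complex. 1 / w) at_infinity (at 0)"
      unfolding eq by (rule filterlim_inverse_at_infinity)
    from landau_o.big.compose[OF o this]
    have "(\<lambda>w. poly A w / poly B w - poly A' w / poly B' w) \<in> O[at 0](\<lambda>w. w ^ Suc (L + M))"
      by (simp add: power_one_over)
    moreover have "(\<lambda>w. poly B w * poly B' w) \<in> O[at 0](\<lambda>w. 1)"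
    proof (rule bigoI_tendsto)
      show "((\<lambda>w. poly B w * poly B' w / 1) \<longlongrightarrow> poly B 0 * poly B' 0 / 1) (at 0)"
        by (intro tendsto_intros) simp
    qed simp
    ultimately have m: "(\<lambda>w. (poly A w / poly B w - poly A' w / poly B' w) * (poly B w * poly B' w))
        \<in> O[at 0](\<lambda>w. w ^ Suc (L + M) * 1)"
      by (rule landau_o.big.mult)
    have "\<forall>\<^sub>F w in at 0. (poly A w / poly B w - poly A' w / poly B' w) * (poly B w * poly B' w) = poly ?D w"
    proof -
      have "(poly B \<longlongrightarrow> poly B 0) (at 0)" "(poly B' \<longlongrightarrow> poly B' 0) (at 0)"
        by (intro tendsto_intros)+
      then have "\<forall>\<^sub>F w in at 0. poly B w \<noteq> 0" "\<forall>\<^sub>F w in at 0. poly B' w \<noteq> 0"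
        using B0 tendsto_imp_eventually_ne by blast+
      then show ?thesis by eventually_elim (simp add: field_simps)
    qed
    from landau_o.big.in_cong[OF this] m show ?thesis by (simp only: mult_1_right)
  qed
  ultimately have "?D = 0" by (rule poly_bigo_zero)
  then show ?thesis by simp
qed

text \<open>The sphere-valued map depends only on the values off a finite set.\<close>

lemma sphere_map_cong:
  assumes "finite S" "\<And>z. z \<notin> S \<Longrightarrow> f z = g z"
  shows "sphere_map f = sphere_map g"
proof
  fix w :: riemann_sphere
  define G where "G = (case w of None \<Rightarrow> at_infinity | Some z \<Rightarrow> at z)"
  have "\<forall>\<^sub>F z in G. z \<notin> S"
  proof (cases w)
    case None
    obtain B where "\<And>x. x \<in> S \<Longrightarrow> cmod x \<le> B"
      using finite_imp_bounded[OF assms(1)] unfolding bounded_iff by blast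
    then have "\<forall>z. B + 1 \<le> cmod z \<longrightarrow> z \<notin> S" by fastforce
    then show ?thesis by (auto simp: G_def None eventually_at_infinity)
  next
    case (Some z)
    have "open (- (S - {z}))" using assms(1) by (intro open_Compl finite_imp_closed) auto
    then have "\<forall>\<^sub>F y in at z. y \<in> - (S - {z}) - {z}" by (rule eventually_at_in_open) auto
    then show ?thesis by (auto simp: G_def Some elim: eventually_mono)
  qed
  then have ev: "\<forall>\<^sub>F z in G. f z = g z" by eventually_elim (rule assms(2))
  have "filterlim f at_infinity G \<longleftrightarrow> filterlim g at_infinity G"
    using ev by (intro filterlim_cong refl)
  moreover have "Lim G f = Lim G g"
    unfolding Topological_Spaces.Lim_def using tendsto_cong[OF ev] by simp
  ultimately show "sphere_map f w = sphere_map g w"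
    unfolding sphere_map_def Let_def G_def[symmetric] by simp
qed

lemma sphere_map_Some: "(f \<longlongrightarrow> l) (at z) \<Longrightarrow> sphere_map f (Some z) = Some l"
  using not_tendsto_and_filterlim_at_infinity[of "at z" f l] tendsto_Lim[of "at z" f l]
  by (auto simp: sphere_map_def Let_def)

lemma sphere_map_None: "(f \<longlongrightarrow> l) at_infinity \<Longrightarrow> sphere_map f None = Some l"
  using not_tendsto_and_filterlim_at_infinity[of at_infinity f l] tendsto_Lim[of at_infinity f l]
    trivial_limit_at_infinity[where 'a = complex]
  by (auto simp: sphere_map_def Let_def)

lemma sphere_map_pole: "filterlim f at_infinity (at z) \<Longrightarrow> sphere_map f (Some z) = None"
  by (simp add: sphere_map_def Let_def)

lemma is_pade_imp_pade_eq:
  assumes "is_pade s L M A B"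
  shows "pade s L M = sphere_map (\<lambda>z. poly A (1 / z) / poly B (1 / z))"
  unfolding pade_def
proof (rule the_equality)
  show "\<exists>A' B'. is_pade s L M A' B' \<and> sphere_map (\<lambda>z. poly A (1 / z) / poly B (1 / z))
      = sphere_map (\<lambda>z. poly A' (1 / z) / poly B' (1 / z))"
    using assms by blast
next
  fix R assume "\<exists>A B. is_pade s L M A B \<and> R = sphere_map (\<lambda>z. poly A (1 / z) / poly B (1 / z))"
  then obtain A' B' where p: "is_pade s L M A' B'"
    and R: "R = sphere_map (\<lambda>z. poly A' (1 / z) / poly B' (1 / z))" by blast
  have "B * B' \<noteq> 0" using assms p by (auto simp: is_pade_def)
  then have fin: "finite (insert 0 ((\<lambda>w. 1 / w) ` {w. poly (B * B') w = 0}))"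
    by (simp add: poly_roots_finite)
  show "R = sphere_map (\<lambda>z. poly A (1 / z) / poly B (1 / z))"
    unfolding R
  proof (rule sphere_map_cong[OF fin])
    fix z assume z: "z \<notin> insert 0 ((\<lambda>w. 1 / w) ` {w. poly (B * B') w = 0})"
    have "poly (B * B') (1 / z) \<noteq> 0"
    proof
      assume "poly (B * B') (1 / z) = 0"
      then have "1 / (1 / z) \<in> (\<lambda>w. 1 / w) ` {w. poly (B * B') w = 0}" by blast
      then show False using z by simp
    qed
    moreover have "poly (A * B') (1 / z) = poly (A' * B) (1 / z)"
      using is_pade_unique[OF assms p] by simp
    ultimately show "poly A' (1 / z) / poly B' (1 / z) = poly A (1 / z) / poly B (1 / z)"
      by (simp add: frac_eq_eq)
  qed
qed

text \<open>The integrand of the transforms, with \<open>kernel 0 0 = 0\<close>.\<close>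

abbreviation (input) kernel :: "complex \<Rightarrow> real \<Rightarrow> complex" where
  "kernel z t \<equiv> complex_of_real t / (complex_of_real t - z)"

lemma geometric_remainder:
  fixes x z :: complex
  assumes "z \<noteq> 0" "z \<noteq> x"
  shows "(\<Sum>j<N. x ^ (j + 1) / z ^ (j + 1)) + x / (x - z) = x ^ (N + 1) / (z ^ N * (x - z))"
proof (induction N)
  case (Suc N)
  have "x - z \<noteq> 0" using assms by simp
  have "(\<Sum>j<Suc N. x ^ (j + 1) / z ^ (j + 1)) + x / (x - z)
      = x ^ (N + 1) / (z ^ N * (x - z)) + x ^ (N + 1) / z ^ (N + 1)"
    using Suc.IH by (simp add: algebra_simps)
  also have "\<dots> = x ^ (Suc N + 1) / (z ^ Suc N * (x - z))"
    using assms \<open>x - z \<noteq> 0\<close> by (simp add: divide_simps) (simp add: algebra_simps)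
  finally show ?case .
qed simp

context positive_functional
begin

text \<open>The transform \<open>\<integral> t d\<sigma>\<^sub>n(t) / (t - z)\<close> of the quadrature measure. A node at the
  origin contributes 0, also for \<open>z = 0\<close>.\<close>

definition quad_transform :: "nat \<Rightarrow> complex \<Rightarrow> complex" where
  "quad_transform n z = (\<Sum>x\<in>nodes n (tau n). complex_of_real (weight (nodes n (tau n)) x)
     * (kernel z x))"

lemma zero_node: "poly (P n) 0 \<noteq> 0 \<Longrightarrow> 0 \<in> nodes n (tau n)"
  by (simp add: nodes_def omega_def tau_def)

text \<open>Exactness of the quadrature up to degree \<open>2 n\<close> is the order condition for the approximant,
  and the node at the origin drops out, which leaves \<open>n\<close> poles.\<close>

lemma pade_eq_quad_transform:
  assumes n: "poly (P n) 0 \<noteq> 0" and s: "\<And>j. s j = I (monom 1 (j + 1))"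
  shows "pade s n n = sphere_map (quad_transform n)"
proof -
  define X where "X = nodes n (tau n)"
  define X' where "X' = X - {0}"
  define w where "w x = weight X x" for x
  define A where "A = (\<Sum>x\<in>X'. Polynomial.smult (complex_of_real (w x * x))
      ([:0, 1:] * (\<Prod>y\<in>X' - {x}. [:- 1, complex_of_real y:])))"
  define B where "B = (\<Prod>x\<in>X'. [:- 1, complex_of_real x:])"
  have fin: "finite X" "finite X'" by (simp_all add: X_def X'_def)
  have card: "card X' = n"
    using zero_node[OF n] nodes_card[of n "tau n"] by (simp add: X'_def X_def)
  have qt: "quad_transform n z = (\<Sum>x\<in>X'. complex_of_real (w x) * (kernel z x))" for z
    unfolding quad_transform_def X_def[symmetric] w_def[symmetric] X'_def
    using fin by (intro sum.mono_neutral_right) auto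
  have dprod: "degree (\<Prod>y\<in>Y. [:- 1, complex_of_real y:]) \<le> card Y" if "finite Y" for Y
    using degree_prod_sum_le[OF that, of "\<lambda>y. [:- 1, complex_of_real y:]"]
      sum_bounded_above[of Y "\<lambda>y. degree [:- 1, complex_of_real y:]" 1]
    by (auto intro: order_trans)
  have eq: "poly A (1 / z) / poly B (1 / z) = quad_transform n z"
    if z: "z \<noteq> 0" "z \<notin> complex_of_real ` X'" for z
  proof -
    have ne: "complex_of_real x / z - 1 \<noteq> 0" if "x \<in> X'" for x
      using that z by auto
    have B: "poly B (1 / z) = (\<Prod>x\<in>X'. complex_of_real x / z - 1)"
      by (simp add: B_def poly_prod)
    have B0: "poly B (1 / z) \<noteq> 0" unfolding B by (subst prod_zero_iff[OF fin(2)]) (use ne in blast)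
    have "poly A (1 / z) / poly B (1 / z) = (\<Sum>x\<in>X'. complex_of_real (w x * x) * (1 / z)
        * (\<Prod>y\<in>X' - {x}. complex_of_real y / z - 1) / poly B (1 / z))"
      by (simp add: A_def poly_sum poly_prod sum_divide_distrib)
    also have "\<dots> = (\<Sum>x\<in>X'. complex_of_real (w x) * (kernel z x))"
    proof (rule sum.cong[OF refl])
      fix x assume x: "x \<in> X'"
      have "poly B (1 / z) = (complex_of_real x / z - 1) * (\<Prod>y\<in>X' - {x}. complex_of_real y / z - 1)"
        unfolding B using x fin by (simp add: prod.remove)
      moreover have "(\<Prod>y\<in>X' - {x}. complex_of_real y / z - 1) \<noteq> 0" using fin ne by auto
      ultimately have "complex_of_real (w x * x) * (1 / z)
          * (\<Prod>y\<in>X' - {x}. complex_of_real y / z - 1) / poly B (1 / z)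
          = complex_of_real (w x * x) * (1 / z) / (complex_of_real x / z - 1)"
        by simp
      also have "\<dots> = complex_of_real (w x) * (kernel z x)"
        using z ne[OF x] by (simp add: field_simps)
      finally show "complex_of_real (w x * x) * (1 / z)
          * (\<Prod>y\<in>X' - {x}. complex_of_real y / z - 1) / poly B (1 / z)
          = complex_of_real (w x) * (kernel z x)" .
    qed
    finally show ?thesis unfolding qt .
  qed
  have "is_pade s n n A B"
    unfolding is_pade_def
  proof (intro conjI)
    show "degree A \<le> n"
      unfolding A_def
    proof (intro degree_sum_le fin)
      fix x assume x: "x \<in> X'"
      have "card (X' - {x}) = n - 1" "n \<ge> 1" using x fin card card_gt_0_iff[of X'] by auto
      then have "degree ([:0, 1:] * (\<Prod>y\<in>X' - {x}. [:- 1, complex_of_real y:])) \<le> n"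
        using degree_mult_le[of "[:0, 1:]" "\<Prod>y\<in>X' - {x}. [:- 1, complex_of_real y:]"]
          dprod[of "X' - {x}"] fin by (simp del: mult_pCons_left)
      then show "degree (Polynomial.smult (complex_of_real (w x * x))
          ([:0, 1:] * (\<Prod>y\<in>X' - {x}. [:- 1, complex_of_real y:]))) \<le> n"
        by (rule order_trans[OF degree_smult_le])
    qed
    show "degree B \<le> n" unfolding B_def using dprod[OF fin(2)] card by simp
    show "poly B 0 \<noteq> 0" using fin by (simp add: B_def poly_prod)
    let ?R = "\<lambda>z. \<Sum>x\<in>X'. complex_of_real (w x) * (complex_of_real x ^ (2 * n + 1) / (z ^ (2 * n) * (complex_of_real x - z)))"
    have sj: "complex_of_real (s j) = (\<Sum>x\<in>X'. complex_of_real (w x) * complex_of_real x ^ (j + 1))"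
      if "j < n + n" for j
    proof -
      have "s j = (\<Sum>x\<in>X. w x * poly (monom 1 (j + 1)) x)"
        unfolding s X_def w_def using that by (intro quadrature) (simp add: degree_monom_eq)
      also have "\<dots> = (\<Sum>x\<in>X'. w x * x ^ (j + 1))"
        unfolding X'_def poly_monom using fin by (subst sum.mono_neutral_right[of X "X - {0}"]) auto
      finally show ?thesis by simp
    qed
    have ev: "\<forall>\<^sub>F z in at_infinity. (\<Sum>j<n + n. complex_of_real (s j) / z ^ (j + 1))
        + poly A (1 / z) / poly B (1 / z) = ?R z"
    proof -
      obtain K where K: "\<And>x. x \<in> X' \<Longrightarrow> \<bar>x\<bar> \<le> K"
        using finite_imp_bounded[OF fin(2)] unfolding bounded_iff by (metis real_norm_def)
      have "\<forall>\<^sub>F z::complex in at_infinity. \<bar>K\<bar> + 1 \<le> cmod z" by (auto simp: eventually_at_infinity)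
      then show ?thesis
      proof eventually_elim
        case (elim z)
        have z: "z \<noteq> 0" using elim by auto
        have zx: "z \<noteq> complex_of_real x" if "x \<in> X'" for x
          using K[OF that] elim by auto
        have "(\<Sum>j<n + n. complex_of_real (s j) / z ^ (j + 1))
            = (\<Sum>j<n + n. \<Sum>x\<in>X'. complex_of_real (w x) * (complex_of_real x ^ (j + 1) / z ^ (j + 1)))"
          by (intro sum.cong) (auto simp: sj sum_divide_distrib)
        also have "\<dots> = (\<Sum>x\<in>X'. complex_of_real (w x) * (\<Sum>j<n + n. complex_of_real x ^ (j + 1) / z ^ (j + 1)))"
          by (subst sum.swap) (simp add: sum_distrib_left)
        finally have "(\<Sum>j<n + n. complex_of_real (s j) / z ^ (j + 1)) + quad_transform n z
            = (\<Sum>x\<in>X'. complex_of_real (w x) * ((\<Sum>j<n + n. complex_of_real x ^ (j + 1) / z ^ (j + 1))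
              + kernel z x))"
          unfolding qt by (simp add: sum.distrib distrib_left)
        also have "\<dots> = ?R z"
          using geometric_remainder[OF z zx, of _ "n + n"] by (intro sum.cong) (auto simp: mult_2)
        finally show ?case using eq[OF z] zx by fastforce
      qed
    qed
    have "?R \<in> O[at_infinity](\<lambda>z. 1 / z ^ (n + n + 1))"
    proof (rule big_sum_in_bigo)
      fix x assume "x \<in> X'"
      have "\<forall>\<^sub>F z::complex in at_infinity. 2 * \<bar>x\<bar> + 1 \<le> cmod z" by (auto simp: eventually_at_infinity)
      then have "\<forall>\<^sub>F z in at_infinity. norm (complex_of_real (w x) * (complex_of_real x ^ (2 * n + 1)
          / (z ^ (2 * n) * (complex_of_real x - z))))
          \<le> (2 * \<bar>w x\<bar> * \<bar>x\<bar> ^ (2 * n + 1)) * norm (1 / z ^ (n + n + 1))"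
      proof eventually_elim
        case (elim z)
        have "cmod z \<le> 2 * cmod (complex_of_real x - z)"
          using norm_triangle_ineq2[of z "complex_of_real x"] elim by (simp add: norm_minus_commute)
        moreover have "cmod z > 0" using elim by (auto intro: less_le_trans[of 0 "2 * \<bar>x\<bar> + 1"])
        ultimately have "1 / (cmod z ^ (2 * n) * cmod (complex_of_real x - z)) \<le> 2 / (cmod z ^ (2 * n) * cmod z)"
          by (simp add: divide_simps)
        then have "\<bar>w x\<bar> * \<bar>x\<bar> ^ (2 * n + 1) * (1 / (cmod z ^ (2 * n) * cmod (complex_of_real x - z)))
            \<le> \<bar>w x\<bar> * \<bar>x\<bar> ^ (2 * n + 1) * (2 / (cmod z ^ (2 * n) * cmod z))"
          by (intro mult_left_mono) auto
        moreover have "norm (complex_of_real (w x) * (complex_of_real x ^ (2 * n + 1)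
            / (z ^ (2 * n) * (complex_of_real x - z))))
            = \<bar>w x\<bar> * \<bar>x\<bar> ^ (2 * n + 1) * (1 / (cmod z ^ (2 * n) * cmod (complex_of_real x - z)))"
          by (simp add: norm_mult norm_divide norm_power)
        moreover have "\<bar>w x\<bar> * \<bar>x\<bar> ^ (2 * n + 1) * (2 / (cmod z ^ (2 * n) * cmod z))
            = (2 * \<bar>w x\<bar> * \<bar>x\<bar> ^ (2 * n + 1)) * norm (1 / z ^ (n + n + 1))"
        proof -
          have e: "n + n + 1 = Suc (2 * n)" by simp
          show ?thesis unfolding e norm_divide norm_power power_Suc by (simp add: norm_mult norm_power mult_ac)
        qed
        ultimately show ?case by (simp only:)
      qed
      then show "(\<lambda>z. complex_of_real (w x) * (complex_of_real x ^ (2 * n + 1)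
          / (z ^ (2 * n) * (complex_of_real x - z)))) \<in> O[at_infinity](\<lambda>z. 1 / z ^ (n + n + 1))"
        by (rule bigoI)
    qed
    then show "(\<lambda>z. (\<Sum>j<n + n. complex_of_real (s j) / z ^ (j + 1)) + poly A (1 / z) / poly B (1 / z))
        \<in> O[at_infinity](\<lambda>z. 1 / z ^ (n + n + 1))"
      using landau_o.big.in_cong[OF ev] by blast
  qed
  then have "pade s n n = sphere_map (\<lambda>z. poly A (1 / z) / poly B (1 / z))"
    by (rule is_pade_imp_pade_eq)
  also have "\<dots> = sphere_map (quad_transform n)"
    using fin by (intro sphere_map_cong[of "insert 0 (complex_of_real ` X')"] eq) auto
  finally show ?thesis .
qed

lemma quad_transform_tendsto:
  assumes "\<And>x. x \<in> nodes n (tau n) \<Longrightarrow> x \<noteq> 0 \<Longrightarrow> z \<noteq> complex_of_real x"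
  shows "(quad_transform n \<longlongrightarrow> quad_transform n z) (at z)"
proof -
  have "((\<lambda>z. kernel z x) \<longlongrightarrow> kernel z x) (at z)"
    if "x \<in> nodes n (tau n)" for x
  proof (cases "x = 0")
    case False
    then have "complex_of_real x - z \<noteq> 0" using assms[OF that] by auto
    then show ?thesis by (intro tendsto_intros)
  qed simp
  then show ?thesis unfolding quad_transform_def by (intro tendsto_sum tendsto_mult tendsto_const)
qed

lemma inverse_pole: "filterlim (\<lambda>z. 1 / (a - z)) at_infinity (at (a :: complex))"
proof -
  have "filterlim (\<lambda>z. a - z) (at 0) (at a)"
    unfolding filterlim_at by (auto intro!: tendsto_eq_intros simp: eventually_at_filter)
  then have "filterlim (\<lambda>z. inverse (a - z)) at_infinity (at a)"
    by (rule filterlim_compose[OF filterlim_inverse_at_infinity])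
  then show ?thesis by (simp add: inverse_eq_divide)
qed

lemma quad_transform_pole:
  assumes x: "x \<in> nodes n (tau n)" and x0: "x \<noteq> 0"
  shows "sphere_map (quad_transform n) (Some (complex_of_real x)) = None"
proof (rule sphere_map_pole)
  let ?X = "nodes n (tau n)" let ?w = "weight ?X"
  let ?rest = "\<lambda>z. \<Sum>y\<in>?X - {x}. complex_of_real (?w y) * (kernel z y)"
  have "filterlim (\<lambda>z. complex_of_real (?w x * x) * (1 / (complex_of_real x - z)))
      at_infinity (at (complex_of_real x))"
    using weight_pos[OF x] x0
    by (intro tendsto_mult_filterlim_at_infinity[OF tendsto_const _ inverse_pole]) auto
  moreover have "(?rest \<longlongrightarrow> ?rest (complex_of_real x)) (at (complex_of_real x))"
    by (intro tendsto_intros) auto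
  ultimately have "filterlim (\<lambda>z. ?rest z + complex_of_real (?w x * x) * (1 / (complex_of_real x - z)))
      at_infinity (at (complex_of_real x))"
    using tendsto_add_filterlim_at_infinity by blast
  moreover have "quad_transform n = (\<lambda>z. ?rest z + complex_of_real (?w x * x) * (1 / (complex_of_real x - z)))"
    unfolding quad_transform_def using x by (intro ext) (simp add: sum.remove)
  ultimately show "filterlim (quad_transform n) at_infinity (at (complex_of_real x))" by simp
qed

end

section \<open>Stereographic projection\<close>

lemma one_plus_square_nonzero:
  "1 + (cmod z)\<^sup>2 \<noteq> 0" "complex_of_real (1 + (cmod z)\<^sup>2) \<noteq> 0"
proof -
  show "1 + (cmod z)\<^sup>2 \<noteq> 0" using add_pos_nonneg[of 1 "(cmod z)\<^sup>2"] by simp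
  then show "complex_of_real (1 + (cmod z)\<^sup>2) \<noteq> 0" unfolding of_real_eq_0_iff .
qed

lemma snd_stereo_Some: "snd (stereo (Some z)) = 1 - 2 / (1 + (cmod z)\<^sup>2)"
proof -
  have "1 + (cmod z)\<^sup>2 > 0" by (rule add_pos_nonneg) auto
  then show ?thesis by (simp add: field_simps)
qed

lemma snd_stereo_less_1: "snd (stereo (Some z)) < 1"
  unfolding snd_stereo_Some by (simp add: add_pos_nonneg)

lemma stereo_inverse: "fst (stereo (Some z)) / complex_of_real (1 - snd (stereo (Some z))) = z"
proof -
  have "complex_of_real (1 - snd (stereo (Some z))) = 2 / complex_of_real (1 + (cmod z)\<^sup>2)"
    unfolding snd_stereo_Some by simp
  then show ?thesis using one_plus_square_nonzero(2)[of z] by simp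
qed

lemma isCont_stereo_Some: "isCont (\<lambda>z. stereo (Some z)) a"
  unfolding stereo.simps
  by (intro isCont_Pair continuous_intros) (rule one_plus_square_nonzero)+

text \<open>The exterior of a disk is a compact part of the sphere, since the stereographic projection
  of \<open>1 / w\<close> depends continuously on \<open>w\<close>.\<close>

lemma compact_exterior:
  assumes "R > 0"
  shows "compact (stereo ` ({None} \<union> Some ` {z. R \<le> cmod z}))"
proof -
  define \<phi> :: "complex \<Rightarrow> complex \<times> real" where
    "\<phi> w = (2 * cnj w / complex_of_real (1 + (cmod w)\<^sup>2), (1 - (cmod w)\<^sup>2) / (1 + (cmod w)\<^sup>2))" for w
  have cont: "continuous_on UNIV \<phi>"
    unfolding \<phi>_def
    by (intro continuous_on_Pair continuous_intros) (use one_plus_square_nonzero in blast)+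
  have \<phi>: "\<phi> w = stereo (Some (1 / w))" if "w \<noteq> 0" for w
  proof -
    have a: "1 + (cmod (1 / w))\<^sup>2 = (1 + (cmod w)\<^sup>2) / (cmod w)\<^sup>2"
      using that by (simp add: norm_divide power_one_over field_simps)
    have b: "complex_of_real ((cmod w)\<^sup>2) = w * cnj w" by (rule complex_norm_square)
    have "2 * (1 / w) / complex_of_real (1 + (cmod (1 / w))\<^sup>2)
        = 2 * (1 / w) * (w * cnj w) / complex_of_real (1 + (cmod w)\<^sup>2)"
      unfolding a of_real_divide b by simp
    also have "\<dots> = 2 * cnj w / complex_of_real (1 + (cmod w)\<^sup>2)" using that by simp
    finally have 1: "2 * (1 / w) / complex_of_real (1 + (cmod (1 / w))\<^sup>2)
        = 2 * cnj w / complex_of_real (1 + (cmod w)\<^sup>2)" .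
    have "((cmod (1 / w))\<^sup>2 - 1) / (1 + (cmod (1 / w))\<^sup>2) = (1 - (cmod w)\<^sup>2) / (1 + (cmod w)\<^sup>2)"
    proof -
      have "(cmod (1 / w))\<^sup>2 - 1 = (1 - (cmod w)\<^sup>2) / (cmod w)\<^sup>2"
        using that by (simp add: norm_divide power_one_over field_simps)
      then show ?thesis unfolding a using that by simp
    qed
    with 1 show ?thesis unfolding \<phi>_def stereo.simps by simp
  qed
  have "stereo ` ({None} \<union> Some ` {z. R \<le> cmod z}) = \<phi> ` cball 0 (1 / R)"
  proof (intro equalityI subsetI)
    fix q assume "q \<in> stereo ` ({None} \<union> Some ` {z. R \<le> cmod z})"
    then consider "q = stereo None" | z where "q = stereo (Some z)" "R \<le> cmod z" by auto
    then show "q \<in> \<phi> ` cball 0 (1 / R)"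
    proof cases
      case 1
      then have "q = \<phi> 0" by (simp add: \<phi>_def)
      then show ?thesis using assms by auto
    next
      case 2
      then have z: "z \<noteq> 0" using assms by auto
      then have "q = \<phi> (1 / z)" using 2 \<phi>[of "1 / z"] by simp
      moreover have "1 / z \<in> cball 0 (1 / R)" using 2 assms z by (simp add: norm_divide frac_le)
      ultimately show ?thesis by blast
    qed
  next
    fix q assume "q \<in> \<phi> ` cball 0 (1 / R)"
    then obtain w where w: "q = \<phi> w" "cmod w \<le> 1 / R" by auto
    show "q \<in> stereo ` ({None} \<union> Some ` {z. R \<le> cmod z})"
    proof (cases "w = 0")
      case True
      then have "q = stereo None" using w by (simp add: \<phi>_def)
      then show ?thesis by blast
    next
      case False
      then have "R \<le> cmod (1 / w)" using w(2) assms by (simp add: norm_divide field_simps)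
      moreover have "q = stereo (Some (1 / w))" unfolding w(1) by (rule \<phi>[OF False])
      ultimately show ?thesis by blast
    qed
  qed
  then show ?thesis
    using compact_continuous_image[OF continuous_on_subset[OF cont subset_UNIV] compact_cball] by simp
qed

section \<open>Convergence of the approximants\<close>

lemma kernel_lipschitz:
  assumes "t = 0 \<or> d \<le> cmod (complex_of_real t - a)" "0 < d" "cmod (z - a) \<le> d / 2" "\<bar>t\<bar> \<le> R"
  shows "cmod (kernel z t - kernel a t)
    \<le> 2 * R / d\<^sup>2 * cmod (z - a)"
proof (cases "t = 0")
  case True
  then show ?thesis using assms by simp
next
  case False
  then have da: "d \<le> cmod (complex_of_real t - a)" using assms by simp
  have "complex_of_real t - a = (complex_of_real t - z) + (z - a)" by simp
  then have dz: "d / 2 \<le> cmod (complex_of_real t - z)"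
    using norm_triangle_ineq[of "complex_of_real t - z" "z - a"] da assms(3) by simp
  have ne: "complex_of_real t - z \<noteq> 0" "complex_of_real t - a \<noteq> 0" using da dz assms(2) by auto
  have "kernel z t - kernel a t
      = complex_of_real t * (z - a) / ((complex_of_real t - z) * (complex_of_real t - a))"
    using ne by (simp add: field_simps)
  then have "cmod (kernel z t - kernel a t)
      = \<bar>t\<bar> * cmod (z - a) / (cmod (complex_of_real t - z) * cmod (complex_of_real t - a))"
    by (simp add: norm_mult norm_divide)
  also have "\<dots> \<le> R * cmod (z - a) / ((d / 2) * d)"
  proof (rule frac_le)
    show "d / 2 * d \<le> cmod (complex_of_real t - z) * cmod (complex_of_real t - a)"
      using da dz assms(2) by (intro mult_mono) auto
    show "\<bar>t\<bar> * cmod (z - a) \<le> R * cmod (z - a)" using assms(4) by (rule mult_right_mono) simp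
    show "0 \<le> R * cmod (z - a)" using assms(4) by (intro mult_nonneg_nonneg) auto
  qed (use assms(2) in simp)
  also have "\<dots> = 2 * R / d\<^sup>2 * cmod (z - a)" by (simp add: power2_eq_square)
  finally show ?thesis .
qed

lemma kernel_bound_far:
  assumes "\<bar>t\<bar> \<le> R" "R < cmod z"
  shows "cmod (kernel z t) \<le> R / (cmod z - R)"
proof -
  have "cmod z - \<bar>t\<bar> \<le> cmod (complex_of_real t - z)"
    using norm_triangle_ineq2[of z "complex_of_real t"] by (simp add: norm_minus_commute)
  then show ?thesis using assms by (auto simp: norm_divide intro!: frac_le)
qed

lemma open_separation:
  fixes T :: "real set"
  assumes "compact T" "z \<notin> complex_of_real ` T"
  shows "\<exists>d>0. \<forall>t\<in>T. d \<le> cmod (complex_of_real t - z)"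
proof -
  have "compact (complex_of_real ` T)" using assms(1) by (intro compact_continuous_image continuous_intros)
  then obtain d where "d > 0" "\<forall>x\<in>complex_of_real ` T. d \<le> dist z x"
    using separate_point_closed[OF compact_imp_closed assms(2)] by blast
  then show ?thesis by (auto simp: dist_norm norm_minus_commute)
qed

lemma complex_polynomial_approximation:
  fixes f :: "real \<Rightarrow> complex"
  assumes "compact S" "continuous_on S f" "e > 0"
  shows "\<exists>(p :: real poly) (q :: real poly).
    \<forall>t\<in>S. cmod (f t - (complex_of_real (poly p t) + \<i> * complex_of_real (poly q t))) < e"
proof -
  obtain g where g: "polynomial_function g" "\<And>t. t \<in> S \<Longrightarrow> cmod (f t - g t) < e"
    using Stone_Weierstrass_polynomial_function[OF assms] by blast
  have ex: "\<exists>p. \<forall>t. poly p t = h t" if hp: "real_polynomial_function h" for h :: "real \<Rightarrow> real"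
  proof -
    obtain a n where "h = (\<lambda>x. \<Sum>i\<le>n. a i * x ^ i)"
      using hp unfolding real_polynomial_function_iff_sum by blast
    then have "\<forall>t. poly (\<Sum>i\<le>n. monom (a i) i) t = h t" by (simp add: poly_sum poly_monom)
    then show ?thesis ..
  qed
  have "real_polynomial_function (Re \<circ> g)" "real_polynomial_function (Im \<circ> g)"
    using g(1) bounded_linear_Re bounded_linear_Im unfolding polynomial_function_def by blast+
  then obtain p q where "\<And>t. poly p t = Re (g t)" "\<And>t. poly q t = Im (g t)"
    using ex[of "Re \<circ> g"] ex[of "Im \<circ> g"] by auto
  then have "g t = complex_of_real (poly p t) + \<i> * complex_of_real (poly q t)" for t
    by (simp add: complex_eq_iff)
  then show ?thesis using g(2) by auto
qed

context two_interval_measure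
begin

text \<open>The two intervals, prolonged at the outer ends.\<close>

definition segments :: "real \<Rightarrow> real set" where
  "segments \<epsilon> = {- 1 - \<epsilon>..\<alpha>} \<union> {\<beta>..1 + \<epsilon>}"

text \<open>The nodes and weights of the quadrature rule that belongs to the \<open>j\<close>-th normal index.\<close>

abbreviation X :: "nat \<Rightarrow> real set" where "X j \<equiv> nodes (nu j) (tau (nu j))"

abbreviation (input) wt :: "nat \<Rightarrow> real \<Rightarrow> complex" where "wt j x \<equiv> complex_of_real (weight (X j) x)"

lemma compact_segments: "compact (segments \<epsilon>)"
  by (simp add: segments_def compact_Un)

lemma E_subset_segments: "\<epsilon> \<ge> 0 \<Longrightarrow> E \<subseteq> segments \<epsilon>"
  by (auto simp: E_def segments_def)

lemma quad_eq: "quad_transform (nu j) z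
    = (\<Sum>x\<in>X j. wt j x * (kernel z x))"
  by (simp add: quad_transform_def)

lemma quad_sum_bound:
  assumes "\<And>x. x \<in> X j \<Longrightarrow> cmod (f x) \<le> B"
  shows "cmod (\<Sum>x\<in>X j. wt j x * f x) \<le> I 1 * B"
proof -
  have "cmod (\<Sum>x\<in>X j. wt j x * f x) \<le> (\<Sum>x\<in>X j. weight (X j) x * B)"
    by (rule sum_norm_le) (use assms weight_pos in \<open>auto simp: norm_mult abs_of_pos intro!: mult_left_mono less_imp_le\<close>)
  also have "\<dots> = I 1 * B" by (simp add: sum_distrib_right[symmetric] weight_sum)
  finally show ?thesis .
qed

lemma integral_bound:
  fixes f :: "real \<Rightarrow> complex"
  assumes "f \<in> borel_measurable borel" "\<And>t. t \<in> E \<Longrightarrow> cmod (f t) \<le> B"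
  shows "cmod (\<integral>t. f t \<partial>\<sigma>) \<le> I 1 * B"
proof -
  have int: "integrable \<sigma> f" by (rule integrable_bounded_E[OF assms])
  have "cmod (\<integral>t. f t \<partial>\<sigma>) \<le> (\<integral>t. cmod (f t) \<partial>\<sigma>)" by (rule integral_norm_bound)
  also have "\<dots> \<le> (\<integral>t. B \<partial>\<sigma>)"
    using int AE_E assms(2) by (intro integral_mono_AE integrable_norm) (auto elim: eventually_mono)
  also have "\<dots> = I 1 * B" by (simp add: I_def)
  finally show ?thesis .
qed

text \<open>The quadrature measures converge weakly to \<open>\<sigma>\<close> as long as the nodes stay in a compact set.\<close>

lemma quadrature_converges:
  fixes f :: "real \<Rightarrow> complex"
  assumes S: "compact S" "E \<subseteq> S" "\<And>j. X j \<subseteq> S"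
    and f: "continuous_on S f" "f \<in> borel_measurable borel"
  shows "(\<lambda>j. \<Sum>x\<in>X j. wt j x * f x) \<longlonglongrightarrow> (\<integral>t. f t \<partial>\<sigma>)"
proof (rule LIMSEQ_I)
  fix r :: real assume r: "r > 0"
  define e where "e = r / (3 * I 1)"
  have e: "e > 0" "I 1 * e = r / 3" using r I_1_pos by (simp_all add: e_def)
  obtain p q where pq: "\<And>t. t \<in> S \<Longrightarrow>
      cmod (f t - (complex_of_real (poly p t) + \<i> * complex_of_real (poly q t))) < e"
    using complex_polynomial_approximation[OF S(1) f(1) e(1)] by blast
  let ?g = "\<lambda>t. complex_of_real (poly p t) + \<i> * complex_of_real (poly q t)"
  have gm: "?g \<in> borel_measurable borel" by measurable
  have gint: "integrable \<sigma> ?g"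
    by (intro Bochner_Integration.integrable_add integrable_mult_right integrable_of_real integrable_poly)
  obtain Bf where Bf: "\<And>t. t \<in> S \<Longrightarrow> cmod (f t) \<le> Bf"
    using compact_imp_bounded[OF compact_continuous_image[OF f(1) S(1)]] unfolding bounded_iff by auto
  have fint: "integrable \<sigma> f" using Bf S(2) by (intro integrable_bounded_E[OF f(2)]) blast
  have "cmod ((\<integral>t. f t \<partial>\<sigma>) - (\<integral>t. ?g t \<partial>\<sigma>)) = cmod (\<integral>t. f t - ?g t \<partial>\<sigma>)"
    using fint gint by simp
  also have "\<dots> \<le> I 1 * e"
    using pq S(2) f(2) gm by (intro integral_bound borel_measurable_diff) (auto intro: less_imp_le)
  finally have d1: "cmod ((\<integral>t. f t \<partial>\<sigma>) - (\<integral>t. ?g t \<partial>\<sigma>)) \<le> r / 3" by (simp add: e)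
  have gI: "(\<integral>t. ?g t \<partial>\<sigma>) = complex_of_real (I p) + \<i> * complex_of_real (I q)"
    using integrable_poly[of p] integrable_poly[of q]
    by (subst Bochner_Integration.integral_add) (auto simp: I_def)
  show "\<exists>N. \<forall>j\<ge>N. norm ((\<Sum>x\<in>X j. wt j x * f x) - (\<integral>t. f t \<partial>\<sigma>)) < r"
  proof (intro exI allI impI)
    fix j assume j: "degree p + degree q \<le> j"
    have "j \<le> nu j" using strict_mono_imp_increasing[OF nu_strict_mono] .
    then have "degree p \<le> 2 * nu j" "degree q \<le> 2 * nu j" using j by auto
    note pq_sum = this[THEN quadrature, of "tau (nu j)"]
    have gQ: "(\<integral>t. ?g t \<partial>\<sigma>) = (\<Sum>x\<in>X j. wt j x * ?g x)"
    proof -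
      have "(\<Sum>x\<in>X j. wt j x * ?g x)
          = (\<Sum>x\<in>X j. complex_of_real (weight (X j) x * poly p x))
            + \<i> * (\<Sum>x\<in>X j. complex_of_real (weight (X j) x * poly q x))"
        unfolding sum_distrib_left sum.distrib[symmetric]
        by (intro sum.cong refl) (simp add: algebra_simps)
      then show ?thesis unfolding gI pq_sum of_real_sum by simp
    qed
    have "(\<Sum>x\<in>X j. wt j x * f x) - (\<integral>t. ?g t \<partial>\<sigma>)
        = (\<Sum>x\<in>X j. wt j x * (f x - ?g x))"
      unfolding gQ by (simp add: sum_subtractf right_diff_distrib)
    also have "cmod \<dots> \<le> I 1 * e"
      using pq S(3) by (intro quad_sum_bound) (blast intro: less_imp_le)
    finally have "cmod ((\<Sum>x\<in>X j. wt j x * f x) - (\<integral>t. ?g t \<partial>\<sigma>)) \<le> r / 3"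
      by (simp add: e)
    then have "cmod ((\<Sum>x\<in>X j. wt j x * f x) - (\<integral>t. f t \<partial>\<sigma>)) \<le> r / 3 + r / 3"
      using d1 norm_triangle_ineq4[of "(\<Sum>x\<in>X j. wt j x * f x) - (\<integral>t. ?g t \<partial>\<sigma>)"
        "(\<integral>t. f t \<partial>\<sigma>) - (\<integral>t. ?g t \<partial>\<sigma>)"] by simp
    then show "norm ((\<Sum>x\<in>X j. wt j x * f x) - (\<integral>t. f t \<partial>\<sigma>)) < r"
      using r by simp
  qed
qed

lemma \<Psi>_1_apply: "\<Psi> 1 z = (\<integral>t. kernel z t \<partial>\<sigma>)"
  by (simp only: \<Psi>_1)

lemma transform_lipschitz:
  assumes "0 < d" "\<And>t. t \<in> E \<Longrightarrow> d \<le> cmod (complex_of_real t - a)" "cmod (z - a) \<le> d / 2"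
  shows "cmod (\<Psi> 1 z - \<Psi> 1 a) \<le> I 1 * (2 * 1 / d\<^sup>2 * cmod (z - a))"
proof -
  have b: "cmod (kernel y t) \<le> 1 / (d / 2)"
    if "t \<in> E" "cmod (y - a) \<le> d / 2" for t y
  proof -
    have "d \<le> cmod (complex_of_real t - y) + cmod (y - a)"
      using norm_triangle_ineq[of "complex_of_real t - y" "y - a"] assms(2)[OF that(1)] by simp
    then have "d / 2 \<le> cmod (complex_of_real t - y)" using that(2) by simp
    moreover have "\<bar>t\<bar> \<le> 1" using that(1) E_bounds by (auto simp: abs_le_iff)
    ultimately have "\<bar>t\<bar> / cmod (complex_of_real t - y) \<le> 1 / (d / 2)"
      using assms(1) by (intro frac_le) auto
    then show ?thesis by (simp only: norm_divide norm_of_real)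
  qed
  have m: "(\<lambda>t. kernel y t) \<in> borel_measurable borel" for y by measurable
  have i: "integrable \<sigma> (\<lambda>t. kernel y t)" if "cmod (y - a) \<le> d / 2" for y
    using b[OF _ that] by (intro integrable_bounded_E[OF m]) auto
  have "\<Psi> 1 z - \<Psi> 1 a = (\<integral>t. kernel z t
      - kernel a t \<partial>\<sigma>)"
    unfolding \<Psi>_1_apply using i[OF assms(3)] i[of a] assms(1) by simp
  also have "cmod \<dots> \<le> I 1 * (2 * 1 / d\<^sup>2 * cmod (z - a))"
  proof (rule integral_bound)
    fix t assume t: "t \<in> E"
    then have "\<bar>t\<bar> \<le> 1" using E_bounds by (auto simp: abs_le_iff)
    then show "cmod (kernel z t - kernel a t)
        \<le> 2 * 1 / d\<^sup>2 * cmod (z - a)"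
      using assms t by (intro kernel_lipschitz) auto
  qed (intro borel_measurable_diff m)
  finally show ?thesis .
qed

lemma transform_bound_far:
  assumes "1 < cmod z"
  shows "cmod (\<Psi> 1 z) \<le> I 1 * (1 / (cmod z - 1))"
  unfolding \<Psi>_1_apply
proof (rule integral_bound)
  fix t assume "t \<in> E"
  then have "\<bar>t\<bar> \<le> 1" using E_bounds by (auto simp: abs_le_iff)
  then show "cmod (kernel z t) \<le> 1 / (cmod z - 1)"
    using assms by (rule kernel_bound_far)
qed measurable

lemma sphere_map_transform: "z \<notin> complex_of_real ` E \<Longrightarrow> sphere_map (\<Psi> 1) (Some z) = Some (\<Psi> 1 z)"
proof -
  assume z: "z \<notin> complex_of_real ` E"
  have "compact E" by (simp add: E_def compact_Un)
  then obtain d where d: "d > 0" "\<And>t. t \<in> E \<Longrightarrow> d \<le> cmod (complex_of_real t - z)"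
    using open_separation[OF _ z] by blast
  have "((\<lambda>y. I 1 * (2 * 1 / d\<^sup>2 * cmod (y - z))) \<longlongrightarrow> I 1 * (2 * 1 / d\<^sup>2 * cmod (z - z))) (at z)"
    using d(1) by (intro tendsto_intros) auto
  then have "((\<lambda>y. I 1 * (2 * 1 / d\<^sup>2 * cmod (y - z))) \<longlongrightarrow> 0) (at z)" by simp
  moreover have "\<forall>\<^sub>F y in at z. norm (\<Psi> 1 y - \<Psi> 1 z) \<le> I 1 * (2 * 1 / d\<^sup>2 * cmod (y - z))"
    unfolding eventually_at
    using d transform_lipschitz[OF d] by (intro exI[of _ "d / 2"]) (auto simp: dist_norm)
  ultimately have "((\<lambda>y. \<Psi> 1 y - \<Psi> 1 z) \<longlongrightarrow> 0) (at z)" by (rule Lim_null_comparison[rotated])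
  then have "(\<Psi> 1 \<longlongrightarrow> \<Psi> 1 z) (at z)" by (rule LIM_zero_cancel)
  then show ?thesis by (rule sphere_map_Some)
qed

lemma tendsto_0_far:
  fixes g :: "complex \<Rightarrow> complex"
  assumes "\<And>z. R < cmod z \<Longrightarrow> cmod (g z) \<le> K * (R / (cmod z - R))"
  shows "(g \<longlongrightarrow> 0) at_infinity"
proof (rule Lim_null_comparison)
  show "\<forall>\<^sub>F z in at_infinity. norm (g z) \<le> K * (R / (cmod z - R))"
    unfolding eventually_at_infinity using assms by (intro exI[of _ "R + 1"]) auto
  have "filterlim (\<lambda>z::complex. cmod z - R) at_top at_infinity"
    using filterlim_tendsto_add_at_top[OF tendsto_const[of "- R"] filterlim_norm_at_top]
    by (simp add: add.commute)
  then have "((\<lambda>z::complex. R / (cmod z - R)) \<longlongrightarrow> 0) at_infinity"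
    by (intro tendsto_divide_0[OF tendsto_const] filterlim_at_top_imp_at_infinity)
  then show "((\<lambda>z::complex. K * (R / (cmod z - R))) \<longlongrightarrow> 0) at_infinity"
    by (rule tendsto_mult_right_zero)
qed

lemma sphere_map_transform_None: "sphere_map (\<Psi> 1) None = Some 0"
  using transform_bound_far by (intro sphere_map_None tendsto_0_far[where R = 1 and K = "I 1"])

lemma quad_bound_far:
  assumes "\<And>x. x \<in> X j \<Longrightarrow> \<bar>x\<bar> \<le> R" "R < cmod z"
  shows "cmod (quad_transform (nu j) z) \<le> I 1 * (R / (cmod z - R))"
  unfolding quad_eq by (intro quad_sum_bound kernel_bound_far assms)

lemma quad_lipschitz:
  assumes "0 < d" "\<And>x. x \<in> X j \<Longrightarrow> x = 0 \<or> d \<le> cmod (complex_of_real x - a)"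
    "cmod (z - a) \<le> d / 2" "\<And>x. x \<in> X j \<Longrightarrow> \<bar>x\<bar> \<le> R"
  shows "cmod (quad_transform (nu j) z - quad_transform (nu j) a) \<le> I 1 * (2 * R / d\<^sup>2 * cmod (z - a))"
proof -
  have "quad_transform (nu j) z - quad_transform (nu j) a
      = (\<Sum>x\<in>X j. wt j x *
         (kernel z x - kernel a x))"
    unfolding quad_eq by (simp add: sum_subtractf right_diff_distrib)
  also have "cmod \<dots> \<le> I 1 * (2 * R / d\<^sup>2 * cmod (z - a))"
    using assms by (intro quad_sum_bound kernel_lipschitz) auto
  finally show ?thesis .
qed

text \<open>The only node in the gap is the origin, and a bound on the parameters bounds the nodes.\<close>

lemma nodes_subset_segments:
  assumes "\<bar>tau (nu j)\<bar> \<le> K"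
  shows "X j \<subseteq> segments K \<union> {0}"
proof
  fix y assume y: "y \<in> X j"
  have b: "\<bar>y\<bar> \<le> 1 + K" using node_bound[OF y] assms by linarith
  have "y = 0" if "\<alpha> < y" "y < \<beta>"
  proof (rule ccontr)
    assume "y \<noteq> 0"
    then obtain t where t: "t \<in> E" "(t - 0) * (t - y) < 0"
      using nodes_separated[OF zero_node[OF nu_nonzero] y] by auto
    then consider "t \<le> \<alpha>" | "\<beta> \<le> t" by (auto simp: E_def)
    then show False
    proof cases
      case 1
      then have "0 \<le> (t - 0) * (t - y)" using that bounds by (intro mult_nonpos_nonpos) auto
      then show False using t by simp
    next
      case 2
      then have "0 \<le> (t - 0) * (t - y)" using that bounds by (intro mult_nonneg_nonneg) auto
      then show False using t by simp
    qed
  qed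
  then show "y \<in> segments K \<union> {0}" using b by (force simp: segments_def abs_le_iff)
qed

text \<open>The transforms of the quadrature measures converge pointwise by weak convergence, and they
  are Lipschitz in \<open>z\<close>, uniformly in \<open>j\<close>. At infinity all of them are small.\<close>

lemma bounded_imp_converges:
  assumes K: "\<And>j. \<bar>tau (nu j)\<bar> \<le> K"
  shows "converges_locally_uniformly (- (Some ` complex_of_real ` segments K))
    (\<lambda>j. sphere_map (quad_transform (nu j))) (sphere_map (\<Psi> 1))"
proof -
  let ?D = "- (Some ` complex_of_real ` segments K)"
  have K0: "K \<ge> 0" using K[of 0] by linarith
  define R where "R = 1 + K"
  have R: "R \<ge> 1" using K0 by (simp add: R_def)
  note XS = nodes_subset_segments[OF K]
  have XR: "\<bar>x\<bar> \<le> R" if "x \<in> X j" for x j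
    using node_bound[OF that] K[of j] by (simp add: R_def)
  have DSome: "z \<notin> complex_of_real ` segments K" if "Some z \<in> ?D" for z using that by auto
  define qv where "qv j w = (case w of None \<Rightarrow> 0 | Some z \<Rightarrow> quad_transform (nu j) z)" for j w
  define Fv where "Fv w = (case w of None \<Rightarrow> 0 | Some z \<Rightarrow> \<Psi> 1 z)" for w
  have qv: "sphere_map (quad_transform (nu j)) w = Some (qv j w)" if "w \<in> ?D" for j w
  proof (cases w)
    case None
    show ?thesis unfolding qv_def None
      using quad_bound_far[OF XR] by (simp add: sphere_map_None[OF tendsto_0_far[where R = R and K = "I 1"]])
  next
    case (Some z)
    have "(quad_transform (nu j) \<longlongrightarrow> quad_transform (nu j) z) (at z)"
      using XS[of j] DSome[of z] that Some by (intro quad_transform_tendsto) auto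
    then show ?thesis unfolding qv_def Some by (simp add: sphere_map_Some)
  qed
  have Fv: "sphere_map (\<Psi> 1) w = Some (Fv w)" if "w \<in> ?D" for w
  proof (cases w)
    case None
    then show ?thesis by (simp add: Fv_def sphere_map_transform_None del: One_nat_def)
  next
    case (Some z)
    then have "z \<notin> complex_of_real ` E" using DSome[of z] that E_subset_segments[OF K0] by blast
    then show ?thesis using Some by (simp add: Fv_def sphere_map_transform del: One_nat_def)
  qed
  \<comment> \<open>Near each point of the domain both functions are close to the value of the limit.\<close>
  have near: "\<exists>V N. open V \<and> stereo w0 \<in> V \<and> (\<forall>j\<ge>N. \<forall>w\<in>?D. stereo w \<in> V \<longrightarrow>
      cmod (qv j w - Fv w0) < \<eta> \<and> cmod (Fv w - Fv w0) < \<eta>)" if w0: "w0 \<in> ?D" and \<eta>: "\<eta> > 0" for w0 \<eta>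
  proof (cases w0)
    case None
    define \<rho> where "\<rho> = R + I 1 * R / \<eta> + 1"
    have \<rho>: "\<rho> > R" "\<rho> > 0" using R I_1_pos \<eta> by (simp_all add: \<rho>_def add_pos_nonneg)
    have small: "I 1 * (R' / (cmod z - R')) < \<eta>" if z: "cmod z > \<rho>" and R': "0 \<le> R'" "R' \<le> R" for z R'
    proof -
      have "I 1 * R / \<eta> < cmod z - R" using z by (simp add: \<rho>_def)
      then have "I 1 * R < \<eta> * (cmod z - R)" using \<eta> by (simp add: field_simps)
      moreover have "I 1 * R' \<le> I 1 * R" using R' I_1_pos by simp
      moreover have "\<eta> * (cmod z - R) \<le> \<eta> * (cmod z - R')" using R' \<eta> by simp
      ultimately have "I 1 * R' < \<eta> * (cmod z - R')" by linarith
      moreover have "cmod z - R' > 0" using z R' \<rho> by simp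
      ultimately show ?thesis by (simp add: field_simps)
    qed
    define V where "V = {p :: complex \<times> real. snd p > 1 - 2 / (1 + \<rho>\<^sup>2)}"
    have "open V" unfolding V_def by (intro open_Collect_less continuous_intros)
    moreover have "stereo w0 \<in> V" unfolding V_def None using add_pos_nonneg[of 1 "\<rho>\<^sup>2"] by simp
    moreover have "cmod (qv j w - Fv w0) < \<eta> \<and> cmod (Fv w - Fv w0) < \<eta>" if "stereo w \<in> V" for j w
    proof (cases w)
      case None
      then show ?thesis using \<open>w0 = None\<close> \<eta> by (simp add: qv_def Fv_def)
    next
      case (Some z)
      then have "1 - 2 / (1 + \<rho>\<^sup>2) < 1 - 2 / (1 + (cmod z)\<^sup>2)"
        using that unfolding V_def by (simp only: mem_Collect_eq snd_stereo_Some)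
      then have "2 / (1 + (cmod z)\<^sup>2) < 2 / (1 + \<rho>\<^sup>2)" by simp
      then have "1 + \<rho>\<^sup>2 < 1 + (cmod z)\<^sup>2"
        using add_pos_nonneg[of 1 "\<rho>\<^sup>2"] add_pos_nonneg[of 1 "(cmod z)\<^sup>2"] by (simp add: field_simps)
      then have z: "cmod z > \<rho>" using power2_less_imp_less[of \<rho> "cmod z"] by simp
      have "cmod (quad_transform (nu j) z) < \<eta>"
        using quad_bound_far[where j = j and z = z and R = R, OF XR] small[of z R] z \<rho> R by fastforce
      moreover have "cmod (\<Psi> 1 z) < \<eta>"
        using transform_bound_far[of z] small[of z 1] z \<rho> R by fastforce
      ultimately show ?thesis using Some \<open>w0 = None\<close> by (simp add: qv_def Fv_def)
    qed
    ultimately show ?thesis by blast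
  next
    case (Some a)
    have a: "a \<notin> complex_of_real ` segments K"
      by (rule DSome) (use w0 in \<open>unfold Some\<close>)
    obtain d where d: "d > 0" "\<And>t. t \<in> segments K \<Longrightarrow> d \<le> cmod (complex_of_real t - a)"
      using open_separation[OF compact_segments a] by blast
    have dX: "x = 0 \<or> d \<le> cmod (complex_of_real x - a)" if "x \<in> X j" for x j
      using XS[of j] that d(2) by blast
    have dE: "d \<le> cmod (complex_of_real t - a)" if "t \<in> E" for t
      using d(2) that E_subset_segments[OF K0] by blast
    define M where "M = I 1 * (2 * R / d\<^sup>2)"
    have M: "M > 0" using I_1_pos R d(1) by (simp add: M_def)
    define r where "r = min (d / 2) (\<eta> / (2 * M))"
    have r: "r > 0" "r \<le> d / 2" "M * r \<le> \<eta> / 2"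
    proof -
      show "r > 0" "r \<le> d / 2" using d(1) \<eta> M by (simp_all add: r_def)
      have "M * r \<le> M * (\<eta> / (2 * M))" using M by (intro mult_left_mono) (auto simp: r_def)
      then show "M * r \<le> \<eta> / 2" using M by simp
    qed
    have "(\<lambda>j. \<Sum>x\<in>X j. wt j x * (kernel a x))
        \<longlonglongrightarrow> (\<integral>t. kernel a t \<partial>\<sigma>)"
    proof (rule quadrature_converges[where S = "segments K \<union> {0}"])
      show "compact (segments K \<union> {0})" using compact_segments by (intro compact_Un) auto
      show "E \<subseteq> segments K \<union> {0}" using E_subset_segments[OF K0] by blast
      \<comment> \<open>Continuity on both closed pieces suffices, also for \<open>a = 0\<close>: then the origin is not in the
        segments, and the kernel takes the value 0 there.\<close>
      show "continuous_on (segments K \<union> {0}) (\<lambda>t. kernel a t)"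
      proof (rule continuous_on_closed_Un)
        show "continuous_on (segments K) (\<lambda>t. kernel a t)"
          using a by (intro continuous_intros) auto
      qed (auto intro: compact_imp_closed compact_segments)
    qed (use XS in auto)
    then have "(\<lambda>j. quad_transform (nu j) a) \<longlonglongrightarrow> \<Psi> 1 a" unfolding quad_eq \<Psi>_1_apply .
    then obtain N where N: "\<And>j. j \<ge> N \<Longrightarrow> cmod (quad_transform (nu j) a - \<Psi> 1 a) < \<eta> / 2"
      using LIMSEQ_D[of _ "\<Psi> 1 a" "\<eta> / 2"] \<eta> by fastforce
    define V where "V = {p :: complex \<times> real. snd p \<noteq> 1} \<inter>
      (\<lambda>p. fst p / complex_of_real (1 - snd p)) -` ball a r"
    have "open V" unfolding V_def
    proof (rule continuous_open_preimage)
      show "continuous_on {p :: complex \<times> real. snd p \<noteq> 1} (\<lambda>p. fst p / complex_of_real (1 - snd p))"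
        by (intro continuous_intros) auto
      show "open {p :: complex \<times> real. snd p \<noteq> 1}" by (intro open_Collect_neq continuous_intros)
    qed simp
    moreover have "stereo w0 \<in> V"
      unfolding V_def Some using stereo_inverse[of a] snd_stereo_less_1[of a] r(1)
      by (auto simp del: stereo.simps)
    moreover have "cmod (qv j w - Fv w0) < \<eta> \<and> cmod (Fv w - Fv w0) < \<eta>"
      if "j \<ge> N" "stereo w \<in> V" for j w
    proof (cases w)
      case None
      then show ?thesis using that by (simp add: V_def)
    next
      case w: (Some z)
      have "z \<in> ball a r" using that(2) unfolding V_def w Int_iff vimage_eq stereo_inverse by blast
      then have z: "cmod (z - a) < r" by (simp add: dist_norm norm_minus_commute)
      then have zd: "cmod (z - a) \<le> d / 2" using r(2) by simp
      have Mz: "M * cmod (z - a) < \<eta> / 2" using mult_strict_left_mono[OF z M] r(3) by simp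
      have "cmod (quad_transform (nu j) z - quad_transform (nu j) a) \<le> M * cmod (z - a)"
        using quad_lipschitz[where j = j and R = R, OF d(1) dX zd XR] by (simp add: M_def mult.assoc)
      then have q: "cmod (quad_transform (nu j) z - \<Psi> 1 a) < \<eta>"
        using N[OF that(1)] Mz norm_triangle_ineq[of "quad_transform (nu j) z - quad_transform (nu j) a"
          "quad_transform (nu j) a - \<Psi> 1 a"] by simp
      have "cmod (\<Psi> 1 z - \<Psi> 1 a) \<le> I 1 * (2 * 1 / d\<^sup>2) * cmod (z - a)"
        using transform_lipschitz[OF d(1) dE zd] by (simp add: mult.assoc)
      also have "\<dots> \<le> M * cmod (z - a)" unfolding M_def
        using R I_1_pos d(1) by (intro mult_right_mono mult_left_mono divide_right_mono) auto
      finally have "cmod (\<Psi> 1 z - \<Psi> 1 a) < \<eta>" using Mz \<eta> by simp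
      with q show ?thesis using w Some by (simp add: qv_def Fv_def)
    qed
    ultimately show ?thesis by blast
  qed
  show ?thesis unfolding converges_locally_uniformly_def
  proof (intro allI impI)
    fix Q assume QD: "Q \<subseteq> ?D" and comp: "compact (stereo ` Q)"
    show "uniform_limit Q (\<lambda>j z. stereo (sphere_map (quad_transform (nu j)) z))
        (\<lambda>z. stereo (sphere_map (\<Psi> 1) z)) sequentially"
      unfolding uniform_limit_iff
    proof (intro allI impI)
      fix e :: real assume e: "e > 0"
      have "\<exists>V N. open V \<and> stereo w0 \<in> V \<and> (\<forall>j\<ge>N. \<forall>w\<in>?D. stereo w \<in> V \<longrightarrow>
          dist (stereo (Some (qv j w))) (stereo (Some (Fv w))) < e)" if "w0 \<in> Q" for w0
      proof -
        obtain \<eta> where \<eta>: "\<eta> > 0" "\<And>y. cmod (y - Fv w0) < \<eta> \<Longrightarrow>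
            dist (stereo (Some y)) (stereo (Some (Fv w0))) < e / 2"
          using isCont_stereo_Some[of "Fv w0"] e unfolding continuous_at_eps_delta
          by (metis dist_norm half_gt_zero)
        have "w0 \<in> ?D" using that QD by (rule subsetD[rotated])
        from near[OF this \<eta>(1)] obtain V N where V: "open V" "stereo w0 \<in> V"
          and VN: "\<forall>j\<ge>N. \<forall>w\<in>?D. stereo w \<in> V \<longrightarrow>
            cmod (qv j w - Fv w0) < \<eta> \<and> cmod (Fv w - Fv w0) < \<eta>"
          by (elim exE conjE)
        have "dist (stereo (Some (qv j w))) (stereo (Some (Fv w))) < e"
          if "j \<ge> N" "w \<in> ?D" "stereo w \<in> V" for j w
        proof -
          have "cmod (qv j w - Fv w0) < \<eta>" "cmod (Fv w - Fv w0) < \<eta>" using VN that by simp_all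
          then show ?thesis by (rule dist_triangle_half_l[OF \<eta>(2) \<eta>(2)])
        qed
        then have "\<forall>j\<ge>N. \<forall>w\<in>?D. stereo w \<in> V \<longrightarrow>
            dist (stereo (Some (qv j w))) (stereo (Some (Fv w))) < e" by simp
        with V show ?thesis by (intro exI[of _ V] exI[of _ N]) (intro conjI)
      qed
      then obtain V N where VN: "\<And>w0. w0 \<in> Q \<Longrightarrow> open (V w0) \<and> stereo w0 \<in> V w0
          \<and> (\<forall>j\<ge>N w0. \<forall>w\<in>?D. stereo w \<in> V w0 \<longrightarrow>
          dist (stereo (Some (qv j w))) (stereo (Some (Fv w))) < e)"
        by metis
      have "\<And>w0. w0 \<in> Q \<Longrightarrow> open (V w0)" "stereo ` Q \<subseteq> (\<Union>w0\<in>Q. V w0)" using VN by blast+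
      then obtain Q' where Q': "Q' \<subseteq> Q" "finite Q'" "stereo ` Q \<subseteq> (\<Union>w0\<in>Q'. V w0)"
        using compactE_image[OF comp] by metis
      have "\<forall>\<^sub>F j in sequentially. \<forall>w0\<in>Q'. j \<ge> N w0"
        using Q'(2) by (intro eventually_ball_finite) (auto simp: eventually_ge_at_top)
      then show "\<forall>\<^sub>F j in sequentially. \<forall>w\<in>Q.
          dist (stereo (sphere_map (quad_transform (nu j)) w)) (stereo (sphere_map (\<Psi> 1) w)) < e"
      proof eventually_elim
        case (elim j)
        show ?case
        proof
          fix w assume w: "w \<in> Q"
          then obtain w0 where w0: "w0 \<in> Q'" "stereo w \<in> V w0" using Q'(3) by blast
          then have "dist (stereo (Some (qv j w))) (stereo (Some (Fv w))) < e"
            using VN[of w0] elim w QD Q'(1) by blast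
          then show "dist (stereo (sphere_map (quad_transform (nu j)) w)) (stereo (sphere_map (\<Psi> 1) w)) < e"
            using qv[of w j] Fv[of w] w QD by (metis subsetD)
        qed
      qed
    qed
  qed
qed

text \<open>Conversely, uniform convergence in a neighbourhood of infinity keeps the poles, hence all
  nodes, in a bounded set.\<close>

lemma converges_imp_bounded:
  assumes \<epsilon>: "\<epsilon> \<ge> 0" and conv: "converges_locally_uniformly (- (Some ` complex_of_real ` segments \<epsilon>))
    (\<lambda>j. sphere_map (quad_transform (nu j))) (sphere_map (\<Psi> 1))"
  shows "\<exists>K. \<forall>j. \<bar>tau (nu j)\<bar> \<le> K"
proof -
  define R where "R = 2 + \<epsilon>"
  let ?Q = "{None} \<union> Some ` {z. R \<le> cmod z}"
  have R: "R \<ge> 2" "R > 0" using \<epsilon> by (simp_all add: R_def)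
  have "?Q \<subseteq> - (Some ` complex_of_real ` segments \<epsilon>)"
    using \<epsilon> bounds by (auto simp: segments_def R_def abs_if split: if_splits)
  then have lim: "uniform_limit ?Q (\<lambda>j z. stereo (sphere_map (quad_transform (nu j)) z))
      (\<lambda>z. stereo (sphere_map (\<Psi> 1) z)) sequentially"
    using conv compact_exterior[OF R(2)] unfolding converges_locally_uniformly_def by blast
  define \<delta> where "\<delta> = 2 / (1 + (I 1)\<^sup>2)"
  have "\<delta> > 0" by (simp add: \<delta>_def add_pos_nonneg)
  then have "\<forall>\<^sub>F j in sequentially. \<forall>w\<in>?Q. dist (stereo (sphere_map (quad_transform (nu j)) w))
      (stereo (sphere_map (\<Psi> 1) w)) < \<delta>"
    using lim unfolding uniform_limit_iff by blast
  then obtain N where N: "\<And>j w. j \<ge> N \<Longrightarrow> w \<in> ?Q \<Longrightarrow>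
      dist (stereo (sphere_map (quad_transform (nu j)) w)) (stereo (sphere_map (\<Psi> 1) w)) < \<delta>"
    unfolding eventually_sequentially by blast
  have tb: "\<bar>tau (nu j)\<bar> \<le> R + 1" if j: "j \<ge> N" for j
  proof (rule parameter_bound)
    fix x assume x: "x \<in> X j"
    show "\<bar>x\<bar> \<le> R"
    proof (rule ccontr)
      assume "\<not> \<bar>x\<bar> \<le> R"
      then have xR: "\<bar>x\<bar> > R" "x \<noteq> 0" using R by auto
      let ?x = "complex_of_real x"
      have "Some ?x \<in> ?Q" using xR by auto
      from N[OF j this] have d: "dist (stereo None) (stereo (sphere_map (\<Psi> 1) (Some ?x))) < \<delta>"
        using quad_transform_pole[OF x xR(2)] by simp
      have "?x \<notin> complex_of_real ` E" using xR R E_bounds by fastforce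
      then have F: "sphere_map (\<Psi> 1) (Some ?x) = Some (\<Psi> 1 ?x)" by (rule sphere_map_transform)
      have "cmod (\<Psi> 1 ?x) \<le> I 1 * (1 / (cmod ?x - 1))"
        using xR R by (intro transform_bound_far) simp
      also have "\<dots> \<le> I 1 * 1" using xR R I_1_pos by (intro mult_left_mono) auto
      finally have "(cmod (\<Psi> 1 ?x))\<^sup>2 \<le> (I 1)\<^sup>2" by (intro power_mono) auto
      then have "\<delta> \<le> 2 / (1 + (cmod (\<Psi> 1 ?x))\<^sup>2)"
        unfolding \<delta>_def by (intro divide_left_mono mult_pos_pos add_pos_nonneg) auto
      also have "\<dots> = snd (stereo None) - snd (stereo (Some (\<Psi> 1 ?x)))" unfolding snd_stereo_Some by simp
      also have "\<dots> \<le> dist (snd (stereo None)) (snd (stereo (Some (\<Psi> 1 ?x))))"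
        by (simp only: dist_real_def abs_ge_self)
      also have "\<dots> \<le> dist (stereo None) (stereo (Some (\<Psi> 1 ?x)))" by (rule dist_snd_le)
      finally show False using d unfolding F by simp
    qed
  qed
  have "\<bar>tau (nu j)\<bar> \<le> R + 1 + (\<Sum>i<N. \<bar>tau (nu i)\<bar>)" for j
  proof (cases "j < N")
    case True
    then have "\<bar>tau (nu j)\<bar> \<le> (\<Sum>i<N. \<bar>tau (nu i)\<bar>)" by (intro member_le_sum) auto
    then show ?thesis using R by simp
  next
    case False
    then have "\<bar>tau (nu j)\<bar> \<le> R + 1" using tb by simp
    moreover have "0 \<le> (\<Sum>i<N. \<bar>tau (nu i)\<bar>)" by (intro sum_nonneg) simp
    ultimately show ?thesis by linarith
  qed
  then show ?thesis by blast
qed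

lemma pade_transform:
  "pade (\<lambda>j. \<integral>t. t ^ (j + 1) \<partial>\<sigma>) (nu j) (nu j) = sphere_map (quad_transform (nu j))"
  by (rule pade_eq_quad_transform[OF nu_nonzero moment_eq])

end

section \<open>The equivalence\<close>

theorem theorem6p3:
  fixes \<alpha> \<beta> :: real and \<sigma> :: "real measure" and E :: "real set"
    and \<FF> :: "complex \<Rightarrow> complex" and \<ss> :: "nat \<Rightarrow> real" and \<nn> :: "nat \<Rightarrow> nat"
  assumes "- 1 \<le> \<alpha>" and "\<alpha> \<le> 0" and "0 \<le> \<beta>" and "\<beta> \<le> 1"
    and "E = {- 1..\<alpha>} \<union> {\<beta>..1}"
    and "borel_measure \<sigma>" and "emeasure \<sigma> (- E) = 0" and "infinite (msupport \<sigma>)"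
    and "\<FF> = (\<lambda>z. \<integral>t. complex_of_real t / (complex_of_real t - z) \<partial>\<sigma>)"
    and "\<FF> \<in> class_D_minus"
    and "\<ss> = (\<lambda>j. \<integral>t. t ^ (j + 1) \<partial>\<sigma>)"
    and "\<nn> = normal_index \<ss>"
  shows "(bounded_l2 (UL_factor_U \<nn> (gen_jacobi_matrix \<FF>) (\<ss> (\<nn> 1 - 1) / (\<integral>t. 1 \<partial>\<sigma>)))
            \<longleftrightarrow> bounded_l2 (LU_factor_U \<nn> (jacobi_matrix \<sigma>)))
       \<and> (bounded_l2 (LU_factor_U \<nn> (jacobi_matrix \<sigma>))
            \<longleftrightarrow> (\<exists>\<epsilon>\<ge>0. converges_locally_uniformly
                    (- (Some ` complex_of_real ` ({- 1 - \<epsilon>..\<alpha>} \<union> {\<beta>..1 + \<epsilon>})))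
                    (\<lambda>j. pade \<ss> (\<nn> j) (\<nn> j)) (sphere_map \<FF>)))"
proof -
  interpret M: two_interval_measure \<sigma> \<alpha> \<beta>
    by unfold_locales (use assms(1-8) in auto)
  have F: "\<FF> = M.\<Psi> 1" using assms(9) M.\<Psi>_1 by simp
  have n: "\<nn> = M.nu" unfolding assms(11,12) by (rule M.normal_index_moments)
  have "UL_factor_U \<nn> (gen_jacobi_matrix \<FF>) (\<ss> (\<nn> 1 - 1) / (\<integral>t. 1 \<partial>\<sigma>))
      = LU_factor_U \<nn> (jacobi_matrix \<sigma>)"
    unfolding F n assms(11) by (rule M.UL_factor_P)
  moreover have "bounded_l2 (LU_factor_U \<nn> (jacobi_matrix \<sigma>)) \<longleftrightarrow> (\<exists>\<epsilon>\<ge>0. converges_locally_uniformly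
      (- (Some ` complex_of_real ` M.segments \<epsilon>)) (\<lambda>j. pade \<ss> (\<nn> j) (\<nn> j)) (sphere_map \<FF>))"
    unfolding F n assms(11) M.pade_transform M.bounded_LU_factor
  proof
    assume "\<exists>K. \<forall>j. \<bar>M.tau (M.nu j)\<bar> \<le> K"
    then obtain K where K: "\<And>j. \<bar>M.tau (M.nu j)\<bar> \<le> K" by blast
    then have "K \<ge> 0" using abs_ge_zero order_trans by blast
    then show "\<exists>\<epsilon>\<ge>0. converges_locally_uniformly (- (Some ` complex_of_real ` M.segments \<epsilon>))
        (\<lambda>j. sphere_map (M.quad_transform (M.nu j))) (sphere_map (M.\<Psi> 1))"
      using M.bounded_imp_converges[OF K] by blast
  qed (use M.converges_imp_bounded in blast)
  ultimately show ?thesis unfolding M.segments_def by simp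
qed

end
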